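(* Let $\eta\in(0,1]$ and $q\in(0,1)$, let $\mu=\eta/q$, and let $(a_n,n\in\mathbb{N}^* )$ be a sequence of elements of $\mathbb{N}^*$. For $n\ge1$ let $\tau_n$ be a random tree distributed as the Galton-Watson tree $\tau$ with offspring distribution $\mathcal{G}(\eta,q)$ conditionally on $\{Z_n=a_n\}$. Assume that $\lim_{n\to\infty}a_n\mu^n=+\infty$ if $\mu<1$, or $\lim_{n\to\infty}a_nn^{-2}=+\infty$ if $\mu=1$, or $\lim_{n\to\infty}a_n\mu^{-n}=+\infty$ if $\mu>1$. Then $\tau_n$ converges in distribution to $\tau^\infty$ as $n\to\infty$.
   Context: Notation: $\mathbb{N}=\{0,1,2,\ldots\}$, $\mathbb{N}^*=\{1,2,\ldots\}$, $\bar{\mathbb{N}}=\mathbb{N}\cup\{+\infty\}$. Trees. Let $\mathcal{U}=\bigcup_{n\ge0}(\mathbb{N}^* )^n$ be the set of finite words, with $(\mathbb{N}^* )^0=\{\emptyset\}$; $|u|$ is the length of $u$. A tree is a subset $\mathbf{t}\subset\mathcal{U}$ containing $\emptyset$ (the root), containing with each $u$ all its prefixes (ancestors), and such that for every $u\in\mathbf{t}$ there is $k_u(\mathbf{t})\in\bar{\mathbb{N}}$ (the number of children of $u$) with $ui\in\mathbf{t}\iff 1\le i\le k_u(\mathbf{t})$ for every $i\in\mathbb{N}^*$. Put $k_u(\mathbf{t})=-1$ if $u\notin\mathbf{t}$. $\mathbb{T}_\infty$ is the set of all trees, with the topology in which $\mathbf{t}_n\to\mathbf{t}$ iff $k_u(\mathbf{t}_n)\to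 k_u(\mathbf{t})$ for all $u\in\mathcal{U}$, where $\{-1\}\cup\bar{\mathbb{N}}$ is the one-point compactification of the discrete space $\{-1\}\cup\mathbb{N}$. Convergence in distribution of random trees is weak convergence in $\mathbb{T}_\infty$. $\mathbb{T}_{\rm f}$ is the set of trees with all $k_u(\mathbf{t})<\infty$, $u\in\mathbf{t}$. The height is $H(\mathbf{t})=\sup\{|u|:u\in\mathbf{t}\}$, $z_n(\mathbf{t})=\#\{u\in\mathbf{t}:|u|=n\}$, and $r_h(\mathbf{t})=\{u\in\mathbf{t}:|u|\le h\}$. Offspring distribution. $\mathcal{G}(\eta,q)$ is the distribution $p$ on $\mathbb{N}$ with $p(0)=1-\eta$ and $p(k)=\eta q(1-q)^{k-1}$ for $k\ge1$. Its mean is $\mu=\eta/q$. Put $\gamma=\frac1{1-q}$, $\kappa=\frac{1-\eta}{1-q}$ and, for $n\ge1$, $\gamma_n=\frac{\kappa-\mu^n}{1-\mu^n}$ if $\mu\ne1$ and $\gamma_n=1+\frac{\gamma-1}{n}$ if $\mu=1$ (so $\gamma_1=\gamma$). Galton-Watson tree. $\tau$ is a $\mathbb{T}_{\rm f}$-valued random variable with $\mathbb{P}(r_h(\tau)=\mathbf{t})=\prod_{u\in r_{h-1}(\mathbf{t})}p(k_u(\mathbf{t}))$ for all $h\ge1$ and $\mathbf{t}\in\mathbb{T}_{\rm f}$ with $H(\mathbf{t})\le h$; $Z_n=z_n(\tau)$. The random tree $\tau^\infty$. For $n\ge1$ let $\tilde p_n(k)=\frac{\gamma_{n+1}^k}{\gamma_n}p(k)$,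 $k\in\mathbb{N}$ (a probability distribution on $\mathbb{N}$), and let $\tilde p_0$ be the Dirac mass at $+\infty$. Then $\tau^\infty$ is the inhomogeneous Galton-Watson tree in which all individuals reproduce independently, an individual at generation $h\in\mathbb{N}$ having a number of children with distribution $\tilde p_h$. In particular its root has infinitely many children and all other vertices have finitely many children. *)

theory Defs
  imports "HOL-Probability.Probability"
begin

section \<open>Trees\<close>

type_synonym word = "nat list"

definition words :: "word set" where
  "words = lists {1..}"

definition is_tree :: "word set \<Rightarrow> bool" where
  "is_tree T \<longleftrightarrow>
     T \<subseteq> words \<and> [] \<in> T \<and> (\<forall>u v. u @ v \<in> T \<longrightarrow> u \<in> T) \<and>
     (\<forall>u\<in>T. \<exists>k::enat. \<forall>i\<ge>1. u @ [i] \<in> T \<longleftrightarrow> enat i \<le> k)"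

typedef tree = "{T. is_tree T}" morphisms nodes Abs_tree
proof
  show "{[]} \<in> {T. is_tree T}"
    by (auto simp: is_tree_def words_def zero_enat_def intro!: exI[of _ 0])
qed

setup_lifting type_definition_tree

definition num_children :: "word \<Rightarrow> tree \<Rightarrow> enat" where
  "num_children u t = (THE k. \<forall>i\<ge>1. u @ [i] \<in> nodes t \<longleftrightarrow> enat i \<le> k)"

text \<open>
  The points of the one-point compactification of the discrete space
  \<open>{-1, 0, 1, \<dots>}\<close> are encoded as \<^typ>\<open>int option\<close>, with \<^const>\<open>None\<close> as the point
  at infinity. \<open>kids u t\<close> is $k_u(t)$ with values in that space.
\<close>

definition kids_space :: "int option topology" where
  "kids_space = Alexandroff_compactification (discrete_topology {-1..})"

definition kids :: "word \<Rightarrow> tree \<Rightarrow> int option" where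
  "kids u t =
     (if u \<in> nodes t
      then (case num_children u t of enat k \<Rightarrow> Some (int k) | \<infinity> \<Rightarrow> None)
      else Some (-1))"

definition height :: "tree \<Rightarrow> enat" where
  "height t = (SUP u\<in>nodes t. enat (length u))"

definition gen_size :: "nat \<Rightarrow> tree \<Rightarrow> enat" where
  "gen_size n t =
     (let L = {u \<in> nodes t. length u = n} in if finite L then enat (card L) else \<infinity>)"

lift_definition truncate :: "nat \<Rightarrow> tree \<Rightarrow> tree" is
  "\<lambda>h T. {u \<in> T. length u \<le> h}"
proof -
  fix h :: nat and T :: "word set"
  assume T: "is_tree T"
  show "is_tree {u \<in> T. length u \<le> h}"
    unfolding is_tree_def
  proof (intro conjI allI ballI impI)
    fix u assume u: "u \<in> {u \<in> T. length u \<le> h}"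
    show "\<exists>k::enat. \<forall>i\<ge>1. u @ [i] \<in> {u \<in> T. length u \<le> h} \<longleftrightarrow> enat i \<le> k"
    proof (cases "length u < h")
      case True
      then show ?thesis using T u unfolding is_tree_def by auto
    next
      case False
      then show ?thesis using u
        by (intro exI[of _ 0]) (auto simp: zero_enat_def)
    qed
  qed (use T in \<open>auto simp: is_tree_def\<close>)
qed

definition locally_finite_trees :: "tree set" where
  "locally_finite_trees = {t. \<forall>u\<in>nodes t. num_children u t < \<infinity>}"

section \<open>The topology of the space of trees\<close>

text \<open>The coarsest topology making all maps \<open>kids u\<close>, \<open>u \<in> words\<close>, continuous.\<close>

definition tree_topology :: "tree topology" where
  "tree_topology =
     pullback_topology UNIV (\<lambda>t. \<lambda>u\<in>words. kids u t) (product_topology (\<lambda>u. kids_space) words)"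

lemma kids_in_kids_space: "kids u t \<in> topspace kids_space"
  by (auto simp: kids_def kids_space_def split: enat.splits)

lemma topspace_tree_topology [simp]: "topspace tree_topology = UNIV"
  using kids_in_kids_space by (auto simp: tree_topology_def topspace_pullback_topology)

instantiation tree :: topological_space
begin

definition open_tree :: "tree set \<Rightarrow> bool" where
  "open_tree = openin tree_topology"

instance
proof
  show "open (UNIV :: tree set)"
    unfolding open_tree_def topspace_tree_topology[symmetric] by (rule openin_topspace)
qed (auto simp: open_tree_def)

end

text \<open>Convergence in distribution; the random variables may live on different spaces.\<close>

definition converges_in_distribution ::
    "(nat \<Rightarrow> 'a measure) \<Rightarrow> (nat \<Rightarrow> 'a \<Rightarrow> 'c::topological_space) \<Rightarrow>
     'b measure \<Rightarrow> ('b \<Rightarrow> 'c) \<Rightarrow> bool" where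
  "converges_in_distribution M X N Y \<longleftrightarrow>
     (\<forall>f :: 'c \<Rightarrow> real. continuous_on UNIV f \<and> bounded (range f) \<longrightarrow>
        (\<lambda>n. \<integral>\<omega>. f (X n \<omega>) \<partial>M n) \<longlonglongrightarrow> (\<integral>\<omega>. f (Y \<omega>) \<partial>N))"

definition random_tree :: "'a measure \<Rightarrow> ('a \<Rightarrow> tree) \<Rightarrow> bool" where
  "random_tree M T \<longleftrightarrow> prob_space M \<and> T \<in> borel_measurable M"

section \<open>Galton-Watson trees\<close>

definition galton_watson_tree :: "(nat \<Rightarrow> real) \<Rightarrow> 'a measure \<Rightarrow> ('a \<Rightarrow> tree) \<Rightarrow> bool" where
  "galton_watson_tree p M \<tau> \<longleftrightarrow>
     random_tree M \<tau> \<and> (\<forall>\<omega>\<in>space M. \<tau> \<omega> \<in> locally_finite_trees) \<and>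
     (\<forall>h\<ge>1. \<forall>t\<in>locally_finite_trees. height t \<le> enat h \<longrightarrow>
        measure M {\<omega> \<in> space M. truncate h (\<tau> \<omega>) = t} =
          (\<Prod>u\<in>nodes (truncate (h - 1) t). p (the_enat (num_children u t))))"

text \<open>
  Inhomogeneous Galton-Watson trees: independent numbers of children \<open>\<xi> u\<close>, \<open>u \<in> words\<close>, are
  attached to all words, \<open>\<xi> u\<close> having distribution \<open>\<nu> (length u)\<close>, and the tree consists of
  the words each letter of which is at most the number attached to the preceding prefix.
\<close>

lift_definition tree_of :: "(word \<Rightarrow> enat) \<Rightarrow> tree" is
  "\<lambda>\<xi>. {u \<in> words. \<forall>j<length u. enat (u ! j) \<le> \<xi> (take j u)}"
proof -
  fix \<xi> :: "word \<Rightarrow> enat"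
  show "is_tree {u \<in> words. \<forall>j<length u. enat (u ! j) \<le> \<xi> (take j u)}"
    (is "is_tree ?T")
    unfolding is_tree_def
  proof (intro conjI allI ballI impI)
    fix u v assume "u @ v \<in> ?T"
    then have uv: "u @ v \<in> words" "\<And>j. j < length (u @ v) \<Longrightarrow> enat ((u @ v) ! j) \<le> \<xi> (take j (u @ v))"
      by auto
    have "enat (u ! j) \<le> \<xi> (take j u)" if "j < length u" for j
      using uv(2)[of j] that by (simp add: nth_append)
    then show "u \<in> ?T" using uv(1) by (auto simp: words_def)
  next
    fix u assume u: "u \<in> ?T"
    have "u @ [i] \<in> ?T \<longleftrightarrow> enat i \<le> \<xi> u" if "i \<ge> 1" for i
      using u that by (auto simp: words_def less_Suc_eq nth_append)
    then show "\<exists>k::enat. \<forall>i\<ge>1. u @ [i] \<in> ?T \<longleftrightarrow> enat i \<le> k" by blast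
  qed (auto simp: words_def)
qed

definition inhom_gw_law :: "(nat \<Rightarrow> enat measure) \<Rightarrow> tree measure" where
  "inhom_gw_law \<nu> = distr (\<Pi>\<^sub>M u\<in>words. \<nu> (length u)) borel tree_of"

definition inhom_galton_watson_tree ::
    "(nat \<Rightarrow> enat measure) \<Rightarrow> 'a measure \<Rightarrow> ('a \<Rightarrow> tree) \<Rightarrow> bool" where
  "inhom_galton_watson_tree \<nu> M T \<longleftrightarrow> random_tree M T \<and> distr M borel T = inhom_gw_law \<nu>"

section \<open>The geometric offspring distribution and the limiting tree\<close>

definition geo_offspring :: "real \<Rightarrow> real \<Rightarrow> nat \<Rightarrow> real" where
  "geo_offspring \<eta> q k = (if k = 0 then 1 - \<eta> else \<eta> * q * (1 - q) ^ (k - 1))"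

definition gamma_seq :: "real \<Rightarrow> real \<Rightarrow> nat \<Rightarrow> real" where
  "gamma_seq \<eta> q n =
     (let \<mu> = \<eta> / q; \<gamma> = 1 / (1 - q); \<kappa> = (1 - \<eta>) / (1 - q)
      in if \<mu> \<noteq> 1 then (\<kappa> - \<mu> ^ n) / (1 - \<mu> ^ n) else 1 + (\<gamma> - 1) / real n)"

definition tilted_offspring :: "real \<Rightarrow> real \<Rightarrow> nat \<Rightarrow> nat \<Rightarrow> real" where
  "tilted_offspring \<eta> q n k =
     gamma_seq \<eta> q (n + 1) ^ k / gamma_seq \<eta> q n * geo_offspring \<eta> q k"

definition tilted_law :: "real \<Rightarrow> real \<Rightarrow> nat \<Rightarrow> enat measure" where
  "tilted_law \<eta> q h =
     (if h = 0 then return (count_space UNIV) \<infinity>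
      else distr (density (count_space UNIV) (\<lambda>k. ennreal (tilted_offspring \<eta> q h k)))
             (count_space UNIV) enat)"

section \<open>Well-definedness\<close>

text \<open>
  The following facts ensure that the constants above have their intended meaning: the characteristic
  property of \<^const>\<open>num_children\<close>, the measurability of the events concerning \<^const>\<open>gen_size\<close>
  and \<^const>\<open>truncate\<close> and of the map \<^const>\<open>tree_of\<close> (without which \<^const>\<open>measure\<close>,
  \<^const>\<open>uniform_measure\<close> and \<^const>\<open>distr\<close> would be degenerate), and the fact that
  \<^const>\<open>tilted_law\<close> consists of probability distributions.
\<close>

lemma enat_eqI_le: "(\<And>i. i \<ge> 1 \<Longrightarrow> enat i \<le> k \<longleftrightarrow> enat i \<le> l) \<Longrightarrow> k = l"
proof (induction k l rule: linorder_wlog)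
  case (le k l)
  show ?case
  proof (rule ccontr)
    assume "k \<noteq> l"
    with le have "k < l" by auto
    then obtain m where m: "k = enat m" by (cases k) auto
    have "enat (Suc m) \<le> l" using \<open>k < l\<close> m by (simp add: Suc_ile_eq)
    then show False using le(2)[of "Suc m"] m by auto
  qed
qed metis

lemma num_children_eqI:
  assumes "\<And>i. i \<ge> 1 \<Longrightarrow> u @ [i] \<in> nodes t \<longleftrightarrow> enat i \<le> k"
  shows "num_children u t = k"
  unfolding num_children_def
proof (rule the_equality)
  fix k' assume "\<forall>i\<ge>1. u @ [i] \<in> nodes t \<longleftrightarrow> enat i \<le> k'"
  then show "k' = k" using assms by (intro enat_eqI_le) auto
qed (use assms in blast)

lemma num_children_iff:
  assumes "u \<in> nodes t" "i \<ge> 1"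
  shows "u @ [i] \<in> nodes t \<longleftrightarrow> enat i \<le> num_children u t"
proof -
  have "is_tree (nodes t)" using nodes[of t] by simp
  then obtain k :: enat where k: "\<And>i. i \<ge> 1 \<Longrightarrow> u @ [i] \<in> nodes t \<longleftrightarrow> enat i \<le> k"
    using assms(1) unfolding is_tree_def by metis
  from num_children_eqI[OF k] k assms(2) show ?thesis by simp
qed

lemma kids_tree_of:
  "kids u (tree_of \<xi>) =
     (if u \<in> nodes (tree_of \<xi>) then (case \<xi> u of enat k \<Rightarrow> Some (int k) | \<infinity> \<Rightarrow> None)
      else Some (-1))"
proof (cases "u \<in> nodes (tree_of \<xi>)")
  case True
  have "num_children u (tree_of \<xi>) = \<xi> u"
    using True
    by (intro num_children_eqI) (auto simp: tree_of.rep_eq words_def less_Suc_eq nth_append)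
  then show ?thesis by (simp add: kids_def)
qed (simp add: kids_def)

definition tree_subbasis :: "tree set set" where
  "tree_subbasis =
     (\<lambda>(u, c). {t. kids u t = Some c}) ` UNIV \<union> (\<lambda>(u, c). {t. kids u t \<noteq> Some c}) ` UNIV"

lemma countable_tree_subbasis: "countable tree_subbasis"
  by (auto simp: tree_subbasis_def)

lemma open_kids:
  assumes "openin kids_space V"
  shows "open {t. kids u t \<in> V}"
proof (cases "u \<in> words")
  case True
  let ?F = "\<lambda>t. \<lambda>u\<in>words. kids u t"
  have "continuous_map tree_topology (product_topology (\<lambda>u. kids_space) words) ?F"
    unfolding tree_topology_def
    using continuous_map_pullback[of _ _ id UNIV ?F] by (simp add: continuous_map_id id_def[symmetric])
  then have "continuous_map tree_topology kids_space (\<lambda>t. ?F t u)"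
    using True by (subst (asm) continuous_map_componentwise) auto
  from openin_continuous_map_preimage[OF this assms] show ?thesis
    using True by (simp add: open_tree_def)
next
  case False
  then have "u \<notin> nodes t" for t using nodes[of t] by (auto simp: is_tree_def)
  then have "kids u t = Some (-1)" for t by (simp add: kids_def)
  then show ?thesis by (cases "Some (-1) \<in> V") auto
qed

lemma openin_kids_space_Some: "c \<ge> -1 \<Longrightarrow> openin kids_space {Some c}"
  unfolding kids_space_def openin_Alexandroff_compactification
  by (intro disjI1 exI[of _ "{c}"]) auto

lemma openin_kids_space_not_Some:
  "c \<ge> -1 \<Longrightarrow> openin kids_space (topspace kids_space - {Some c})"
  unfolding kids_space_def openin_Alexandroff_compactification
  by (intro disjI2 exI[of _ "{c}"]) (auto simp: closedin_def)

lemma kids_ge: "kids u t = Some c \<Longrightarrow> c \<ge> -1"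
  by (auto simp: kids_def split: if_splits enat.splits)

lemma open_tree_subbasis:
  assumes "S \<in> tree_subbasis" shows "open S"
proof -
  have "open {t. kids u t = Some c} \<and> open {t. kids u t \<noteq> Some c}" for u c
  proof (cases "c \<ge> -1")
    case True
    have "{t. kids u t \<noteq> Some c} = {t. kids u t \<in> topspace kids_space - {Some c}}"
      using kids_in_kids_space by auto
    then show ?thesis
      using open_kids[OF openin_kids_space_Some[OF True], of u]
        open_kids[OF openin_kids_space_not_Some[OF True], of u] by simp
  next
    case False
    then have "kids u t \<noteq> Some c" for t using kids_ge by blast
    then show ?thesis by simp
  qed
  then show ?thesis using assms by (auto simp: tree_subbasis_def)
qed

lemma open_tree_eq: "(open :: tree set \<Rightarrow> bool) = generate_topology tree_subbasis"
proof (intro ext iffI)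
  fix S :: "tree set"
  assume "generate_topology tree_subbasis S"
  then show "open S"
    by induction (auto simp: open_tree_subbasis)
next
  fix S :: "tree set"
  assume "open S"
  let ?F = "\<lambda>t. \<lambda>u\<in>words. kids u t"
  let ?G = "topology (generate_topology tree_subbasis)"
  have ist: "istopology (generate_topology tree_subbasis)"
    unfolding istopology_def by (auto intro: generate_topology.intros)
  then have G: "openin ?G = generate_topology tree_subbasis"
    by (rule topology_inverse')
  have topG: "topspace ?G = UNIV"
    by (metis G generate_topology.UNIV openin_subset top.extremum_uniqueI)
  from \<open>open S\<close> obtain U where U: "openin (product_topology (\<lambda>u. kids_space) words) U"
    "S = ?F -` U"
    by (auto simp: open_tree_def tree_topology_def openin_pullback_topology)
  have "continuous_map ?G kids_space (\<lambda>t. kids u t)" for u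
    unfolding continuous_map
  proof (intro conjI allI impI)
    show "kids u ` topspace ?G \<subseteq> topspace kids_space" using kids_in_kids_space by auto
  next
    fix V assume "openin kids_space V"
    then consider (Some) W where "V = Some ` W"
      | (None) C where "compactin (discrete_topology {-1..}) C"
          "V = insert None (Some ` ({-1..} - C))"
      unfolding kids_space_def openin_Alexandroff_compactification by auto
    then have "generate_topology tree_subbasis {t. kids u t \<in> V}"
    proof cases
      case Some
      have "{t. kids u t \<in> V} = \<Union> ((\<lambda>c. {t. kids u t = Some c}) ` W)"
        using Some by auto
      also have "generate_topology tree_subbasis \<dots>"
        by (rule generate_topology.UN)
           (auto simp: tree_subbasis_def intro!: generate_topology.Basis)
      finally show ?thesis .
    next
      case None
      have fin: "finite C" using None(1) by (simp add: compactin_discrete_topology)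
      have "{t. kids u t \<in> V} = (\<Inter>c\<in>C. {t. kids u t \<noteq> Some c})"
      proof (intro set_eqI iffI)
        fix t assume "t \<in> (\<Inter>c\<in>C. {t. kids u t \<noteq> Some c})"
        then show "t \<in> {t. kids u t \<in> V}"
          using None(2) kids_ge[of u t] by (cases "kids u t") auto
      qed (use None(2) in auto)
      also have "generate_topology tree_subbasis \<dots>"
        using fin
      proof induction
        case (insert c C)
        have "generate_topology tree_subbasis {t. kids u t \<noteq> Some c}"
          by (auto simp: tree_subbasis_def intro!: generate_topology.Basis)
        then show ?case using insert by (auto intro: generate_topology.Int)
      qed (auto intro: generate_topology.UNIV)
      finally show ?thesis .
    qed
    then show "openin ?G {t \<in> topspace ?G. kids u t \<in> V}" by (simp add: G topG)
  qed
  then have "continuous_map ?G (product_topology (\<lambda>u. kids_space) words) ?F"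
    by (subst continuous_map_componentwise) auto
  from openin_continuous_map_preimage[OF this U(1)]
  show "generate_topology tree_subbasis S"
    by (simp add: G topG U(2) vimage_def)
qed

instance tree :: second_countable_topology
proof
  show "\<exists>B::tree set set. countable B \<and> open = generate_topology B"
    using countable_tree_subbasis open_tree_eq by blast
qed

lemma borel_tree_eq: "(borel :: tree measure) = sigma UNIV tree_subbasis"
  by (rule second_countable_borel_measurable[OF open_tree_eq])

lemma pred_nodes [measurable]: "Measurable.pred borel (\<lambda>t. u \<in> nodes t)"
proof -
  have "{t. u \<in> nodes t} = {t. kids u t \<noteq> Some (-1)}"
    by (auto simp: kids_def split: enat.splits)
  moreover have "open {t. kids u t \<noteq> Some (-1)}"
    by (rule open_tree_subbasis) (auto simp: tree_subbasis_def)
  ultimately have "{t. u \<in> nodes t} \<in> sets borel"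
    by (metis borel_open)
  then show ?thesis by (simp add: pred_def)
qed

lemma sets_gen_size: "{t. gen_size n t = enat k} \<in> sets borel"
proof -
  let ?C = "{F :: word set. finite F \<and> card F = k}"
  have C: "countable ?C"
    by (rule countable_subset[OF _ countable_Collect_finite]) auto
  have "gen_size n t = enat k \<longleftrightarrow> (\<exists>F\<in>?C. \<forall>u. (u \<in> nodes t \<and> length u = n) \<longleftrightarrow> u \<in> F)" for t
  proof
    assume "gen_size n t = enat k"
    then show "\<exists>F\<in>?C. \<forall>u. (u \<in> nodes t \<and> length u = n) \<longleftrightarrow> u \<in> F"
      by (intro bexI[of _ "{u \<in> nodes t. length u = n}"])
         (auto simp: gen_size_def Let_def split: if_splits)
  next
    assume "\<exists>F\<in>?C. \<forall>u. (u \<in> nodes t \<and> length u = n) \<longleftrightarrow> u \<in> F"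
    then obtain F where "finite F" "card F = k" "{u \<in> nodes t. length u = n} = F" by blast
    then show "gen_size n t = enat k" by (simp add: gen_size_def)
  qed
  then have "{t. gen_size n t = enat k} =
      (\<Union>F\<in>?C. {t. \<forall>u. (u \<in> nodes t \<and> length u = n) \<longleftrightarrow> u \<in> F})"
    by auto
  also have "\<dots> \<in> sets borel"
  proof (rule sets.countable_UN'[OF C])
    have *: "{t. \<forall>u. (u \<in> nodes t \<and> length u = n) \<longleftrightarrow> u \<in> F} \<in> sets borel" for F
    proof -
      have "Measurable.pred borel (\<lambda>t. \<forall>u. (u \<in> nodes t \<and> length u = n) \<longleftrightarrow> u \<in> F)"
        by measurable
      then show ?thesis by (simp add: pred_def)
    qed
    show "(\<lambda>F. {t. \<forall>u. (u \<in> nodes t \<and> length u = n) \<longleftrightarrow> u \<in> F}) ` ?C \<subseteq> sets borel"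
      using * by blast
  qed
  finally show ?thesis .
qed

lemma sets_truncate: "{t. truncate h t = t'} \<in> sets borel"
proof -
  have "truncate h t = t' \<longleftrightarrow> (\<forall>u. (u \<in> nodes t \<and> length u \<le> h) \<longleftrightarrow> u \<in> nodes t')" for t
    by (simp add: nodes_inject[symmetric] truncate.rep_eq set_eq_iff)
  moreover have "Measurable.pred borel (\<lambda>t. \<forall>u. (u \<in> nodes t \<and> length u \<le> h) \<longleftrightarrow> u \<in> nodes t')"
    by measurable
  ultimately show ?thesis by (simp add: pred_def)
qed

lemma measurable_tree_of:
  assumes "\<And>h. sets (\<nu> h) = UNIV"
  shows "tree_of \<in> (\<Pi>\<^sub>M u\<in>words. \<nu> (length u)) \<rightarrow>\<^sub>M borel"
proof -
  let ?P = "\<Pi>\<^sub>M u\<in>words. \<nu> (length u)"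
  have sp: "space (\<nu> h) = UNIV" for h
    using assms[of h] sets.sets_into_space[of UNIV "\<nu> h"] by auto
  have comp [measurable]: "(\<lambda>\<xi>. \<xi> u) \<in> ?P \<rightarrow>\<^sub>M count_space UNIV" if "u \<in> words" for u
  proof -
    have "(\<lambda>\<xi>. \<xi> u) \<in> ?P \<rightarrow>\<^sub>M \<nu> (length u)" using that by simp
    moreover have "measurable ?P (\<nu> (length u)) = measurable ?P (count_space UNIV)"
      by (rule measurable_cong_sets) (auto simp: assms)
    ultimately show ?thesis by simp
  qed
  have node: "Measurable.pred ?P (\<lambda>\<xi>. u \<in> nodes (tree_of \<xi>))" for u
  proof (cases "u \<in> words")
    case True
    have tk: "take j u \<in> words" for j
      using True unfolding words_def by (meson in_lists_conv_set in_set_takeD)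
    have one: "Measurable.pred ?P (\<lambda>\<xi>. enat (u ! j) \<le> \<xi> (take j u))" for j
      by (rule measurable_compose[OF comp[OF tk]]) simp
    have "Measurable.pred ?P (\<lambda>\<xi>. \<forall>j\<in>{..<length u}. enat (u ! j) \<le> \<xi> (take j u))"
      by (intro pred_intros_finite one) simp
    moreover have "(\<lambda>\<xi>. u \<in> nodes (tree_of \<xi>)) =
        (\<lambda>\<xi>. \<forall>j\<in>{..<length u}. enat (u ! j) \<le> \<xi> (take j u))"
      using True by (auto simp: tree_of.rep_eq)
    ultimately show ?thesis by (simp only:)
  qed (simp add: tree_of.rep_eq)
  have kids: "(\<lambda>\<xi>. kids u (tree_of \<xi>)) \<in> ?P \<rightarrow>\<^sub>M count_space UNIV" for u
  proof (cases "u \<in> words")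
    case True
    show ?thesis unfolding kids_tree_of
    proof (rule measurable_If)
      show "(\<lambda>\<xi>. case \<xi> u of enat k \<Rightarrow> Some (int k) | \<infinity> \<Rightarrow> None) \<in> ?P \<rightarrow>\<^sub>M count_space UNIV"
        by (rule measurable_compose[OF comp[OF True]]) simp
    qed (use node in \<open>auto simp: pred_def\<close>)
  qed (simp add: kids_tree_of tree_of.rep_eq)
  show ?thesis
    unfolding borel_tree_eq
  proof (rule measurable_measure_of)
    fix S assume "S \<in> tree_subbasis"
    then obtain u A where S: "S = {t. kids u t \<in> A}"
      by (auto simp: tree_subbasis_def intro: that[of _ "{Some _}"] that[of _ "- {Some _}"])
    have "(\<lambda>\<xi>. kids u (tree_of \<xi>)) -` A \<inter> space ?P \<in> sets ?P"
      by (rule measurable_sets[OF kids]) simp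
    then show "tree_of -` S \<inter> space ?P \<in> sets ?P"
      by (simp add: S vimage_def)
  qed auto
qed

lemma gamma_seq_aux:
  assumes "0 < \<eta>" "\<eta> \<le> 1" "0 < q" "q < 1" "n \<ge> 1"
  shows "0 < gamma_seq \<eta> q n"
    and "(1 - q) * gamma_seq \<eta> q (n + 1) < 1"
    and "1 - \<eta> + \<eta> * q * gamma_seq \<eta> q (n + 1) / (1 - (1 - q) * gamma_seq \<eta> q (n + 1)) =
           gamma_seq \<eta> q n"
proof -
  define g where "g = gamma_seq \<eta> q n"
  define g' where "g' = gamma_seq \<eta> q (n + 1)"
  have "0 < g \<and> (1 - q) * g' < 1 \<and> 1 - \<eta> + \<eta> * q * g' / (1 - (1 - q) * g') = g"
  proof (cases "\<eta> = q")
    case True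
    have n: "real n > 0" using assms by simp
    have g: "g = 1 + q / ((1 - q) * n)"
      using assms True by (simp add: g_def gamma_seq_def field_simps)
    have g': "g' = 1 + q / ((1 - q) * (n + 1))"
      using assms True by (simp add: g'_def gamma_seq_def field_simps)
    have d: "1 - (1 - q) * g' = q * n / (n + 1)"
    proof -
      have "(1 - q) * (1 + q / ((1 - q) * c)) = (1 - q) + q / c" for c
        using assms by (simp only: distrib_left) simp
      from this[of "n + 1"] have "(1 - q) * g' = (1 - q) + q / (n + 1)"
        by (simp only: g')
      then show ?thesis using n by (simp add: field_simps)
    qed
    moreover have "q * n / (n + 1) > 0" using assms n by simp
    moreover have "1 - \<eta> + \<eta> * q * g' / (q * n / (n + 1)) = g"
    proof -
      have g'': "q * g' = q + q ^ 2 / ((1 - q) * (n + 1))"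
        by (simp add: g' distrib_left power2_eq_square)
      have "q * q * g' / (q * n / (n + 1)) = q * g' * (n + 1) / n"
        using assms n by (simp add: field_simps)
      also have "q * g' * (n + 1) = q * (n + 1) + q ^ 2 / (1 - q)"
      proof -
        have "q\<^sup>2 / ((1 - q) * c) * c = q\<^sup>2 / (1 - q)" if "c > 0" for c
          using that by simp
        from this[of "n + 1"] show ?thesis
          unfolding g'' distrib_right by simp
      qed
      also have "\<dots> = q * n + q / (1 - q)"
      proof -
        have "q + q ^ 2 / (1 - q) = q / (1 - q)"
          using assms by (simp add: field_simps power2_eq_square)
        then show ?thesis by (simp add: distrib_left)
      qed
      finally show ?thesis
        using n assms unfolding True g by (simp add: add_divide_distrib)
    qed
    moreover have "g > 0" using assms n by (simp add: g add_pos_nonneg)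
    ultimately show ?thesis by auto
  next
    case False
    define \<mu> where "\<mu> = \<eta> / q"
    define \<kappa> where "\<kappa> = (1 - \<eta>) / (1 - q)"
    define x where "x = \<mu> ^ n"
    have mu: "\<mu> > 0" "\<mu> \<noteq> 1" "\<eta> = \<mu> * q" using assms False by (auto simp: \<mu>_def)
    have g: "g = (\<kappa> - x) / (1 - x)" and g': "g' = (\<kappa> - \<mu> * x) / (1 - \<mu> * x)"
      using mu(2) unfolding g_def g'_def gamma_seq_def \<mu>_def[symmetric] \<kappa>_def[symmetric] Let_def
      by (simp_all add: x_def)
    have k: "\<kappa> * (1 - q) = 1 - \<eta>" using assms by (simp add: \<kappa>_def)
    consider (lt) "\<mu> < 1" "0 < x" "x < 1" "\<mu> * x < 1" "\<kappa> > 1"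
      | (gt) "\<mu> > 1" "x > 1" "\<mu> * x > 1" "\<kappa> < 1"
    proof (cases "\<mu> < 1")
      case True
      then have "x < 1" using mu assms power_less_one_iff[of \<mu> n] by (simp add: x_def)
      moreover have "0 < x" using mu by (simp add: x_def)
      moreover have "\<mu> * x < 1" using True mu power_less_one_iff[of \<mu> "Suc n"] by (simp add: x_def)
      moreover have "\<mu> * q < 1 * q" using True assms by (intro mult_strict_right_mono) auto
      then have "\<kappa> > 1" using assms mu(3) by (simp add: \<kappa>_def)
      ultimately show ?thesis using lt True by blast
    next
      case False
      then have 1: "\<mu> > 1" using mu by simp
      then have "x > 1" using assms one_less_power[of \<mu> n] by (simp add: x_def)
      moreover have "\<mu> * x > 1" using 1 one_less_power[of \<mu> "Suc n"] by (simp add: x_def)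
      moreover have "1 * q < \<mu> * q" using 1 assms by (intro mult_strict_right_mono) auto
      then have "\<kappa> < 1" using assms mu(3) by (simp add: \<kappa>_def)
      ultimately show ?thesis using gt 1 by blast
    qed
    note cases = this
    have ne: "1 - x \<noteq> 0" "1 - \<mu> * x \<noteq> 0" using cases by (cases; simp)+
    have "g > 0" using cases by cases (auto simp: g zero_less_divide_iff)
    have "1 - (1 - q) * g' = ((1 - \<mu> * x) - (\<kappa> * (1 - q) - (1 - q) * \<mu> * x)) / (1 - \<mu> * x)"
      using ne by (simp add: g' field_simps)
    also have "(1 - \<mu> * x) - (\<kappa> * (1 - q) - (1 - q) * \<mu> * x) = \<eta> * (1 - x)"
      unfolding k by (simp add: mu(3) algebra_simps)
    finally have d: "1 - (1 - q) * g' = \<eta> * (1 - x) / (1 - \<mu> * x)" .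
    have "1 - (1 - q) * g' > 0"
      unfolding d using cases by cases (use assms in \<open>auto simp: zero_less_divide_iff zero_less_mult_iff mult_less_0_iff\<close>)
    moreover have "\<eta> * q * g' / (1 - (1 - q) * g') = q * (\<kappa> - \<mu> * x) / (1 - x)"
      unfolding d unfolding g' using ne assms by (simp add: divide_simps)
    moreover have "1 - \<eta> + q * (\<kappa> - \<mu> * x) / (1 - x) = ((1 - \<eta>) * (1 - x) + q * (\<kappa> - \<mu> * x)) / (1 - x)"
      using ne by (simp add: field_simps)
    moreover have "(1 - \<eta>) * (1 - x) + q * (\<kappa> - \<mu> * x) = \<kappa> - x"
      using k by (simp add: algebra_simps mu(3))
    ultimately show ?thesis using \<open>g > 0\<close> by (simp add: g)
  qed
  then show "0 < gamma_seq \<eta> q n" "(1 - q) * gamma_seq \<eta> q (n + 1) < 1"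
    "1 - \<eta> + \<eta> * q * gamma_seq \<eta> q (n + 1) / (1 - (1 - q) * gamma_seq \<eta> q (n + 1)) =
       gamma_seq \<eta> q n"
    by (auto simp: g_def g'_def)
qed

lemma tilted_offspring_nonneg:
  assumes "0 < \<eta>" "\<eta> \<le> 1" "0 < q" "q < 1" "n \<ge> 1"
  shows "tilted_offspring \<eta> q n k \<ge> 0"
  using assms gamma_seq_aux(1)[OF assms] gamma_seq_aux(1)[OF assms(1-4), of "n + 1"]
  by (simp add: tilted_offspring_def geo_offspring_def)

lemma tilted_offspring_sums:
  assumes "0 < \<eta>" "\<eta> \<le> 1" "0 < q" "q < 1" "n \<ge> 1"
  shows "tilted_offspring \<eta> q n sums 1"
proof -
  define g where "g = gamma_seq \<eta> q n"
  define g' where "g' = gamma_seq \<eta> q (n + 1)"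
  note aux = gamma_seq_aux[OF assms, folded g_def g'_def]
  have "g' > 0" using gamma_seq_aux(1)[OF assms(1-4), of "n + 1"] by (simp add: g'_def)
  then have "\<bar>(1 - q) * g'\<bar> < 1" using aux(2) assms by simp
  then have "(\<lambda>k. ((1 - q) * g') ^ k) sums (1 / (1 - (1 - q) * g'))"
    by (intro geometric_sums) auto
  then have "(\<lambda>k. \<eta> * q * g' / g * ((1 - q) * g') ^ k) sums
      (\<eta> * q * g' / g * (1 / (1 - (1 - q) * g')))"
    by (rule sums_mult)
  also have "(\<lambda>k. \<eta> * q * g' / g * ((1 - q) * g') ^ k) = (\<lambda>k. tilted_offspring \<eta> q n (Suc k))"
    by (auto simp: tilted_offspring_def geo_offspring_def g_def[symmetric] g'_def[symmetric]
        power_mult_distrib)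
       (auto simp: g'_def)
  finally have "tilted_offspring \<eta> q n sums
      (\<eta> * q * g' / g * (1 / (1 - (1 - q) * g')) + tilted_offspring \<eta> q n 0)"
    by (simp add: sums_Suc_iff)
  also have "\<eta> * q * g' / g * (1 / (1 - (1 - q) * g')) + tilted_offspring \<eta> q n 0 =
      (1 - \<eta> + \<eta> * q * g' / (1 - (1 - q) * g')) / g"
    by (simp add: tilted_offspring_def geo_offspring_def g_def[symmetric] add_divide_distrib)
  also have "\<dots> = 1" using aux by simp
  finally show ?thesis .
qed

lemma sets_tilted_law: "sets (tilted_law \<eta> q h) = UNIV"
  by (simp add: tilted_law_def)

lemma prob_space_tilted_law:
  assumes "0 < \<eta>" "\<eta> \<le> 1" "0 < q" "q < 1"
  shows "prob_space (tilted_law \<eta> q h)"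
proof (cases "h = 0")
  case True
  then show ?thesis by (simp add: tilted_law_def prob_space_return)
next
  case False
  then have h: "h \<ge> 1" by simp
  have "(\<Sum>k. ennreal (tilted_offspring \<eta> q h k)) = 1"
    using suminf_ennreal_eq[OF tilted_offspring_nonneg[OF assms h] tilted_offspring_sums[OF assms h]]
    by simp
  then have "prob_space (density (count_space UNIV) (\<lambda>k. ennreal (tilted_offspring \<eta> q h k)))"
    by (intro prob_spaceI) (simp add: emeasure_density nn_integral_count_space_nat)
  from prob_space.prob_space_distr[OF this, of enat "count_space UNIV"] False
  show ?thesis by (simp add: tilted_law_def)
qed

end

theory Submission
  imports Defs
begin

text \<open>
  Let $f_n$ be the generating function of $Z_n$. It is linear fractional with its pole at
  $\gamma_n$, so $P(Z_n = k)$ is proportional to $\gamma_n^{-k}$ for $k \ge 1$.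

  Cut a tree down to its first $J$ generations and to the descendants of the first $J$ children of
  the root (\<open>prune\<close>), and fix a possible result \<open>s\<close> in which the root does have $J$ children. On
  the event that the Galton-Watson tree is cut down to \<open>s\<close>, generation $n$ consists of the
  descendants of the $z$ vertices of \<open>s\<close> at height $J$ and of those of the remaining children of
  the root. By the memoryless property of the geometric distribution the number of the latter
  children is again geometric, and the branching property (\<open>branching_property\<close>) turns this into
  $$E[x^{Z_n}; s] = P_s \, (1-q)^J \, (f_n(x) + c) \, f_{n-J}(x)^z,$$
  where $P_s$ is the product of the offspring probabilities of \<open>s\<close> at the heights $1, \dots, J-1$
  and $c$ is a constant (\<open>prob_prune_generation_size\<close>). Comparing the coefficients of $x^{a}$ here
  and in $f_n$ gives the conditional probability of the event given $Z_n = a$. As the law of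
  $Z_n$ is geometric away from 0, the quotient of the coefficients is
  $E[\gamma_n^Y; Y < a]$ plus a boundary term, where $Y$ is a sum of $z$ independent copies of
  $Z_{n-J}$, and $E[\gamma_n^Y] = f_{n-J}(\gamma_n)^z = \gamma_J^z$. Under the law tilted by
  $\gamma_n^Y$ the summands of $Y$ are geometric away from 0 with ratio
  $\gamma_n / \gamma_{n-J}$, so their size is of order $1 / (\gamma_n - 1)(\gamma_n - \kappa)$ at most.
  In each of the three regimes the hypothesis says that $a_n$ is much larger than that; hence the
  restriction to $Y < a_n$ and the boundary term disappear in the limit
  (\<open>coefficient_ratio_tendsto\<close>) and the conditional probability tends to
  $P_s (1-q)^J \gamma_J^z$. The weights $\gamma_{h+1}^k / \gamma_h$ of the tilted offspring laws
  telescope along the levels of \<open>s\<close> to the same value, which is therefore the probability that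
  $\tau^\infty$ is cut down to \<open>s\<close> (\<open>prob_prune_limit\<close>).

  It remains to pass from these events to continuous functions. Almost surely the root of
  $\tau^\infty$ is its only vertex with infinitely many children, and around such a tree the sets of
  all trees that are cut down to the same \<open>s\<close> form a basis of neighbourhoods as $J$ grows
  (\<open>prune_neighbourhoods\<close>). A nonnegative continuous function is thus the limit of its infima over
  these countably many cells, and two applications of Fatou's lemma give lower semicontinuity of
  the expectation (\<open>lower_semicontinuity_cells\<close>); applying this to $B + f$ and $B - f$ yields
  convergence.
\<close>

section \<open>Iterates of the linear fractional generating function\<close>

locale geometric_offspring =
  fixes \<eta> q :: real
  assumes eta_pos: "0 < \<eta>" and eta_le: "\<eta> \<le> 1" and q_pos: "0 < q" and q_less: "q < 1"
begin

text \<open>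
  The fixed points of the offspring generating function are 1 and this number.
\<close>

definition kappa :: real where "kappa = (1 - \<eta>) / (1 - q)"

abbreviation g :: "nat \<Rightarrow> real" where "g \<equiv> gamma_seq \<eta> q"

lemma g_1: "g 1 = 1 / (1 - q)"
proof (cases "\<eta> = q")
  case True then show ?thesis using q_pos q_less by (simp add: gamma_seq_def)
next
  case False
  have "((1 - \<eta>) / (1 - q) - \<eta> / q) = (q - \<eta>) / ((1 - q) * q)" "1 - \<eta> / q = (q - \<eta>) / q"
    using q_pos q_less by (simp_all add: divide_simps) (simp add: algebra_simps)
  then show ?thesis using False q_pos q_less by (simp add: gamma_seq_def divide_simps)
qed

lemma mean_power_neq_1:
  assumes "\<eta> \<noteq> q" "n \<ge> 1"
  shows "(\<eta> / q) ^ n \<noteq> 1"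
proof -
  have "\<eta> / q > 0" "\<eta> / q \<noteq> 1" using assms eta_pos q_pos by auto
  then show ?thesis using assms power_eq_iff_eq_base[of n "\<eta> / q" 1] by simp
qed

text \<open>
  The ratio of the distances of $\gamma_n$ from the two fixed points is $\mu^n$. In the critical
  case the fixed points coincide.
\<close>

lemma g_minus_fixed_point:
  assumes "n \<ge> 1"
  shows "\<eta> \<noteq> q \<Longrightarrow> g n - 1 = (kappa - 1) / (1 - (\<eta> / q) ^ n)"
    and "\<eta> \<noteq> q \<Longrightarrow> g n - kappa = (\<eta> / q) ^ n * (kappa - 1) / (1 - (\<eta> / q) ^ n)"
    and "\<eta> = q \<Longrightarrow> g n - 1 = q / (1 - q) / real n"
    and "\<eta> = q \<Longrightarrow> kappa = 1"
proof -
  assume ne: "\<eta> \<noteq> q"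
  then have "\<eta> / q > 0" "\<eta> / q \<noteq> 1" using eta_pos q_pos by auto
  have "1 - (\<eta> / q) ^ n \<noteq> 0" using mean_power_neq_1[OF ne assms] by simp
  moreover have "g n = (kappa - (\<eta> / q) ^ n) / (1 - (\<eta> / q) ^ n)"
    using \<open>\<eta> / q \<noteq> 1\<close> by (simp only: gamma_seq_def kappa_def Let_def if_True simp_thms)
  ultimately show "g n - 1 = (kappa - 1) / (1 - (\<eta> / q) ^ n)"
    "g n - kappa = (\<eta> / q) ^ n * (kappa - 1) / (1 - (\<eta> / q) ^ n)"
    by (simp_all add: eq_divide_eq left_diff_distrib) (simp_all add: algebra_simps)
next
  assume eq: "\<eta> = q"
  then show "kappa = 1" unfolding kappa_def using q_less by simp
  have "1 / (1 - q) - 1 = q / (1 - q)" using q_less by (simp add: field_simps)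
  then show "g n - 1 = q / (1 - q) / real n" using eq q_pos by (simp add: gamma_seq_def)
qed

lemma g_gt: assumes "n \<ge> 1" shows "g n > 1" "g n > kappa"
proof -
  have "g n - 1 > 0 \<and> g n - kappa > 0"
  proof (cases "\<eta> = q")
    case True
    then show ?thesis using g_minus_fixed_point(3,4)[OF assms] q_pos q_less assms by simp
  next
    case False
    show ?thesis
    proof (cases "\<eta> < q")
      case True
      then have "kappa > 1" "\<eta> / q < 1" using q_less q_pos by (simp_all add: kappa_def)
      moreover have "(\<eta> / q) ^ n < 1" "(\<eta> / q) ^ n > 0"
        using calculation eta_pos q_pos assms by (auto intro!: power_Suc_less_one simp: power_less_one_iff)
      ultimately show ?thesis using g_minus_fixed_point(1,2)[OF assms False] by simp
    next
      case gt: False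
      then have "kappa < 1" "\<eta> / q > 1" using q_less q_pos False by (simp_all add: kappa_def)
      moreover have "(\<eta> / q) ^ n > 1" using calculation(2) assms by (intro one_less_power) auto
      ultimately show ?thesis using g_minus_fixed_point(1,2)[OF assms False]
        by (auto intro!: divide_neg_neg mult_pos_neg)
    qed
  qed
  then show "g n > 1" "g n > kappa" by auto
qed

lemma kappa_nonneg: "kappa \<ge> 0" using eta_le q_less by (simp add: kappa_def)

text \<open>
  As a function of real $n$, $\gamma_n$ solves $d\gamma/dn = -(\gamma - 1)(\gamma - \kappa)$ up to a constant
  factor in front of the right hand side. Accordingly \<open>gap n\<close> is, up to bounded factors, the decrement
  of the sequence of poles near $n$, and its inverse is the order of magnitude of the tilted
  generation sizes below.
\<close>

definition gap :: "nat \<Rightarrow> real" where "gap n = (g n - 1) * (g n - kappa)"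

lemma gap_pos: "n \<ge> 1 \<Longrightarrow> gap n > 0"
  using g_gt[of n] by (simp add: gap_def)

lemma g_sum_pos: "m \<ge> 1 \<Longrightarrow> n \<ge> 1 \<Longrightarrow> g m + g n - 1 - kappa > 0"
  using g_gt[of n] g_gt[of m] by linarith

text \<open>
  The addition theorem of $\gamma$. It expresses that the $m$-th iterate maps $\gamma_{m+n}$ to
  $\gamma_n$, the pole of the $n$-th iterate.
\<close>

lemma g_add:
  assumes "m \<ge> 1" "n \<ge> 1"
  shows "g (m + n) * (g m + g n - 1 - kappa) = g m * g n - kappa"
proof (cases "\<eta> = q")
  case True
  define c where "c = q / (1 - q)"
  have k: "kappa = 1" using g_minus_fixed_point(4)[of 1] True by simp
  have e: "g i = 1 + c / real i" if "i \<ge> 1" for i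
    using g_minus_fixed_point(3)[OF that True] by (simp add: c_def)
  have *: "(1 + c / (M + N)) * (c / M + c / N) = (1 + c / M) * (1 + c / N) - 1"
    if "M > 0" "N > 0" for M N :: real
  proof -
    have "M + N \<noteq> 0" using that by simp
    then show ?thesis using that by (simp add: divide_simps) algebra
  qed
  show ?thesis unfolding k
    using assms *[of "real m" "real n"] by (simp add: e)
next
  case False
  define x where "x = (\<eta> / q) ^ m"
  define y where "y = (\<eta> / q) ^ n"
  have xy: "(\<eta> / q) ^ (m + n) = x * y" by (simp add: x_def y_def power_add)
  have ne: "1 - x \<noteq> 0" "1 - y \<noteq> 0" "1 - x * y \<noteq> 0"
    using assms mean_power_neq_1[OF False] unfolding xy[symmetric] by (simp_all add: x_def y_def)
  have e: "g m = 1 + (kappa - 1) / (1 - x)" "g n = 1 + (kappa - 1) / (1 - y)"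
      "g (m + n) = 1 + (kappa - 1) / (1 - x * y)"
    using g_minus_fixed_point(1)[OF assms(1) False] g_minus_fixed_point(1)[OF assms(2) False]
      g_minus_fixed_point(1)[of "m + n", OF _ False] assms by (simp_all add: xy x_def y_def)
  show ?thesis unfolding e using ne by (simp add: divide_simps) algebra
qed

lemma g_diff:
  assumes "m \<ge> 1" "n \<ge> 1"
  shows "g m - g (m + n) = gap m / (g m + g n - 1 - kappa)"
  using g_add[OF assms] g_sum_pos[OF assms] by (simp add: gap_def field_simps)

lemma g_less: "m \<ge> 1 \<Longrightarrow> n \<ge> 1 \<Longrightarrow> g (m + n) < g m"
  using g_diff[of m n] divide_pos_pos[OF gap_pos[of m] g_sum_pos[of m n]] by simp

lemma g_le: assumes "m \<ge> 1" shows "g m \<le> g 1"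
proof (cases "m = 1")
  case False
  then show ?thesis using g_less[of 1 "m - 1"] assms by (cases m) (auto simp: Suc_le_eq)
qed simp

definition offspring_pgf :: "real \<Rightarrow> real" where
  "offspring_pgf x = 1 - \<eta> + \<eta> * q * x / (1 - (1 - q) * x)"

lemma geo_offspring_nonneg: "geo_offspring \<eta> q k \<ge> 0"
  using eta_pos eta_le q_pos q_less by (simp add: geo_offspring_def)

lemma scaled_less_1:
  assumes "x \<le> 1" shows "(1 - q) * x < 1"
proof -
  have "(1 - q) * x \<le> (1 - q) * 1" using assms q_less by (intro mult_left_mono) auto
  also have "\<dots> < 1" using q_pos by simp
  finally show ?thesis .
qed

text \<open>
  The offspring law beyond $J - 1$, shifted to 0, is a multiple of a geometric law. This is where
  the memoryless property enters.
\<close>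

lemma tail_pgf_sums:
  assumes "J \<ge> 1" "0 \<le> x" "x \<le> 1"
  shows "(\<lambda>k. if J \<le> k then geo_offspring \<eta> q k * x ^ (k - J) else 0) sums
           (\<eta> * q * (1 - q) ^ (J - 1) / (1 - (1 - q) * x))"
proof -
  have "(1 - q) * x < 1" using scaled_less_1[OF assms(3)] .
  then have "norm ((1 - q) * x) < 1" using assms q_less q_pos by simp
  from sums_mult[OF geometric_sums[OF this], of "\<eta> * q * (1 - q) ^ (J - 1)"]
  have "(\<lambda>k. if J \<le> k + J then geo_offspring \<eta> q (k + J) * x ^ (k + J - J) else 0) sums
      (\<eta> * q * (1 - q) ^ (J - 1) * (1 / (1 - (1 - q) * x)))"
    using assms by (auto simp: geo_offspring_def power_mult_distrib mult.assoc add.commute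
        power_add[symmetric] elim!: sums_cong[THEN iffD1, rotated])
  then show ?thesis
    by (subst (asm) sums_iff_shift) simp
qed

lemma offspring_pgf_sums:
  assumes "0 \<le> x" "x \<le> 1"
  shows "(\<lambda>k. geo_offspring \<eta> q k * x ^ k) sums offspring_pgf x"
proof -
  have "(\<lambda>k. x * (if 1 \<le> k then geo_offspring \<eta> q k * x ^ (k - 1) else 0)) sums
      (x * (\<eta> * q * (1 - q) ^ (1 - 1) / (1 - (1 - q) * x)))"
    by (intro sums_mult tail_pgf_sums) (use assms in auto)
  moreover have "(\<lambda>k. if k = 0 then 1 - \<eta> else 0) sums (1 - \<eta>)"
    using sums_single[of 0 "\<lambda>_. 1 - \<eta>"] by simp
  ultimately have "(\<lambda>k. x * (if 1 \<le> k then geo_offspring \<eta> q k * x ^ (k - 1) else 0) +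
       (if k = 0 then 1 - \<eta> else 0)) sums
      (x * (\<eta> * q * (1 - q) ^ (1 - 1) / (1 - (1 - q) * x)) + (1 - \<eta>))"
    by (rule sums_add)
  moreover have "x * (if 1 \<le> k then geo_offspring \<eta> q k * x ^ (k - 1) else 0) +
       (if k = 0 then 1 - \<eta> else 0) = geo_offspring \<eta> q k * x ^ k" for k
    by (cases k) (auto simp: geo_offspring_def)
  ultimately show ?thesis by (simp add: offspring_pgf_def algebra_simps)
qed

definition gen_pgf :: "nat \<Rightarrow> real \<Rightarrow> real" where
  "gen_pgf n x = (kappa + (g n - 1 - kappa) * x) / (g n - x)"

lemma offspring_pgf_eq: "0 \<le> x \<Longrightarrow> x \<le> 1 \<Longrightarrow> offspring_pgf x = gen_pgf 1 x"
proof -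
  assume x: "0 \<le> x" "x \<le> 1"
  then have d: "1 - (1 - q) * x > 0" "1 - q > 0" using scaled_less_1[of x] q_less by auto
  have "g 1 - x = (1 - (1 - q) * x) / (1 - q)" using d g_1 by (simp add: field_simps)
  moreover have "kappa + (g 1 - 1 - kappa) * x = (1 - \<eta> + (q - (1 - \<eta>)) * x) / (1 - q)"
  proof -
    have "g 1 - 1 - kappa = (q - (1 - \<eta>)) / (1 - q)"
      unfolding g_1 kappa_def using d by (simp add: divide_eq_eq diff_divide_eq_iff eq_divide_eq left_diff_distrib)
    then show ?thesis by (simp add: kappa_def add_divide_distrib)
  qed
  moreover have "offspring_pgf x = (1 - \<eta> + (q - (1 - \<eta>)) * x) / (1 - (1 - q) * x)"
    using d by (simp add: offspring_pgf_def divide_simps) (simp add: algebra_simps)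
  ultimately show ?thesis unfolding gen_pgf_def using d by simp
qed

lemma gen_pgf_range:
  assumes "n \<ge> 1" "0 \<le> x" "x \<le> 1"
  shows "0 \<le> gen_pgf n x" "gen_pgf n x \<le> 1"
proof -
  have d: "g n - x > 0" using g_gt[OF assms(1)] assms by simp
  have "kappa + (g n - 1 - kappa) * x = kappa * (1 - x) + (g n - 1) * x" by (simp add: algebra_simps)
  also have "\<dots> \<ge> 0" using kappa_nonneg g_gt[OF assms(1)] assms by simp
  finally show "0 \<le> gen_pgf n x" using d by (simp add: gen_pgf_def)
  have "(g n - kappa) * (1 - x) \<ge> 0" using g_gt[OF assms(1)] assms by simp
  then have "kappa + (g n - 1 - kappa) * x \<le> g n - x" by (simp add: algebra_simps)
  then show "gen_pgf n x \<le> 1" using d by (simp add: gen_pgf_def)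
qed

text \<open>
  Iterating a linear fractional map with fixed points 1 and $\kappa$ moves only its pole, by
  the case $m = 1$ of the addition theorem.
\<close>

lemma gen_pgf_Suc:
  assumes "n \<ge> 1" "0 \<le> x" "x \<le> 1"
  shows "gen_pgf (Suc n) x = gen_pgf 1 (gen_pgf n x)"
proof -
  define s where "s = g 1 + g n - 1 - kappa"
  have s: "s > 0" using g_sum_pos[of 1 n] assms by (simp add: s_def)
  have G: "g (Suc n) * s = g 1 * g n - kappa" using g_add[of 1 n] assms by (simp add: s_def)
  have d: "g n - x > 0" "g (Suc n) - x > 0" using g_gt[of n] g_gt[of "Suc n"] assms by auto
  let ?N = "kappa + (g n - 1 - kappa) * x"
  have "g 1 - gen_pgf n x = (g 1 * (g n - x) - ?N) / (g n - x)"
    using d by (simp add: gen_pgf_def field_simps)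
  also have "g 1 * (g n - x) - ?N = s * (g (Suc n) - x)"
    using G by (simp add: s_def algebra_simps)
  finally have e1: "g 1 - gen_pgf n x = s * (g (Suc n) - x) / (g n - x)" .
  have "kappa + (g 1 - 1 - kappa) * gen_pgf n x = (kappa * (g n - x) + (g 1 - 1 - kappa) * ?N) / (g n - x)"
    using d by (simp add: gen_pgf_def field_simps)
  also have "kappa * (g n - x) + (g 1 - 1 - kappa) * ?N = s * (kappa + (g (Suc n) - 1 - kappa) * x)"
  proof -
    have "s * (kappa + (g (Suc n) - 1 - kappa) * x) = s * kappa + (g (Suc n) * s - s - s * kappa) * x"
      by (simp add: algebra_simps)
    also have "\<dots> = kappa * (g n - x) + (g 1 - 1 - kappa) * ?N"
      unfolding G by (simp add: s_def) algebra
    finally show ?thesis by simp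
  qed
  finally have e2: "kappa + (g 1 - 1 - kappa) * gen_pgf n x = s * (kappa + (g (Suc n) - 1 - kappa) * x) / (g n - x)" .
  have "gen_pgf 1 (gen_pgf n x) = (kappa + (g 1 - 1 - kappa) * gen_pgf n x) / (g 1 - gen_pgf n x)"
    by (simp add: gen_pgf_def)
  also have "\<dots> = gen_pgf (Suc n) x"
    unfolding e1 e2 using s d by (simp add: gen_pgf_def)
  finally show ?thesis by simp
qed

text \<open>
  The expansion of \<open>gen_pgf n\<close> at 0: geometric with ratio $1/\gamma_n$ except for the constant term.
\<close>

definition gen_fps :: "nat \<Rightarrow> real fps" where
  "gen_fps n = Abs_fps (\<lambda>k. if k = 0 then kappa / g n else gap n / g n * (1 / g n) ^ k)"

lemma gen_fps_nth: "fps_nth (gen_fps n) k = (if k = 0 then kappa / g n else gap n / g n * (1 / g n) ^ k)"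
  by (simp add: gen_fps_def)

lemma gen_fps_sums:
  assumes "n \<ge> 1" "\<bar>x\<bar> < g n"
  shows "(\<lambda>k. fps_nth (gen_fps n) k * x ^ k) sums gen_pgf n x"
proof -
  have gp: "g n > 0" "g n - x > 0" using g_gt[OF assms(1)] assms by auto
  then have "norm (x / g n) < 1" using assms by simp
  from sums_mult[OF geometric_sums[OF this], of "gap n / g n"]
  have "(\<lambda>k. gap n / g n * (x / g n) ^ k) sums (gap n / g n * (1 / (1 - x / g n)))" .
  moreover have "(\<lambda>k. if k = 0 then kappa / g n - gap n / g n else 0) sums (kappa / g n - gap n / g n)"
    using sums_single[of 0 "\<lambda>_. kappa / g n - gap n / g n"] by simp
  ultimately have "(\<lambda>k. gap n / g n * (x / g n) ^ k + (if k = 0 then kappa / g n - gap n / g n else 0))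
    sums (gap n / g n * (1 / (1 - x / g n)) + (kappa / g n - gap n / g n))"
    by (rule sums_add)
  moreover have "gap n / g n * (x / g n) ^ k + (if k = 0 then kappa / g n - gap n / g n else 0) =
     fps_nth (gen_fps n) k * x ^ k" for k
    by (simp add: gen_fps_nth power_divide)
  moreover have "gap n / g n * (1 / (1 - x / g n)) + (kappa / g n - gap n / g n) = gen_pgf n x"
  proof -
    have "1 / (1 - x / g n) = g n / (g n - x)" using gp by (simp add: field_simps)
    then have "gap n / g n * (1 / (1 - x / g n)) + (kappa / g n - gap n / g n) =
      (gap n * g n + (kappa - gap n) * (g n - x)) / (g n * (g n - x))"
      using gp by (simp add: field_simps)
    also have "gap n * g n + (kappa - gap n) * (g n - x) = (kappa + (g n - 1 - kappa) * x) * g n"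
      by (simp add: gap_def) algebra
    finally show ?thesis using gp by (simp add: gen_pgf_def)
  qed
  ultimately show ?thesis by simp
qed

lemma gen_fps_nonneg: "n \<ge> 1 \<Longrightarrow> fps_nth (gen_fps n) k \<ge> 0"
  using g_gt[of n] gap_pos[of n] kappa_nonneg by (simp add: gen_fps_nth)

lemma gen_pgf_g: "m \<ge> 1 \<Longrightarrow> J \<ge> 1 \<Longrightarrow> gen_pgf m (g (m + J)) = g J"
  using g_add[of m J] g_less[of m J] by (simp add: gen_pgf_def field_simps)


end

section \<open>Powers of power series with nonnegative coefficients\<close>

definition partial_sum :: "real fps \<Rightarrow> nat \<Rightarrow> real" where
  "partial_sum F N = (\<Sum>k\<le>N. fps_nth F k)"

text \<open>
  Both bounds compare sets of pairs of exponents: the triangle $i + j \le N$ lies in the square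
  $[0,N]^2$, and the rectangle $[0,M] \times [0,N]$ lies in the triangle $i + j \le M + N$.
\<close>

lemma partial_sum_mult:
  assumes "\<And>k. fps_nth F k \<ge> 0" "\<And>k. fps_nth G k \<ge> 0"
  shows "partial_sum (F * G) N \<le> partial_sum F N * partial_sum G N"
    and "partial_sum F M * partial_sum G N \<le> partial_sum (F * G) (M + N)"
proof -
  let ?h = "\<lambda>(i, j). fps_nth F i * fps_nth G j"
  have e: "partial_sum (F * G) L = sum ?h {(i, j). i + j \<le> L}" for L
    by (simp add: partial_sum_def fps_mult_nth atLeast0AtMost sum.triangle_reindex_eq)
  have p: "partial_sum F L * partial_sum G L' = sum ?h ({..L} \<times> {..L'})" for L L'
    by (simp add: partial_sum_def sum_product sum.cartesian_product)
  have fin: "finite {(i, j). i + j \<le> (L::nat)}" for L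
    by (rule finite_subset[of _ "{..L} \<times> {..L}"]) auto
  show "partial_sum (F * G) N \<le> partial_sum F N * partial_sum G N"
    unfolding e p by (rule sum_mono2) (use assms in auto)
  show "partial_sum F M * partial_sum G N \<le> partial_sum (F * G) (M + N)"
    unfolding e p by (rule sum_mono2[OF fin]) (use assms in auto)
qed

lemma fps_mult_nonneg:
  fixes F G :: "real fps"
  assumes "\<And>k. fps_nth F k \<ge> 0" "\<And>k. fps_nth G k \<ge> 0"
  shows "fps_nth (F * G) k \<ge> 0"
  using assms by (simp add: fps_mult_nth sum_nonneg)

lemma fps_power_nonneg:
  fixes F :: "real fps"
  assumes "\<And>k. fps_nth F k \<ge> 0"
  shows "fps_nth (F ^ z) k \<ge> 0"
  using assms by (induction z arbitrary: k) (auto intro!: fps_mult_nonneg)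

lemma partial_sum_nonneg: "(\<And>k. fps_nth F k \<ge> 0) \<Longrightarrow> partial_sum F N \<ge> 0"
  by (simp add: partial_sum_def sum_nonneg)

lemma partial_sum_mono:
  "(\<And>k. fps_nth F k \<ge> 0) \<Longrightarrow> M \<le> N \<Longrightarrow> partial_sum F M \<le> partial_sum F N"
  unfolding partial_sum_def by (rule sum_mono2) auto

text \<open>
  For a sum of $z$ independent variables: a sum at most $N$ forces all summands to be at most $N$, and
  summands at most $N$ force the sum to be at most $zN$. So concentration of a single summand carries
  over to the sum.
\<close>

lemma partial_sum_power:
  assumes "\<And>k. fps_nth F k \<ge> 0"
  shows "partial_sum (F ^ z) N \<le> partial_sum F N ^ z"
    and "partial_sum F N ^ z \<le> partial_sum (F ^ z) (z * N)"
proof -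
  show "partial_sum (F ^ z) N \<le> partial_sum F N ^ z"
  proof (induction z)
    case (Suc z)
    have "partial_sum (F ^ Suc z) N \<le> partial_sum F N * partial_sum (F ^ z) N"
      using partial_sum_mult(1)[of F "F ^ z"] assms fps_power_nonneg[OF assms] by simp
    also have "\<dots> \<le> partial_sum F N * partial_sum F N ^ z"
      using Suc assms by (intro mult_left_mono partial_sum_nonneg)
    finally show ?case by simp
  qed (simp add: partial_sum_def fps_one_nth)
  show "partial_sum F N ^ z \<le> partial_sum (F ^ z) (z * N)"
  proof (induction z)
    case (Suc z)
    have "partial_sum F N * partial_sum F N ^ z \<le> partial_sum F N * partial_sum (F ^ z) (z * N)"
      using Suc assms by (intro mult_left_mono partial_sum_nonneg)
    also have "\<dots> \<le> partial_sum (F ^ Suc z) (N + z * N)"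
      using partial_sum_mult(2)[of F "F ^ z"] assms fps_power_nonneg[OF assms] by simp
    finally show ?case by simp
  qed (simp add: partial_sum_def)
qed

text \<open>
  For independent copies $X_1, \dots, X_z$ of a variable with law $F$ this is the identity
  $k P(\sum X_i = k) = z E[X_1; \sum X_i = k]$, whose right hand side is at most
  $z \max_j j P(X_1 = j)$. The identity is obtained by differentiating $F^z$.
\<close>

lemma coefficient_power_le:
  assumes nn: "\<And>k. fps_nth F k \<ge> 0" and le: "\<And>k. real k * fps_nth F k \<le> c"
    and one: "\<And>N. partial_sum F N \<le> 1"
  shows "real k * fps_nth (F ^ z) k \<le> real z * c"
proof (cases "k = 0 \<or> z = 0")
  case True
  have "c \<ge> 0" using le[of 0] by simp
  then show ?thesis using True by (auto simp: fps_one_nth)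
next
  case False
  then obtain j y where j: "k = Suc j" and y: "z = Suc y" by (cases k; cases z) auto
  have "real k * fps_nth (F ^ z) k = fps_nth (fps_deriv (F ^ z)) j"
    by (simp add: j)
  also have "\<dots> = real z * fps_nth (fps_deriv F * F ^ y) j"
    by (simp only: fps_deriv_power y) (simp add: mult.assoc)
  also have "\<dots> \<le> real z * c"
  proof (rule mult_left_mono)
    have "fps_nth (fps_deriv F * F ^ y) j = (\<Sum>i\<le>j. real (Suc i) * fps_nth F (Suc i) * fps_nth (F ^ y) (j - i))"
      by (simp add: fps_mult_nth atLeast0AtMost)
    also have "\<dots> \<le> (\<Sum>i\<le>j. c * fps_nth (F ^ y) (j - i))"
      by (intro sum_mono mult_right_mono le fps_power_nonneg nn)
    also have "\<dots> = c * partial_sum (F ^ y) j"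
      unfolding partial_sum_def sum_distrib_left
      by (rule sum.reindex_bij_witness[of _ "\<lambda>i. j - i" "\<lambda>i. j - i"]) auto
    also have "\<dots> \<le> c * 1"
    proof (rule mult_left_mono)
      have "partial_sum (F ^ y) j \<le> partial_sum F j ^ y" by (rule partial_sum_power(1)[OF nn])
      also have "\<dots> \<le> 1" using one partial_sum_nonneg[OF nn] by (intro power_le_one)
      finally show "partial_sum (F ^ y) j \<le> 1" .
      show "c \<ge> 0" using le[of 0] by simp
    qed
    finally show "fps_nth (fps_deriv F * F ^ y) j \<le> c" by simp
  qed simp
  finally show ?thesis .
qed

text \<open>
  The substitution $X \mapsto cX$ commutes with powers; the factor $d$ normalises the total mass.
\<close>

lemma fps_power_rescale:
  fixes F :: "real fps"
  shows "Abs_fps (\<lambda>k. d * c ^ k * fps_nth F k) ^ z = Abs_fps (\<lambda>k. d ^ z * c ^ k * fps_nth (F ^ z) k)"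
proof (induction z)
  case 0 show ?case by (auto simp: fps_eq_iff)
next
  case (Suc z)
  have "fps_nth (Abs_fps (\<lambda>k. d * c ^ k * fps_nth F k) ^ Suc z) k = d ^ Suc z * c ^ k * fps_nth (F ^ Suc z) k" for k
  proof -
    have "fps_nth (Abs_fps (\<lambda>k. d * c ^ k * fps_nth F k) ^ Suc z) k =
       (\<Sum>i=0..k. (d * c ^ i * fps_nth F i) * (d ^ z * c ^ (k - i) * fps_nth (F ^ z) (k - i)))"
      by (simp add: Suc fps_mult_nth)
    also have "\<dots> = (\<Sum>i=0..k. d ^ Suc z * c ^ k * (fps_nth F i * fps_nth (F ^ z) (k - i)))"
    proof (rule sum.cong)
      fix i assume "i \<in> {0..k}"
      then have "c ^ k = c ^ i * c ^ (k - i)" by (simp flip: power_add)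
      then show "(d * c ^ i * fps_nth F i) * (d ^ z * c ^ (k - i) * fps_nth (F ^ z) (k - i)) =
        d ^ Suc z * c ^ k * (fps_nth F i * fps_nth (F ^ z) (k - i))" by simp
    qed simp
    finally show ?thesis by (simp add: fps_mult_nth sum_distrib_left)
  qed
  then show ?case by (simp add: fps_eq_iff)
qed

lemma mult_power_le_geometric:
  fixes r :: real assumes "0 \<le> r" "r \<le> 1"
  shows "real k * r ^ k * (1 - r) \<le> 1"
proof -
  have "real k * r ^ k \<le> (\<Sum>i<k. r ^ i)"
    using sum_mono[of "{..<k}" "\<lambda>_. r ^ k" "\<lambda>i. r ^ i"] power_decreasing[of _ k r] assms by simp
  then have "real k * r ^ k * (1 - r) \<le> (\<Sum>i<k. r ^ i) * (1 - r)"
    using assms by (intro mult_right_mono) auto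
  also have "\<dots> = 1 - r ^ k" by (metis one_diff_power_eq mult.commute)
  also have "\<dots> \<le> 1" using assms by simp
  finally show ?thesis .
qed

section \<open>Asymptotics of the quotient of coefficients\<close>

context geometric_offspring
begin

text \<open>
  The law of $Z_m$ tilted by $\gamma_{m+J}^k$; its total mass is 1 since
  $f_m(\gamma_{m+J}) = \gamma_J$.
\<close>

definition tilted_fps :: "nat \<Rightarrow> nat \<Rightarrow> real fps" where
  "tilted_fps m J = Abs_fps (\<lambda>k. 1 / g J * g (m + J) ^ k * fps_nth (gen_fps m) k)"

text \<open>
  Away from 0 the tilted law is geometric with ratio $r = \gamma_{m+J}/\gamma_m < 1$. Its tail beyond
  $N$ is therefore at most $r^N$, and $1 - r$, a relative increment of the poles, is of order at least
  \<open>gap (m + J)\<close>. In the last bound the factor $1 - r$ from the weights of the geometric law cancels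
  the bound $1/(1 - r)$ for $k r^k$.
\<close>

lemma tilted_fps_geometric:
  assumes "m \<ge> 1" "J \<ge> 1"
  defines "G \<equiv> tilted_fps m J" and "r \<equiv> g (m + J) / g m"
  shows "fps_nth G k \<ge> 0" and "partial_sum G N \<le> 1" and "1 - r ^ N \<le> partial_sum G N"
    and "0 \<le> r" "r < 1" "1 - r \<ge> gap (m + J) / (2 * g 1 ^ 2)"
    and "real k * fps_nth G k \<le> 2 * g 1"
proof -
  define s where "s = g m + g J - 1 - kappa"
  have gp: "g m > 1" "g J > 1" "g (m + J) > 1" "g (m + J) < g m" "g m \<le> g 1" "g J \<le> g 1" "g 1 > 1"
    using g_gt[of m] g_gt[of J] g_gt[of "m + J"] g_less[of m J] g_le[of m] g_le[of J] g_gt[of 1] assms by auto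
  have s: "0 < s" "s \<le> 2 * g 1" using g_sum_pos[OF assms(1,2)] gp kappa_nonneg by (auto simp: s_def)
  show r: "0 \<le> r" "r < 1" using gp by (simp_all add: r_def)
  have 1: "1 - r = gap m / (s * g m)"
  proof -
    have "1 - r = (g m - g (m + J)) / g m" using gp by (simp add: r_def diff_divide_distrib)
    then show ?thesis using g_diff[OF assms(1,2)] by (simp add: s_def)
  qed
  have "gap (m + J) \<le> gap m" using gp g_gt(2)[of "m + J"] assms unfolding gap_def
    by (intro mult_mono) auto
  have "s * g m \<le> (2 * g 1) * g 1" using gp s by (intro mult_mono) auto
  then have "gap (m + J) / (2 * g 1 ^ 2) \<le> gap m / (s * g m)"
    using \<open>gap (m + J) \<le> gap m\<close> gp s gap_pos[OF assms(1)]
    by (intro frac_le) (auto simp: power2_eq_square)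
  then show "1 - r \<ge> gap (m + J) / (2 * g 1 ^ 2)" using 1 by simp
  show nn: "fps_nth G k \<ge> 0" for k
    using gen_fps_nonneg[OF assms(1)] gp by (simp add: G_def tilted_fps_def)
  have G: "fps_nth G k = gap m / (g m * g J) * r ^ k" if "k \<ge> 1" for k
    using that gp by (simp add: G_def tilted_fps_def gen_fps_nth r_def power_divide mult_ac)
  show "real k * fps_nth G k \<le> 2 * g 1"
  proof (cases "k = 0")
    case False
    then have "real k * fps_nth G k = gap m / (g m * g J) * (real k * r ^ k)" using G by simp
    also have "\<dots> = s / g J * (real k * r ^ k * (1 - r))" using 1 gp s by (simp add: mult_ac)
    also have "\<dots> \<le> s / g J * 1"
      using mult_power_le_geometric[of r k] r s gp by (intro mult_left_mono) auto
    also have "\<dots> \<le> s / 1 * 1" using gp s by (intro mult_right_mono divide_left_mono) auto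
    finally show ?thesis using s by simp
  qed (use gp in simp)
  have "(\<lambda>k. fps_nth (gen_fps m) k * g (m + J) ^ k) sums g J"
    using gen_fps_sums[of m "g (m + J)"] gen_pgf_g[OF assms(1,2)] assms(1) gp by simp
  from sums_mult[OF this, of "1 / g J"] have sums: "(\<lambda>k. fps_nth G k) sums 1"
    using gp by (simp add: G_def tilted_fps_def mult.assoc mult.left_commute mult.commute)
  have "(\<lambda>k. fps_nth G (k + Suc N)) sums (1 - partial_sum G N)" for N
    using sums unfolding partial_sum_def
    by (subst sums_iff_shift) (simp add: lessThan_Suc_atMost)
  note tail = this
  have "(\<lambda>k. fps_nth G (k + 1)) sums (1 - fps_nth G 0)"
    using tail[of 0] by (simp add: partial_sum_def)
  from sums_mult[OF this, of "r ^ N"]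
  have "(\<lambda>k. fps_nth G (k + Suc N)) sums (r ^ N * (1 - fps_nth G 0))"
    by (simp add: G power_add mult_ac)
  from sums_unique2[OF this tail] have e: "1 - partial_sum G N = r ^ N * (1 - fps_nth G 0)" by simp
  have "fps_nth G 0 \<le> 1" using sums_le[OF _ sums_single[of 0 "fps_nth G"] sums] nn by simp
  then have "0 \<le> r ^ N * (1 - fps_nth G 0)" "r ^ N * (1 - fps_nth G 0) \<le> r ^ N * 1"
    using r nn[of 0] by (simp, intro mult_left_mono) auto
  then show "partial_sum G N \<le> 1" "1 - r ^ N \<le> partial_sum G N" using e by auto
qed

text \<open>
  In the Cauchy product for the coefficient of $X^a$, the factor from \<open>gen_fps (m + J)\<close> is
  proportional to $\gamma_{m+J}^{b-a}$ for every $b < a$. Dividing by the coefficient in the denominator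
  leaves the weight $\gamma_{m+J}^b$, which is the tilting. Only $b = a$ meets the constant terms.
\<close>

lemma coefficient_ratio_eq:
  assumes "m \<ge> 1" "J \<ge> 1" "a \<ge> 1"
  shows "fps_nth ((gen_fps (m + J) + fps_const c) * gen_fps m ^ z) a / fps_nth (gen_fps (m + J)) a =
    g J ^ z * (partial_sum (tilted_fps m J ^ z) (a - 1) +
               (kappa + c * g (m + J)) * fps_nth (tilted_fps m J ^ z) a / gap (m + J))"
proof -
  let ?n = "m + J" and ?F = "gen_fps m ^ z" and ?G = "tilted_fps m J ^ z"
  have gp: "g J > 1" "g ?n > 1" "gap ?n > 0" using g_gt[of J] g_gt[of ?n] gap_pos[of ?n] assms by auto
  have FG: "fps_nth ?F b = g J ^ z * fps_nth ?G b / g ?n ^ b" for b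
    unfolding tilted_fps_def fps_power_rescale fps_nth_Abs_fps
    using gp by (simp add: power_divide)
  have "fps_nth ((gen_fps ?n + fps_const c) * ?F) a =
     (\<Sum>b\<in>insert a {..<a}. fps_nth (gen_fps ?n + fps_const c) (a - b) * fps_nth ?F b)"
    using fps_mult_nth[of ?F "gen_fps ?n + fps_const c" a]
    by (simp add: mult.commute atLeast0AtMost lessThan_Suc_atMost[symmetric] lessThan_Suc)
  also have "\<dots> = (kappa / g ?n + c) * fps_nth ?F a + (\<Sum>b<a. gap ?n / g ?n * (1 / g ?n) ^ (a - b) * fps_nth ?F b)"
    by (simp add: gen_fps_nth)
  also have "(\<Sum>b<a. gap ?n / g ?n * (1 / g ?n) ^ (a - b) * fps_nth ?F b) =
      gap ?n / g ?n * (1 / g ?n) ^ a * (g J ^ z * partial_sum ?G (a - 1))"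
  proof -
    have "gap ?n / g ?n * (1 / g ?n) ^ (a - b) * fps_nth ?F b = gap ?n / g ?n * (1 / g ?n) ^ a * (g J ^ z * fps_nth ?G b)"
      if "b < a" for b
    proof -
      have "(1 / g ?n) ^ a = (1 / g ?n) ^ (a - b) * (1 / g ?n) ^ b" using that by (simp flip: power_add)
      then show ?thesis by (simp add: FG power_divide)
    qed
    moreover have "{..a - 1} = {..<a}" using assms by auto
    ultimately show ?thesis
      unfolding partial_sum_def sum_distrib_left by (intro sum.cong) auto
  qed
  also have "(kappa / g ?n + c) * fps_nth ?F a = gap ?n / g ?n * (1 / g ?n) ^ a * (g J ^ z *
     ((kappa + c * g ?n) * fps_nth ?G a / gap ?n))"
    using gp by (simp add: FG power_divide field_simps)
  finally have "fps_nth ((gen_fps ?n + fps_const c) * ?F) a = gap ?n / g ?n * (1 / g ?n) ^ a *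
     (g J ^ z * (partial_sum ?G (a - 1) + (kappa + c * g ?n) * fps_nth ?G a / gap ?n))"
    by (simp add: algebra_simps)
  moreover have "fps_nth (gen_fps ?n) a = gap ?n / g ?n * (1 / g ?n) ^ a"
    using assms(3) by (simp add: gen_fps_nth)
  moreover have "gap ?n / g ?n * (1 / g ?n) ^ a > 0" using gp by simp
  ultimately show ?thesis by (simp only: nonzero_mult_div_cancel_left less_imp_neq[symmetric] simp_thms)
qed

text \<open>
  The condition on \<open>y\<close> says that $a$ is large compared with the typical size
  $1/$\<open>gap (m + J)\<close> of the tilted variables.
\<close>

lemma tilted_fps_bounds:
  fixes z :: nat
  assumes "m \<ge> 1" "J \<ge> 1" "a \<ge> 1"
  defines "y \<equiv> real a * gap (m + J) / real (Suc z) - g 1 ^ 2"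
  assumes y: "y \<ge> 2 * g 1 ^ 2"
  shows "partial_sum (tilted_fps m J ^ z) (a - 1) \<le> 1"
    and "(1 - 2 * g 1 ^ 2 / y) ^ z \<le> partial_sum (tilted_fps m J ^ z) (a - 1)"
    and "fps_nth (tilted_fps m J ^ z) a / gap (m + J) \<le> real z * (2 * g 1) / (real a * gap (m + J))"
proof -
  note T = tilted_fps_geometric[OF assms(1,2)]
  let ?G = "tilted_fps m J" and ?r = "g (m + J) / g m"
  have gp: "gap (m + J) > 0" "g 1 > 1" using gap_pos[of "m + J"] g_gt[of 1] assms by auto
  then have y0: "y > 0" using y by (smt (verit) zero_less_power)
  have "partial_sum (?G ^ z) (a - 1) \<le> partial_sum ?G (a - 1) ^ z" by (rule partial_sum_power(1)[OF T(1)])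
  also have "\<dots> \<le> 1" using T(2) partial_sum_nonneg[OF T(1)] by (intro power_le_one)
  finally show "partial_sum (?G ^ z) (a - 1) \<le> 1" .
  have "real a * fps_nth (?G ^ z) a \<le> real z * (2 * g 1)"
    by (rule coefficient_power_le[OF T(1) T(7) T(2)])
  then show "fps_nth (?G ^ z) a / gap (m + J) \<le> real z * (2 * g 1) / (real a * gap (m + J))"
    using gp assms(3) by (simp add: field_simps)
  (* If each of the z summands is at most N, then their sum is at most a - 1. *)
  define N where "N = (a - 1) div Suc z"
  have "a \<le> N * Suc z + Suc z"
    using div_mult_mod_eq[of "a - 1" "Suc z"] mod_less_divisor[of "Suc z" "a - 1"] assms(3)
    unfolding N_def by linarith
  then have "real a \<le> real (N * Suc z + Suc z)" by (simp only: of_nat_le_iff)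
  then have "real a / real (Suc z) - 1 \<le> real N"
    by (simp add: field_simps)
  then have "(real a / real (Suc z) - 1) * gap (m + J) \<le> real N * gap (m + J)"
    using gp by (intro mult_right_mono) auto
  moreover have "gap (m + J) \<le> g 1 * g 1"
    unfolding gap_def using g_gt[of "m + J"] g_le[of "m + J"] kappa_nonneg assms
    by (intro mult_mono) auto
  ultimately have yN: "y \<le> real N * gap (m + J)"
    by (simp add: y_def left_diff_distrib power2_eq_square)
  have "?r ^ N * y \<le> ?r ^ N * (real N * gap (m + J))"
    using yN T(4) by (intro mult_left_mono) auto
  also have "\<dots> = real N * ?r ^ N * (gap (m + J) / (2 * g 1 ^ 2)) * (2 * g 1 ^ 2)"
    using gp by simp
  also have "\<dots> \<le> real N * ?r ^ N * (1 - ?r) * (2 * g 1 ^ 2)"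
    using T(6,4) by (intro mult_right_mono mult_left_mono) auto
  also have "\<dots> \<le> 1 * (2 * g 1 ^ 2)"
    using mult_power_le_geometric[of ?r N] T(4,5) by (intro mult_right_mono) auto
  finally have "?r ^ N \<le> 2 * g 1 ^ 2 / y" using y0 by (simp add: field_simps)
  then have "1 - 2 * g 1 ^ 2 / y \<le> partial_sum ?G N" using T(3)[of N] by linarith
  moreover have "0 \<le> 1 - 2 * g 1 ^ 2 / y" using y y0 by simp
  ultimately have "(1 - 2 * g 1 ^ 2 / y) ^ z \<le> partial_sum ?G N ^ z" by (intro power_mono)
  also have "\<dots> \<le> partial_sum (?G ^ z) (z * N)" by (rule partial_sum_power(2)[OF T(1)])
  also have "\<dots> \<le> partial_sum (?G ^ z) (a - 1)"
  proof (rule partial_sum_mono[OF fps_power_nonneg[OF T(1)]])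
    have "z * N \<le> N * Suc z" by simp
    also have "\<dots> \<le> a - 1" unfolding N_def by (rule div_times_less_eq_dividend)
    finally show "z * N \<le> a - 1" .
  qed
  finally show "(1 - 2 * g 1 ^ 2 / y) ^ z \<le> partial_sum (?G ^ z) (a - 1)" .
qed

text \<open>
  The main estimate: the tilted mass below $a_n$ tends to 1 and the boundary term tends to 0.
\<close>

lemma coefficient_ratio_tendsto:
  fixes a :: "nat \<Rightarrow> nat"
  assumes J: "J \<ge> 1" and a: "\<And>n. n \<ge> 1 \<Longrightarrow> a n \<ge> 1"
    and lim: "filterlim (\<lambda>n. real (a n) * gap n) at_top sequentially"
  shows "(\<lambda>n. fps_nth ((gen_fps n + fps_const c) * gen_fps (n - J) ^ z) (a n) / fps_nth (gen_fps n) (a n))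
     \<longlonglongrightarrow> g J ^ z"
proof -
  define y where "y n = real (a n) * gap n / real (Suc z) - g 1 ^ 2" for n
  define w where "w n = real (a n) * gap n" for n
  have w: "filterlim w at_top sequentially" using lim unfolding w_def .
  have "filterlim (\<lambda>n. - (g 1 ^ 2) + w n / real (Suc z)) at_top sequentially"
    using filterlim_at_top_mult_tendsto_pos[OF tendsto_const _ w, of "1 / real (Suc z)"]
    by (intro filterlim_tendsto_add_at_top[OF tendsto_const]) simp
  then have y: "filterlim y at_top sequentially"
    by (simp add: y_def[abs_def] w_def)
  define P where "P n = partial_sum (tilted_fps (n - J) J ^ z) (a n - 1)" for n
  define Q where "Q n = fps_nth (tilted_fps (n - J) J ^ z) (a n) / gap n" for n
  have ev: "eventually (\<lambda>n. n > J \<and> y n \<ge> 2 * g 1 ^ 2) sequentially"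
    using y by (intro eventually_conj eventually_gt_at_top) (simp add: filterlim_at_top)
  have n: "n - J \<ge> 1" "n - J + J = n" "a n \<ge> 1" if "n > J" for n using that a[of n] by auto
  have "P \<longlonglongrightarrow> 1"
  proof (rule tendsto_sandwich)
    have "(\<lambda>n. (1 - 2 * g 1 ^ 2 / y n) ^ z) \<longlonglongrightarrow> (1 - 0) ^ z"
      by (intro tendsto_intros tendsto_divide_0[OF tendsto_const] filterlim_at_top_imp_at_infinity y)
    then show "(\<lambda>n. (1 - 2 * g 1 ^ 2 / y n) ^ z) \<longlonglongrightarrow> 1" by simp
    show "eventually (\<lambda>n. (1 - 2 * g 1 ^ 2 / y n) ^ z \<le> P n) sequentially"
      using ev by eventually_elim
        (use tilted_fps_bounds(2)[OF n(1) J n(3)] n(2) in \<open>simp add: P_def y_def\<close>)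
    show "eventually (\<lambda>n. P n \<le> 1) sequentially"
      using ev by eventually_elim
        (use tilted_fps_bounds(1)[OF n(1) J n(3)] n(2) in \<open>simp add: P_def y_def\<close>)
  qed (rule tendsto_const)
  moreover have "(\<lambda>n. (kappa + c * g n) * Q n) \<longlonglongrightarrow> 0"
  proof (rule Lim_null_comparison)
    show "eventually (\<lambda>n. norm ((kappa + c * g n) * Q n) \<le> (kappa + \<bar>c\<bar> * g 1) * (real z * (2 * g 1) / w n)) sequentially"
      using ev
    proof eventually_elim
      case (elim n)
      then have nn: "n > J" by simp
      have gn: "0 < g n" "g n \<le> g 1" "gap n > 0" using g_gt[of n] g_le[of n] gap_pos[of n] nn by auto
      have "Q n \<le> real z * (2 * g 1) / w n"
        using tilted_fps_bounds(3)[OF n(1)[OF nn] J n(3)[OF nn]] n(2)[OF nn] elim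
        by (simp add: Q_def y_def w_def)
      moreover have "0 \<le> Q n" unfolding Q_def
        using fps_power_nonneg[OF tilted_fps_geometric(1)[OF n(1)[OF nn] J]] gn by simp
      moreover have "\<bar>kappa + c * g n\<bar> \<le> kappa + \<bar>c\<bar> * g 1"
      proof -
        have "\<bar>kappa + c * g n\<bar> \<le> \<bar>kappa\<bar> + \<bar>c\<bar> * g n" using gn by (metis abs_mult abs_of_pos abs_triangle_ineq)
        also have "\<bar>c\<bar> * g n \<le> \<bar>c\<bar> * g 1" using gn by (intro mult_left_mono) auto
        finally show ?thesis using kappa_nonneg by simp
      qed
      ultimately have "\<bar>kappa + c * g n\<bar> * Q n \<le> (kappa + \<bar>c\<bar> * g 1) * (real z * (2 * g 1) / w n)"
        by (intro mult_mono) auto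
      then show ?case using \<open>0 \<le> Q n\<close> by (simp only: real_norm_def abs_mult abs_of_nonneg)
    qed
    have "(\<lambda>n. (kappa + \<bar>c\<bar> * g 1) * (real z * (2 * g 1) / w n)) \<longlonglongrightarrow> (kappa + \<bar>c\<bar> * g 1) * 0"
      by (intro tendsto_intros tendsto_divide_0[OF tendsto_const] filterlim_at_top_imp_at_infinity w)
    then show "(\<lambda>n. (kappa + \<bar>c\<bar> * g 1) * (real z * (2 * g 1) / w n)) \<longlonglongrightarrow> 0" by simp
  qed
  ultimately have "(\<lambda>n. g J ^ z * (P n + (kappa + c * g n) * Q n)) \<longlonglongrightarrow> g J ^ z * (1 + 0)"
    by (intro tendsto_intros)
  moreover have "eventually (\<lambda>n. g J ^ z * (P n + (kappa + c * g n) * Q n) =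
      fps_nth ((gen_fps n + fps_const c) * gen_fps (n - J) ^ z) (a n) / fps_nth (gen_fps n) (a n)) sequentially"
    using eventually_gt_at_top[of J]
    by eventually_elim
      (use coefficient_ratio_eq[OF n(1) J n(3)] n(2) in \<open>simp add: P_def Q_def\<close>)
  ultimately show ?thesis by (auto elim: Lim_transform_eventually)
qed

end

section \<open>Trees of finite height and pruning\<close>

abbreviation num_kids :: "word \<Rightarrow> tree \<Rightarrow> nat" where
  "num_kids u t \<equiv> the_enat (num_children u t)"

definition level :: "nat \<Rightarrow> tree \<Rightarrow> word set" where
  "level h t = {u \<in> nodes t. length u = h}"

definition finite_trees :: "nat \<Rightarrow> tree set" where
  "finite_trees h = {t \<in> locally_finite_trees. \<forall>u\<in>nodes t. length u \<le> h}"

lemma Nil_in_nodes [simp]: "[] \<in> nodes t"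
  using nodes[of t] by (simp add: is_tree_def)

text \<open>
  With \<open>rev_induct\<close> this makes membership in a tree a recursion along the path from the root.
\<close>

lemma snoc_in_nodes: "u @ [i] \<in> nodes t \<longleftrightarrow> u \<in> nodes t \<and> 1 \<le> i \<and> enat i \<le> num_children u t"
proof -
  have "is_tree (nodes t)" using nodes[of t] by simp
  then have "u @ [i] \<in> nodes t \<Longrightarrow> u \<in> nodes t \<and> 1 \<le> i"
    by (auto simp: is_tree_def words_def)
  then show ?thesis using num_children_iff[of u t i] by blast
qed

lemma num_children_not_node: "u \<notin> nodes t \<Longrightarrow> num_children u t = 0"
  by (intro num_children_eqI) (auto simp: snoc_in_nodes zero_enat_def)

lemma snoc_in_nodes_tree_of:
  "u @ [i] \<in> nodes (tree_of \<xi>) \<longleftrightarrow> u \<in> nodes (tree_of \<xi>) \<and> 1 \<le> i \<and> enat i \<le> \<xi> u"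
  by (auto simp: tree_of.rep_eq words_def less_Suc_eq nth_append)

lemma num_children_tree_of: "u \<in> nodes (tree_of \<xi>) \<Longrightarrow> num_children u (tree_of \<xi>) = \<xi> u"
  by (intro num_children_eqI) (simp add: snoc_in_nodes_tree_of)

text \<open>
  Whether a word belongs to \<open>tree_of \<xi>\<close> depends on \<open>\<xi>\<close> only through the proper prefixes of the word,
  which lie in the tree if the word does.
\<close>

lemma tree_of_eqI:
  assumes "\<And>u. u \<in> nodes t \<Longrightarrow> num_children u t = \<xi> u"
  shows "tree_of \<xi> = t"
proof -
  have "u \<in> nodes (tree_of \<xi>) \<longleftrightarrow> u \<in> nodes t" for u
    by (induction u rule: rev_induct) (auto simp: snoc_in_nodes assms num_children_tree_of)
  then show ?thesis by (auto simp: nodes_inject[symmetric])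
qed

lemma num_children_truncate:
  "num_children u (truncate h t) = (if length u < h then num_children u t else 0)"
proof (cases "u \<in> nodes t")
  case True
  then show ?thesis
    by (intro num_children_eqI) (auto simp: truncate.rep_eq snoc_in_nodes zero_enat_def)
qed (simp add: num_children_not_node truncate.rep_eq)

lemma level_0 [simp]: "level 0 t = {[]}"
  by (auto simp: level_def)

lemma level_Suc:
  "level (Suc h) t = (\<Union>u\<in>level h t. (\<lambda>i. u @ [i]) ` {i. 1 \<le> i \<and> enat i \<le> num_children u t})"
proof (intro set_eqI iffI)
  fix v assume v: "v \<in> level (Suc h) t"
  then obtain u i where "v = u @ [i]" by (cases v rule: rev_cases) (auto simp: level_def)
  then show "v \<in> (\<Union>u\<in>level h t. (\<lambda>i. u @ [i]) ` {i. 1 \<le> i \<and> enat i \<le> num_children u t})"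
    using v by (auto simp: level_def snoc_in_nodes)
qed (auto simp: level_def snoc_in_nodes)

lemma num_kids_enat: "t \<in> locally_finite_trees \<Longrightarrow> enat (num_kids u t) = num_children u t"
  by (cases "u \<in> nodes t") (auto simp: locally_finite_trees_def num_children_not_node zero_enat_def)

lemma finite_level_card_Suc:
  assumes "\<And>u. u \<in> level h t \<Longrightarrow> num_children u t \<noteq> \<infinity>" "finite (level h t)"
  shows "finite (level (Suc h) t)" "card (level (Suc h) t) = (\<Sum>u\<in>level h t. num_kids u t)"
proof -
  let ?C = "\<lambda>u. (\<lambda>i. u @ [i]) ` {1..num_kids u t}"
  have e: "level (Suc h) t = (\<Union>u\<in>level h t. ?C u)"
    unfolding level_Suc
  proof (intro SUP_cong refl arg_cong2[of _ _ _ _ "(`)"])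
    fix u assume "u \<in> level h t"
    then obtain k where "num_children u t = enat k" using assms(1)[of u] by (cases "num_children u t") auto
    then show "{i. 1 \<le> i \<and> enat i \<le> num_children u t} = {1..num_kids u t}" by auto
  qed
  show "finite (level (Suc h) t)" unfolding e using assms(2) by auto
  have "card (\<Union>u\<in>level h t. ?C u) = (\<Sum>u\<in>level h t. card (?C u))"
    using assms(2) by (intro card_UN_disjoint) auto
  also have "\<dots> = (\<Sum>u\<in>level h t. num_kids u t)"
    by (intro sum.cong) (auto simp: card_image inj_on_def)
  finally show "card (level (Suc h) t) = (\<Sum>u\<in>level h t. num_kids u t)" by (simp only: e)
qed

lemma locally_finite_level:
  assumes "t \<in> locally_finite_trees"
  shows "finite (level h t)"
    and "card (level (Suc h) t) = (\<Sum>u\<in>level h t. num_kids u t)"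
proof -
  have *: "num_children u t \<noteq> \<infinity>" if "u \<in> level i t" for i u
    using assms that by (auto simp: locally_finite_trees_def level_def)
  show fin: "finite (level h t)" for h
    by (induction h) (auto intro!: finite_level_card_Suc *)
  show "card (level (Suc h) t) = (\<Sum>u\<in>level h t. num_kids u t)"
    by (rule finite_level_card_Suc) (use * fin in auto)
qed

lemma gen_size_locally_finite:
  "t \<in> locally_finite_trees \<Longrightarrow> gen_size n t = enat (card (level n t))"
  using locally_finite_level(1)[of t n] by (simp add: gen_size_def level_def)

lemma finite_nodes:
  assumes "t \<in> finite_trees h"
  shows "finite (nodes t)"
proof -
  have "nodes t \<subseteq> (\<Union>i\<le>h. level i t)" using assms by (auto simp: finite_trees_def level_def)
  moreover have "finite (\<Union>i\<le>h. level i t)"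
    using assms by (auto simp: finite_trees_def intro: locally_finite_level)
  ultimately show ?thesis by (rule finite_subset)
qed

lemma countable_finite_trees: "countable (finite_trees h)"
proof (rule countable_image_inj_on)
  show "countable (nodes ` finite_trees h)"
    by (rule countable_subset[OF _ countable_Collect_finite]) (auto intro: finite_nodes)
  show "inj_on nodes (finite_trees h)" by (simp add: inj_on_def nodes_inject)
qed

lemma truncate_finite_trees:
  assumes "t \<in> locally_finite_trees" shows "truncate h t \<in> finite_trees h"
  using assms by (auto simp: finite_trees_def locally_finite_trees_def num_children_truncate truncate.rep_eq zero_enat_def)

lemma finite_trees_height:
  assumes "t \<in> finite_trees h"
  shows "t \<in> locally_finite_trees" "height t \<le> enat h"
  using assms by (auto simp: finite_trees_def height_def intro!: SUP_least)

lemma num_children_finite_trees: "t \<in> finite_trees h \<Longrightarrow> h \<le> length u \<Longrightarrow> num_children u t = 0"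
  by (intro num_children_eqI) (auto simp: finite_trees_def zero_enat_def dest!: bspec)

lemma finite_trees_0: "finite_trees 0 = {tree_of (\<lambda>_. 0)}"
proof (intro equalityI subsetI)
  fix t assume "t \<in> finite_trees 0"
  then show "t \<in> {tree_of (\<lambda>_. 0)}" using tree_of_eqI[of t "\<lambda>_. 0"] num_children_finite_trees[of t 0] by simp
next
  have "u \<in> nodes (tree_of (\<lambda>_. 0)) \<Longrightarrow> u = []" for u
    by (cases u rule: rev_cases) (auto simp: snoc_in_nodes_tree_of zero_enat_def)
  then show "t \<in> finite_trees 0" if "t \<in> {tree_of (\<lambda>_. 0)}" for t
    using that by (auto simp: finite_trees_def locally_finite_trees_def num_children_tree_of zero_enat_def)
qed

lemma truncate_truncate: "h \<le> h' \<Longrightarrow> truncate h (truncate h' t) = truncate h t"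
  by (auto simp: nodes_inject[symmetric] truncate.rep_eq)

lemma level_truncate: "i \<le> h \<Longrightarrow> level i (truncate h t) = level i t"
  by (auto simp: level_def truncate.rep_eq)

text \<open>
  To add one generation to a tree of height at most \<open>h\<close> is to choose the number of children of each
  vertex at height \<open>h\<close>; these choices are free.
\<close>

lemma bij_betw_extensions:
  assumes s: "s \<in> finite_trees h"
  shows "bij_betw (\<lambda>t. \<lambda>u\<in>level h s. num_kids u t)
           {t \<in> finite_trees (Suc h). truncate h t = s} (level h s \<rightarrow>\<^sub>E UNIV)"
proof (rule bij_betw_byWitness)
  let ?ext = "\<lambda>k. tree_of (\<lambda>u. if length u = h then enat (k u) else num_children u s)"
  have lev: "level h t = level h s" if "truncate h t = s" for t
    using level_truncate[of h h t] that by simp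
  show "\<forall>t\<in>{t \<in> finite_trees (Suc h). truncate h t = s}. ?ext (\<lambda>u\<in>level h s. num_kids u t) = t"
  proof (intro ballI tree_of_eqI)
    fix t u assume t: "t \<in> {t \<in> finite_trees (Suc h). truncate h t = s}" and u: "u \<in> nodes t"
    show "num_children u t = (if length u = h then enat ((\<lambda>u\<in>level h s. num_kids u t) u) else num_children u s)"
    proof (cases "length u = h")
      case True
      then have "u \<in> level h s" using u t lev[of t] by (auto simp: level_def)
      then show ?thesis using t True by (simp add: num_kids_enat finite_trees_def)
    next
      case False
      then show ?thesis
        using t num_children_truncate[of u h t] num_children_finite_trees[of t "Suc h" u] by auto
    qed
  qed
  have num_ext: "num_children u (?ext k) = (if length u = h then enat (k u) else num_children u s)"
    if "u \<in> nodes (?ext k)" for u k using num_children_tree_of[OF that] .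
  have tr: "truncate h (?ext k) = s" for k
  proof -
    have "u \<in> nodes s \<longleftrightarrow> u \<in> nodes (?ext k) \<and> length u \<le> h" for u
    proof (induction u rule: rev_induct)
      case (snoc i u)
      then show ?case using num_children_finite_trees[OF s, of u]
        by (cases "length u" h rule: linorder_cases) (auto simp: snoc_in_nodes num_children_tree_of zero_enat_def Suc_le_eq split: if_splits)
    qed simp
    then show ?thesis by (auto simp: nodes_inject[symmetric] truncate.rep_eq)
  qed
  show "\<forall>k\<in>level h s \<rightarrow>\<^sub>E UNIV. (\<lambda>u\<in>level h s. num_kids u (?ext k)) = k"
  proof (intro ballI ext)
    fix k u assume k: "k \<in> level h s \<rightarrow>\<^sub>E (UNIV :: nat set)"
    show "(\<lambda>u\<in>level h s. num_kids u (?ext k)) u = k u"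
    proof (cases "u \<in> level h s")
      case True
      then have "u \<in> nodes (?ext k)" "length u = h"
        using lev[OF tr[of k]] by (auto simp: level_def)
      then show ?thesis using True num_ext[of u k] by simp
    qed (use k in \<open>auto simp: PiE_def extensional_def\<close>)
  qed
  show "(\<lambda>t. \<lambda>u\<in>level h s. num_kids u t) ` {t \<in> finite_trees (Suc h). truncate h t = s}
     \<subseteq> level h s \<rightarrow>\<^sub>E UNIV" by auto
  show "?ext ` (level h s \<rightarrow>\<^sub>E UNIV) \<subseteq> {t \<in> finite_trees (Suc h). truncate h t = s}"
  proof (intro image_subsetI CollectI conjI)
    fix k :: "word \<Rightarrow> nat"
    show "truncate h (?ext k) = s" by (rule tr)
    have "length u \<le> Suc h" if "u \<in> nodes (?ext k)" for u
    proof (cases u rule: rev_cases)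
      case (snoc v i)
      then show ?thesis using that num_children_finite_trees[OF s, of v]
        by (auto simp: snoc_in_nodes_tree_of zero_enat_def split: if_splits intro: ccontr)
    qed simp
    moreover have "num_children u s < \<infinity>" for u
      using num_kids_enat[OF finite_trees_height(1)[OF s], of u] by (cases "num_children u s") auto
    ultimately show "?ext k \<in> finite_trees (Suc h)"
      by (auto simp: finite_trees_def locally_finite_trees_def num_ext)
  qed
qed

text \<open>
  The two cut-offs, in height and in the children of the root, are tied to one parameter to obtain a sequence of partitions.
\<close>

definition prune :: "nat \<Rightarrow> tree \<Rightarrow> tree" where
  "prune J t = tree_of (\<lambda>u. if u = [] then min (enat J) (num_children [] t)
                            else if length u < J then num_children u t else 0)"

lemma nodes_prune:
  "u \<in> nodes (prune J t) \<longleftrightarrow> u \<in> nodes t \<and> length u \<le> J \<and> (u \<noteq> [] \<longrightarrow> hd u \<le> J)"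
proof (induction u rule: rev_induct)
  case Nil show ?case by (simp add: prune_def)
next
  case (snoc i u)
  show ?case
  proof (cases "u = []")
    case True
    then show ?thesis
      using snoc_in_nodes_tree_of[of "[]" i] snoc_in_nodes[of "[]" i t] by (auto simp: prune_def)
  next
    case False
    then show ?thesis using snoc
      by (auto simp: prune_def num_children_tree_of snoc_in_nodes zero_enat_def split: if_splits)
  qed
qed

lemma num_children_prune:
  assumes "u \<in> nodes (prune J t)"
  shows "num_children u (prune J t) = (if u = [] then min (enat J) (num_children [] t)
           else if length u < J then num_children u t else 0)"
  using num_children_tree_of[of u] assms unfolding prune_def .

text \<open>
  Only finitely many vertices are involved, none of them the root except through an inequality.
  So the event is a finite cylinder both for the Galton-Watson tree and for the limit tree.
\<close>

lemma prune_eq_iff: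
  assumes s: "s \<in> finite_trees J" "num_children [] s = enat J"
  shows "prune J t = s \<longleftrightarrow>
    enat J \<le> num_children [] t \<and> (\<forall>u\<in>nodes s. 0 < length u \<and> length u < J \<longrightarrow> num_children u t = num_children u s)"
proof
  assume "prune J t = s"
  then show "enat J \<le> num_children [] t \<and> (\<forall>u\<in>nodes s. 0 < length u \<and> length u < J \<longrightarrow> num_children u t = num_children u s)"
    using num_children_prune[of _ J t] s(2) by (auto simp: min_def split: if_splits)
next
  assume R: "enat J \<le> num_children [] t \<and> (\<forall>u\<in>nodes s. 0 < length u \<and> length u < J \<longrightarrow> num_children u t = num_children u s)"
  show "prune J t = s" unfolding prune_def
    by (rule tree_of_eqI) (use R s num_children_finite_trees[OF s(1)] in \<open>auto simp: min_def\<close>)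
qed

definition root_infinite_trees :: "tree set" where
  "root_infinite_trees = {t. num_children [] t = \<infinity> \<and> (\<forall>u\<in>nodes t. u \<noteq> [] \<longrightarrow> num_children u t < \<infinity>)}"

lemma prune_root_infinite:
  assumes "t \<in> root_infinite_trees"
  shows "prune J t \<in> finite_trees J" "num_children [] (prune J t) = enat J"
  using assms
  by (auto simp: finite_trees_def locally_finite_trees_def root_infinite_trees_def num_children_prune nodes_prune zero_enat_def)

lemma kids_eqI:
  assumes "u \<in> nodes t \<longleftrightarrow> u \<in> nodes t'" "u \<in> nodes t \<Longrightarrow> num_children u t = num_children u t'"
  shows "kids u t = kids u t'"
  using assms by (simp add: kids_def)

lemma prune_eq_kids_eq:
  assumes "prune J t = prune J t'" "u \<noteq> []" "length u < J" "hd u \<le> J"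
  shows "kids u t = kids u t'"
  using assms nodes_prune[of u J t] nodes_prune[of u J t']
    num_children_prune[of u J t] num_children_prune[of u J t']
  by (intro kids_eqI) auto

text \<open>
  For a vertex other than the root, pruning at a large \<open>J\<close> determines its number of children. At the
  root it only says that there are at least \<open>J\<close> children, but as the number is infinite this is what
  convergence in the one-point compactification asks for.
\<close>

lemma prune_neighbourhoods:
  assumes t: "t \<in> root_infinite_trees" and V: "open V" "t \<in> V"
  shows "eventually (\<lambda>J. \<forall>t'. prune J t' = prune J t \<longrightarrow> t' \<in> V) sequentially"
proof -
  have "generate_topology tree_subbasis V" using V(1) by (simp add: open_tree_eq[symmetric])
  then show ?thesis using V(2)
  proof induction
    case (Int A B)
    then have "eventually (\<lambda>J. (\<forall>t'. prune J t' = prune J t \<longrightarrow> t' \<in> A) \<and>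
        (\<forall>t'. prune J t' = prune J t \<longrightarrow> t' \<in> B)) sequentially"
      by (intro eventually_conj) auto
    then show ?case by eventually_elim auto
  next
    case (UN K)
    then obtain A where A: "A \<in> K" "t \<in> A" by auto
    from UN.IH[OF A] show ?case by (rule eventually_mono) (use \<open>A \<in> K\<close> in blast)
  next
    case (Basis S)
    then obtain u c where S: "S = {t. kids u t = Some c} \<or> S = {t. kids u t \<noteq> Some c}"
      by (auto simp: tree_subbasis_def)
    show ?case
    proof (cases "u = []")
      case True
      have S': "S = {t. kids [] t \<noteq> Some c}"
        using S Basis.prems t True by (auto simp: kids_def root_infinite_trees_def)
      show ?thesis using eventually_gt_at_top[of "nat c"]
      proof eventually_elim
        case (elim J)
        have "enat J \<le> num_children [] t'" if "prune J t' = prune J t" for t'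
          using prune_root_infinite(2)[OF t, of J] num_children_prune[of "[]" J t'] that
          by (auto simp: min_def split: if_splits)
        then show ?case using elim by (fastforce simp: S' kids_def split: enat.splits)
      qed
    next
      case False
      show ?thesis using eventually_gt_at_top[of "max (length u) (hd u)"]
        by eventually_elim (use S Basis.prems prune_eq_kids_eq[OF _ False] in fastforce)
    qed
  qed simp
qed

section \<open>The branching property\<close>

lemma nn_integral_count_space_fibres:
  fixes f :: "'a \<Rightarrow> ennreal"
  assumes "countable B" "\<And>a. a \<in> A \<Longrightarrow> r a \<in> B"
  shows "(\<integral>\<^sup>+a. f a \<partial>count_space A) = (\<integral>\<^sup>+b. \<integral>\<^sup>+a. f a \<partial>count_space {a \<in> A. r a = b} \<partial>count_space B)"
proof -
  have "(\<integral>\<^sup>+a. f a \<partial>count_space A) = (\<integral>\<^sup>+a. \<integral>\<^sup>+b. f a * indicator {r a} b \<partial>count_space B \<partial>count_space A)"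
  proof (rule nn_integral_cong)
    fix a assume "a \<in> space (count_space A)"
    then show "f a = (\<integral>\<^sup>+b. f a * indicator {r a} b \<partial>count_space B)"
      using assms(2)[of a] by (subst nn_integral_count_space'[where A="{r a}"]) (auto simp: indicator_def)
  qed
  also have "\<dots> = (\<integral>\<^sup>+b. \<integral>\<^sup>+a. f a * indicator {r a} b \<partial>count_space A \<partial>count_space B)"
    by (rule nn_integral_count_space_nn_integral) (use assms in auto)
  also have "\<dots> = (\<integral>\<^sup>+b. \<integral>\<^sup>+a. f a \<partial>count_space {a \<in> A. r a = b} \<partial>count_space B)"
  proof (rule nn_integral_cong)
    fix b
    have "(\<integral>\<^sup>+a. f a * indicator {r a} b \<partial>count_space A) = (\<integral>\<^sup>+a. f a * indicator {a \<in> A. r a = b} a \<partial>count_space A)"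
      by (intro nn_integral_cong) (auto simp: indicator_def)
    also have "\<dots> = (\<integral>\<^sup>+a. f a \<partial>restrict_space (count_space A) {a \<in> A. r a = b})"
      by (subst nn_integral_restrict_space) auto
    also have "restrict_space (count_space A) {a \<in> A. r a = b} = count_space {a \<in> A. r a = b}"
      by (subst restrict_count_space) (auto intro: arg_cong[where f=count_space])
    finally show "(\<integral>\<^sup>+a. f a * indicator {r a} b \<partial>count_space A) = (\<integral>\<^sup>+a. f a \<partial>count_space {a \<in> A. r a = b})" .
  qed
  finally show ?thesis .
qed

lemma nn_integral_countable_valued:
  fixes g :: "'b \<Rightarrow> ennreal"
  assumes "countable S" "\<And>\<omega>. \<omega> \<in> space M \<Longrightarrow> X \<omega> \<in> S" "\<And>s. s \<in> S \<Longrightarrow> {\<omega> \<in> space M. X \<omega> = s} \<in> sets M"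
  shows "(\<integral>\<^sup>+\<omega>. g (X \<omega>) \<partial>M) = (\<integral>\<^sup>+s. g s * emeasure M {\<omega> \<in> space M. X \<omega> = s} \<partial>count_space S)"
proof -
  have "(\<integral>\<^sup>+\<omega>. g (X \<omega>) \<partial>M) = (\<integral>\<^sup>+\<omega>. \<integral>\<^sup>+s. g s * indicator {\<omega> \<in> space M. X \<omega> = s} \<omega> \<partial>count_space S \<partial>M)"
  proof (rule nn_integral_cong)
    fix \<omega> assume w: "\<omega> \<in> space M"
    then show "g (X \<omega>) = (\<integral>\<^sup>+s. g s * indicator {\<omega> \<in> space M. X \<omega> = s} \<omega> \<partial>count_space S)"
      using assms(2)[OF w] by (subst nn_integral_count_space'[where A="{X \<omega>}"]) (auto simp: indicator_def)
  qed
  also have "\<dots> = (\<integral>\<^sup>+s. \<integral>\<^sup>+\<omega>. g s * indicator {\<omega> \<in> space M. X \<omega> = s} \<omega> \<partial>M \<partial>count_space S)"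
    using assms by (intro nn_integral_count_space_nn_integral) auto
  also have "\<dots> = (\<integral>\<^sup>+s. g s * emeasure M {\<omega> \<in> space M. X \<omega> = s} \<partial>count_space S)"
    using assms(3) by (intro nn_integral_cong nn_integral_cmult_indicator) auto
  finally show ?thesis .
qed

text \<open>
  Tonelli's theorem for a finite product of counting measures.
\<close>

lemma nn_integral_prod_PiE:
  fixes f :: "'a \<Rightarrow> nat \<Rightarrow> ennreal"
  assumes "finite A"
  shows "(\<integral>\<^sup>+k. (\<Prod>u\<in>A. f u (k u)) \<partial>count_space (A \<rightarrow>\<^sub>E UNIV)) = (\<Prod>u\<in>A. \<Sum>k. f u k)"
proof -
  interpret product_sigma_finite "\<lambda>_::'a. count_space (UNIV :: nat set)"
    by (intro product_sigma_finite.intro sigma_finite_measure_count_space)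
  have "(\<integral>\<^sup>+k. (\<Prod>u\<in>A. f u (k u)) \<partial>count_space (A \<rightarrow>\<^sub>E UNIV)) =
      (\<integral>\<^sup>+k. (\<Prod>u\<in>A. f u (k u)) \<partial>PiM A (\<lambda>_. count_space UNIV))"
    using count_space_PiM_finite[OF assms, of "\<lambda>_. UNIV :: nat set"] by simp
  also have "\<dots> = (\<Prod>u\<in>A. \<Sum>k. f u k)"
    by (subst product_nn_integral_prod) (use assms in \<open>auto simp: nn_integral_count_space_nat\<close>)
  finally show ?thesis .
qed

locale galton_watson =
  fixes p :: "nat \<Rightarrow> real" and M :: "'a measure" and \<tau> :: "'a \<Rightarrow> tree"
  assumes gw: "galton_watson_tree p M \<tau>" and p_nonneg: "\<And>k. p k \<ge> 0"
begin

sublocale prob_space M using gw by (simp add: galton_watson_tree_def random_tree_def)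

lemma measurable_\<tau> [measurable]: "\<tau> \<in> borel_measurable M"
  using gw by (simp add: galton_watson_tree_def random_tree_def)

lemma \<tau>_locally_finite: "\<omega> \<in> space M \<Longrightarrow> \<tau> \<omega> \<in> locally_finite_trees"
  using gw by (simp add: galton_watson_tree_def)

definition weight :: "nat \<Rightarrow> tree \<Rightarrow> ennreal" where
  "weight h t = (\<Prod>u\<in>{u \<in> nodes t. length u < h}. ennreal (p (num_kids u t)))"

lemma sets_truncate_\<tau>: "{\<omega> \<in> space M. truncate h (\<tau> \<omega>) = t} \<in> sets M"
  using measurable_sets[OF measurable_\<tau> sets_truncate[of h t]] by (simp add: vimage_def Int_def conj_commute)

lemma emeasure_truncate:
  assumes "t \<in> finite_trees h"
  shows "emeasure M {\<omega> \<in> space M. truncate h (\<tau> \<omega>) = t} = weight h t"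
proof (cases h)
  case 0
  have "truncate 0 (\<tau> \<omega>) = t" if "\<omega> \<in> space M" for \<omega>
    using truncate_finite_trees[OF \<tau>_locally_finite[OF that], of 0] assms
    unfolding 0 finite_trees_0 by auto
  then have "{\<omega> \<in> space M. truncate h (\<tau> \<omega>) = t} = space M" using 0 by auto
  then show ?thesis using 0 by (simp add: weight_def emeasure_space_1)
next
  case (Suc i)
  have "{u \<in> nodes t. length u < h} = nodes (truncate (h - 1) t)"
    by (auto simp: Suc truncate.rep_eq)
  moreover have "num_kids u t = the_enat (num_children u t)" for u by simp
  moreover have "measure M {\<omega> \<in> space M. truncate h (\<tau> \<omega>) = t} =
          (\<Prod>u\<in>nodes (truncate (h - 1) t). p (num_kids u t))"
    using gw finite_trees_height[OF assms] Suc by (simp add: galton_watson_tree_def)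
  ultimately show ?thesis
    by (simp add: emeasure_eq_measure weight_def prod_ennreal p_nonneg)
qed

lemma nn_integral_truncate:
  "(\<integral>\<^sup>+\<omega>. F (truncate h (\<tau> \<omega>)) \<partial>M) = (\<integral>\<^sup>+t. F t * weight h t \<partial>count_space (finite_trees h))"
proof -
  have "(\<integral>\<^sup>+\<omega>. F (truncate h (\<tau> \<omega>)) \<partial>M) = (\<integral>\<^sup>+t. F t * emeasure M {\<omega> \<in> space M. truncate h (\<tau> \<omega>) = t} \<partial>count_space (finite_trees h))"
    by (intro nn_integral_countable_valued countable_finite_trees truncate_finite_trees \<tau>_locally_finite sets_truncate_\<tau>)
  also have "\<dots> = (\<integral>\<^sup>+t. F t * weight h t \<partial>count_space (finite_trees h))"
    by (intro nn_integral_cong) (simp add: emeasure_truncate)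
  finally show ?thesis .
qed

lemma measurable_truncate_\<tau>: "(\<lambda>\<omega>. F (truncate h (\<tau> \<omega>)) :: ennreal) \<in> borel_measurable M"
proof (rule measurable_compose[of "\<lambda>\<omega>. truncate h (\<tau> \<omega>)" M "count_space (finite_trees h)"])
  show "(\<lambda>\<omega>. truncate h (\<tau> \<omega>)) \<in> M \<rightarrow>\<^sub>M count_space (finite_trees h)"
    unfolding measurable_count_space_eq_countable[OF countable_finite_trees]
    using sets_truncate_\<tau>[of h] truncate_finite_trees[OF \<tau>_locally_finite]
    by (auto simp: vimage_def Int_def conj_commute)
qed simp

lemma weight_Suc:
  assumes "t \<in> finite_trees (Suc h)"
  shows "weight (Suc h) t = weight h (truncate h t) * (\<Prod>u\<in>level h t. ennreal (p (num_kids u t)))"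
proof -
  have "{u \<in> nodes t. length u < Suc h} = {u \<in> nodes t. length u < h} \<union> level h t"
    by (auto simp: level_def)
  then have "weight (Suc h) t = (\<Prod>u\<in>{u \<in> nodes t. length u < h}. ennreal (p (num_kids u t))) *
      (\<Prod>u\<in>level h t. ennreal (p (num_kids u t)))"
    using finite_nodes[OF assms] unfolding weight_def
    by (simp only:) (rule prod.union_disjoint; auto simp: level_def)
  also have "(\<Prod>u\<in>{u \<in> nodes t. length u < h}. ennreal (p (num_kids u t))) = weight h (truncate h t)"
    unfolding weight_def by (intro prod.cong) (auto simp: truncate.rep_eq num_children_truncate)
  finally show ?thesis .
qed

text \<open>
  Given the tree up to height \<open>h\<close>, the numbers of children of the vertices at height \<open>h\<close> are
  independent with law \<open>p\<close>. The expectation is a sum over the trees of height at most \<open>h + 1\<close>; it is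
  grouped by the truncation at height \<open>h\<close>, and each group is a sum over a product set. The test
  functions may depend on the vertex, which is what allows one to prescribe the numbers of children
  at some vertices and to count the offspring of the others.
\<close>

lemma branching_property:
  fixes \<phi> :: "word \<Rightarrow> nat \<Rightarrow> ennreal"
  shows "(\<integral>\<^sup>+\<omega>. G (truncate h (\<tau> \<omega>)) * (\<Prod>u\<in>level h (\<tau> \<omega>). \<phi> u (num_kids u (\<tau> \<omega>))) \<partial>M) =
         (\<integral>\<^sup>+\<omega>. G (truncate h (\<tau> \<omega>)) * (\<Prod>u\<in>level h (\<tau> \<omega>). \<Sum>k. ennreal (p k) * \<phi> u k) \<partial>M)"
proof -
  let ?F = "\<lambda>t. G (truncate h t) * (\<Prod>u\<in>level h t. \<phi> u (num_kids u t))"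
  let ?E = "\<lambda>s. {t \<in> finite_trees (Suc h). truncate h t = s}"
  have "(\<integral>\<^sup>+\<omega>. ?F (\<tau> \<omega>) \<partial>M) = (\<integral>\<^sup>+\<omega>. ?F (truncate (Suc h) (\<tau> \<omega>)) \<partial>M)"
  proof -
    have "?F t = ?F (truncate (Suc h) t)" for t
      by (auto simp: truncate_truncate level_truncate num_children_truncate level_def[of h t]
          intro!: arg_cong2[of _ _ _ _ "(*)"] prod.cong)
    then show ?thesis by presburger
  qed
  also have "\<dots> = (\<integral>\<^sup>+t. ?F t * weight (Suc h) t \<partial>count_space (finite_trees (Suc h)))"
    by (rule nn_integral_truncate)
  also have "\<dots> = (\<integral>\<^sup>+s. \<integral>\<^sup>+t. ?F t * weight (Suc h) t \<partial>count_space (?E s) \<partial>count_space (finite_trees h))"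
    by (rule nn_integral_count_space_fibres)
       (auto simp: countable_finite_trees intro!: truncate_finite_trees dest: finite_trees_height(1))
  also have "\<dots> = (\<integral>\<^sup>+s. (G s * (\<Prod>u\<in>level h s. \<Sum>k. ennreal (p k) * \<phi> u k)) * weight h s \<partial>count_space (finite_trees h))"
  proof (rule nn_integral_cong)
    fix s assume "s \<in> space (count_space (finite_trees h))"
    then have s: "s \<in> finite_trees h" by simp
    let ?K = "\<lambda>t. \<lambda>u\<in>level h s. num_kids u t"
    let ?H = "\<lambda>k. G s * weight h s * (\<Prod>u\<in>level h s. ennreal (p (k u)) * \<phi> u (k u))"
    have "(\<integral>\<^sup>+t. ?F t * weight (Suc h) t \<partial>count_space (?E s)) = (\<integral>\<^sup>+t. ?H (?K t) \<partial>count_space (?E s))"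
    proof (rule nn_integral_cong)
      fix t assume "t \<in> space (count_space (?E s))"
      then have t: "t \<in> finite_trees (Suc h)" "truncate h t = s" by auto
      then have "level h t = level h s" using level_truncate[of h h t] by simp
      then show "?F t * weight (Suc h) t = ?H (?K t)"
        using weight_Suc[OF t(1)] t(2) by (simp add: prod.distrib mult_ac)
    qed
    also have "\<dots> = (\<integral>\<^sup>+k. ?H k \<partial>count_space (level h s \<rightarrow>\<^sub>E UNIV))"
      by (rule nn_integral_bij_count_space[OF bij_betw_extensions[OF s]])
    also have "\<dots> = G s * weight h s * (\<integral>\<^sup>+k. (\<Prod>u\<in>level h s. ennreal (p (k u)) * \<phi> u (k u)) \<partial>count_space (level h s \<rightarrow>\<^sub>E UNIV))"
      by (rule nn_integral_cmult) simp
    also have "\<dots> = G s * weight h s * (\<Prod>u\<in>level h s. \<Sum>k. ennreal (p k) * \<phi> u k)"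
      using locally_finite_level(1)[OF finite_trees_height(1)[OF s], of h]
        nn_integral_prod_PiE[of "level h s" "\<lambda>u k. ennreal (p k) * \<phi> u k"] by simp
    finally show "(\<integral>\<^sup>+t. ?F t * weight (Suc h) t \<partial>count_space (?E s)) =
      (G s * (\<Prod>u\<in>level h s. \<Sum>k. ennreal (p k) * \<phi> u k)) * weight h s" by (simp add: mult_ac)
  qed
  also have "\<dots> = (\<integral>\<^sup>+\<omega>. G (truncate h (\<tau> \<omega>)) * (\<Prod>u\<in>level h (truncate h (\<tau> \<omega>)). \<Sum>k. ennreal (p k) * \<phi> u k) \<partial>M)"
    by (rule nn_integral_truncate[symmetric])
  finally show ?thesis by (simp add: level_truncate)
qed

definition pgf :: "ennreal \<Rightarrow> ennreal" where
  "pgf y = (\<Sum>k. ennreal (p k) * y ^ k)"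

text \<open>
  The case of equal test functions $y^k$: each generation replaces $y$ by its image under the
  generating function.
\<close>

lemma pgf_iterate:
  "(\<integral>\<^sup>+\<omega>. G (truncate h (\<tau> \<omega>)) * y ^ card (level (h + m) (\<tau> \<omega>)) \<partial>M) =
   (\<integral>\<^sup>+\<omega>. G (truncate h (\<tau> \<omega>)) * (pgf ^^ m) y ^ card (level h (\<tau> \<omega>)) \<partial>M)"
proof (induction m arbitrary: y)
  case (Suc m)
  have "(\<integral>\<^sup>+\<omega>. G (truncate h (\<tau> \<omega>)) * y ^ card (level (h + Suc m) (\<tau> \<omega>)) \<partial>M) =
     (\<integral>\<^sup>+\<omega>. G (truncate h (truncate (h + m) (\<tau> \<omega>))) * (\<Prod>u\<in>level (h + m) (\<tau> \<omega>). y ^ num_kids u (\<tau> \<omega>)) \<partial>M)"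
    by (intro nn_integral_cong)
       (simp add: truncate_truncate locally_finite_level(2)[OF \<tau>_locally_finite] power_sum)
  also have "\<dots> = (\<integral>\<^sup>+\<omega>. G (truncate h (truncate (h + m) (\<tau> \<omega>))) * (\<Prod>u\<in>level (h + m) (\<tau> \<omega>). pgf y) \<partial>M)"
    unfolding pgf_def by (rule branching_property)
  also have "\<dots> = (\<integral>\<^sup>+\<omega>. G (truncate h (\<tau> \<omega>)) * pgf y ^ card (level (h + m) (\<tau> \<omega>)) \<partial>M)"
    by (simp add: truncate_truncate)
  also have "\<dots> = (\<integral>\<^sup>+\<omega>. G (truncate h (\<tau> \<omega>)) * (pgf ^^ Suc m) y ^ card (level h (\<tau> \<omega>)) \<partial>M)"
    using Suc[of "pgf y"] by (simp add: funpow_Suc_right del: funpow.simps)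
  finally show ?case .
qed simp

section \<open>The generating function of a generation on a pruning event\<close>

definition tail_pgf :: "nat \<Rightarrow> ennreal \<Rightarrow> ennreal" where
  "tail_pgf J y = (\<Sum>k. ennreal (p k) * (if J \<le> k then y ^ (k - J) else 0))"

text \<open>
  The part of the event \<open>prune J t = s\<close> that is decided by the numbers of children below height \<open>h\<close>.
\<close>

definition agrees :: "nat \<Rightarrow> tree \<Rightarrow> nat \<Rightarrow> tree \<Rightarrow> bool" where
  "agrees J s h t \<longleftrightarrow> enat J \<le> num_children [] t \<and>
     (\<forall>u\<in>nodes s. 0 < length u \<and> length u < h \<longrightarrow> num_children u t = num_children u s)"

lemma agrees_level:
  assumes "agrees J s h t" "num_children [] s = enat J" "i \<le> h"
  shows "level i s \<subseteq> level i t"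
  using assms(3)
proof (induction i)
  case (Suc i)
  have "enat j \<le> num_children u t" if u: "u \<in> level i s" and "enat j \<le> num_children u s" for u j
    using assms(1,2) that Suc.prems
    by (cases "u = []") (auto simp: agrees_def level_def intro: order_trans[of _ "enat J"])
  then show ?case using Suc unfolding level_Suc by fastforce
qed simp

lemma agrees_truncate: "h \<ge> 1 \<Longrightarrow> agrees J s h (truncate h t) \<longleftrightarrow> agrees J s h t"
  by (auto simp: agrees_def num_children_truncate)

text \<open>
  Vertices at height \<open>h\<close> that belong to \<open>s\<close> must have the prescribed number of children and
  contribute a constant; all others contribute a factor \<open>pgf y\<close> each.
\<close>

lemma pruned_pgf_step:
  assumes s: "s \<in> finite_trees J" "num_children [] s = enat J" and h: "h \<ge> 1"
  shows "(\<integral>\<^sup>+\<omega>. of_bool (agrees J s (Suc h) (\<tau> \<omega>)) * y ^ (card (level (Suc h) (\<tau> \<omega>)) - card (level (Suc h) s)) \<partial>M) =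
     (\<Prod>u\<in>level h s. ennreal (p (num_kids u s))) *
     (\<integral>\<^sup>+\<omega>. of_bool (agrees J s h (\<tau> \<omega>)) * pgf y ^ (card (level h (\<tau> \<omega>)) - card (level h s)) \<partial>M)"
proof -
  have sf: "s \<in> locally_finite_trees" using finite_trees_height[OF s(1)] by simp
  note ls = locally_finite_level[OF sf]
  (* The two kinds of vertices: those of s are tested for the prescribed value, the others are counted. *)
  define \<phi> where "\<phi> u k = (if u \<in> level h s then of_bool (k = num_kids u s) else y ^ k)" for u and k :: nat
  have "(\<integral>\<^sup>+\<omega>. of_bool (agrees J s (Suc h) (\<tau> \<omega>)) * y ^ (card (level (Suc h) (\<tau> \<omega>)) - card (level (Suc h) s)) \<partial>M) =
    (\<integral>\<^sup>+\<omega>. of_bool (agrees J s h (truncate h (\<tau> \<omega>))) * (\<Prod>u\<in>level h (\<tau> \<omega>). \<phi> u (num_kids u (\<tau> \<omega>))) \<partial>M)"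
  proof (rule nn_integral_cong)
    fix \<omega> assume "\<omega> \<in> space M"
    define t where "t = \<tau> \<omega>"
    have t: "t \<in> locally_finite_trees" using \<tau>_locally_finite[OF \<open>\<omega> \<in> space M\<close>] by (simp add: t_def)
    note lt = locally_finite_level[OF t]
    have "of_bool (agrees J s (Suc h) t) * y ^ (card (level (Suc h) t) - card (level (Suc h) s)) =
       of_bool (agrees J s h t) * (\<Prod>u\<in>level h t. \<phi> u (num_kids u t))"
    proof (cases "agrees J s h t")
      case True
      have sub: "level h s \<subseteq> level h t" using agrees_level[OF True s(2)] by simp
      have split: "agrees J s (Suc h) t \<longleftrightarrow> (\<forall>u\<in>level h s. num_kids u t = num_kids u s)"
        using True h num_kids_enat[OF t] num_kids_enat[OF sf]
        by (auto simp: agrees_def level_def less_Suc_eq) metis+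
      have "(\<Prod>u\<in>level h t. \<phi> u (num_kids u t)) =
         (\<Prod>u\<in>level h t - level h s. \<phi> u (num_kids u t)) * (\<Prod>u\<in>level h s. \<phi> u (num_kids u t))"
        by (rule prod.subset_diff[OF sub lt(1)])
      also have "(\<Prod>u\<in>level h t - level h s. \<phi> u (num_kids u t)) = y ^ (\<Sum>u\<in>level h t - level h s. num_kids u t)"
        by (simp add: \<phi>_def power_sum)
      also have "(\<Prod>u\<in>level h s. \<phi> u (num_kids u t)) = of_bool (agrees J s (Suc h) t)"
        unfolding split using ls(1)[of h] by (auto simp: \<phi>_def intro!: prod.neutral prod_zero)
      finally have e: "(\<Prod>u\<in>level h t. \<phi> u (num_kids u t)) =
        y ^ (\<Sum>u\<in>level h t - level h s. num_kids u t) * of_bool (agrees J s (Suc h) t)" .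
      have "(\<Sum>u\<in>level h t - level h s. num_kids u t) = card (level (Suc h) t) - card (level (Suc h) s)"
        if "agrees J s (Suc h) t"
      proof -
        have "card (level (Suc h) t) = (\<Sum>u\<in>level h t - level h s. num_kids u t) + (\<Sum>u\<in>level h s. num_kids u t)"
          unfolding lt(2) by (rule sum.subset_diff[OF sub lt(1)])
        then show ?thesis using that split by (simp add: ls(2))
      qed
      then show ?thesis using e True by auto
    qed (auto simp: agrees_def)
    then show "of_bool (agrees J s (Suc h) (\<tau> \<omega>)) * y ^ (card (level (Suc h) (\<tau> \<omega>)) - card (level (Suc h) s)) =
        of_bool (agrees J s h (truncate h (\<tau> \<omega>))) * (\<Prod>u\<in>level h (\<tau> \<omega>). \<phi> u (num_kids u (\<tau> \<omega>)))"
      by (simp add: t_def agrees_truncate[OF h])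
  qed
  also have "\<dots> = (\<integral>\<^sup>+\<omega>. of_bool (agrees J s h (truncate h (\<tau> \<omega>))) * (\<Prod>u\<in>level h (\<tau> \<omega>). \<Sum>k. ennreal (p k) * \<phi> u k) \<partial>M)"
    by (rule branching_property)
  also have "\<dots> = (\<integral>\<^sup>+\<omega>. (\<Prod>u\<in>level h s. ennreal (p (num_kids u s))) *
      (of_bool (agrees J s h (truncate h (\<tau> \<omega>))) * pgf y ^ (card (level h (truncate h (\<tau> \<omega>))) - card (level h s))) \<partial>M)"
  proof (rule nn_integral_cong)
    fix \<omega> assume "\<omega> \<in> space M"
    define t where "t = \<tau> \<omega>"
    have t: "t \<in> locally_finite_trees" using \<tau>_locally_finite[OF \<open>\<omega> \<in> space M\<close>] by (simp add: t_def)
    have sub: "level h s \<subseteq> level h t" if "agrees J s h t" using agrees_level[OF that s(2)] by simp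
    have "(\<Sum>k. ennreal (p k) * \<phi> u k) = (if u \<in> level h s then ennreal (p (num_kids u s)) else pgf y)" for u
    proof (cases "u \<in> level h s")
      case True
      then have "(\<Sum>k. ennreal (p k) * \<phi> u k) = (\<Sum>k\<in>{num_kids u s}. ennreal (p k) * \<phi> u k)"
        by (intro suminf_finite) (auto simp: \<phi>_def)
      then show ?thesis using True by (simp add: \<phi>_def)
    qed (simp add: \<phi>_def pgf_def)
    then have "(\<Prod>u\<in>level h t. \<Sum>k. ennreal (p k) * \<phi> u k) =
       (\<Prod>u\<in>level h t. if u \<in> level h s then ennreal (p (num_kids u s)) else pgf y)" by simp
    also have "\<dots> = (\<Prod>u\<in>level h s. ennreal (p (num_kids u s))) * pgf y ^ (card (level h t) - card (level h s))"
      if "agrees J s h t"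
    proof -
      have "level h t \<inter> level h s = level h s" "level h t \<inter> - level h s = level h t - level h s" using sub[OF that] by auto
      then show ?thesis using locally_finite_level(1)[OF t] ls(1) sub[OF that]
        by (simp add: prod.If_cases card_Diff_subset)
    qed
    finally have "of_bool (agrees J s h t) * (\<Prod>u\<in>level h t. \<Sum>k. ennreal (p k) * \<phi> u k) =
      (\<Prod>u\<in>level h s. ennreal (p (num_kids u s))) * (of_bool (agrees J s h t) * pgf y ^ (card (level h t) - card (level h s)))"
      by auto
    then show "of_bool (agrees J s h (truncate h (\<tau> \<omega>))) * (\<Prod>u\<in>level h (\<tau> \<omega>). \<Sum>k. ennreal (p k) * \<phi> u k) =
      (\<Prod>u\<in>level h s. ennreal (p (num_kids u s))) * (of_bool (agrees J s h (truncate h (\<tau> \<omega>))) * pgf y ^ (card (level h (truncate h (\<tau> \<omega>))) - card (level h s)))"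
      by (simp add: t_def agrees_truncate[OF h] level_truncate)
  qed
  also have "\<dots> = (\<Prod>u\<in>level h s. ennreal (p (num_kids u s))) *
     (\<integral>\<^sup>+\<omega>. of_bool (agrees J s h (truncate h (\<tau> \<omega>))) * pgf y ^ (card (level h (truncate h (\<tau> \<omega>))) - card (level h s)) \<partial>M)"
    by (rule nn_integral_cmult) (rule measurable_truncate_\<tau>)
  finally show ?thesis by (simp add: agrees_truncate[OF h] level_truncate)
qed

text \<open>
  The first generation: the root has at least \<open>J\<close> children, the first \<open>J\<close> of which belong to \<open>s\<close>.
\<close>

lemma pruned_pgf_1:
  assumes s: "s \<in> finite_trees J" "num_children [] s = enat J"
  shows "(\<integral>\<^sup>+\<omega>. of_bool (agrees J s 1 (\<tau> \<omega>)) * y ^ (card (level 1 (\<tau> \<omega>)) - card (level 1 s)) \<partial>M) = tail_pgf J y"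
proof -
  have c: "card (level 1 t) = num_kids [] t" if "t \<in> locally_finite_trees" for t
    using locally_finite_level(2)[OF that, of 0] by simp
  have "(\<integral>\<^sup>+\<omega>. of_bool (agrees J s 1 (\<tau> \<omega>)) * y ^ (card (level 1 (\<tau> \<omega>)) - card (level 1 s)) \<partial>M) =
     (\<integral>\<^sup>+\<omega>. 1 * (\<Prod>u\<in>level 0 (\<tau> \<omega>). (if J \<le> num_kids u (\<tau> \<omega>) then y ^ (num_kids u (\<tau> \<omega>) - J) else 0)) \<partial>M)"
  proof (rule nn_integral_cong)
    fix \<omega> assume w: "\<omega> \<in> space M"
    then obtain k where k: "num_children [] (\<tau> \<omega>) = enat k"
      using num_kids_enat[OF \<tau>_locally_finite[OF w], of "[]"] by metis
    show "of_bool (agrees J s 1 (\<tau> \<omega>)) * y ^ (card (level 1 (\<tau> \<omega>)) - card (level 1 s)) =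
      1 * (\<Prod>u\<in>level 0 (\<tau> \<omega>). (if J \<le> num_kids u (\<tau> \<omega>) then y ^ (num_kids u (\<tau> \<omega>) - J) else 0))"
      using c[OF \<tau>_locally_finite[OF w]] c[OF finite_trees_height(1)[OF s(1)]] k s(2)
      by (simp add: agrees_def)
  qed
  also have "\<dots> = (\<integral>\<^sup>+\<omega>. 1 * (\<Prod>u\<in>level 0 (\<tau> \<omega>). (\<Sum>k. ennreal (p k) * (if J \<le> k then y ^ (k - J) else 0))) \<partial>M)"
    by (rule branching_property)
  also have "\<dots> = tail_pgf J y" by (simp add: tail_pgf_def emeasure_space_1)
  finally show ?thesis .
qed

lemma pruned_pgf_level:
  assumes s: "s \<in> finite_trees J" "num_children [] s = enat J" and h: "h \<ge> 1"
  shows "(\<integral>\<^sup>+\<omega>. of_bool (agrees J s h (\<tau> \<omega>)) * y ^ (card (level h (\<tau> \<omega>)) - card (level h s)) \<partial>M) =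
     (\<Prod>u\<in>{u \<in> nodes s. 0 < length u \<and> length u < h}. ennreal (p (num_kids u s))) * tail_pgf J ((pgf ^^ (h - 1)) y)"
  using h
proof (induction h arbitrary: y rule: dec_induct)
  case base
  have "{u \<in> nodes s. 0 < length u \<and> length u < 1} = {}" by auto
  then show ?case using pruned_pgf_1[OF s] by simp
next
  case (step h)
  have "{u \<in> nodes s. 0 < length u \<and> length u < Suc h} = level h s \<union> {u \<in> nodes s. 0 < length u \<and> length u < h}"
    using step(1) by (auto simp: level_def)
  then have "(\<Prod>u\<in>{u \<in> nodes s. 0 < length u \<and> length u < Suc h}. ennreal (p (num_kids u s))) =
     (\<Prod>u\<in>level h s. ennreal (p (num_kids u s))) * (\<Prod>u\<in>{u \<in> nodes s. 0 < length u \<and> length u < h}. ennreal (p (num_kids u s)))"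
    using finite_nodes[OF s(1)] by (simp only:) (rule prod.union_disjoint; auto simp: level_def)
  moreover have "(pgf ^^ (Suc h - 1)) y = (pgf ^^ (h - 1)) (pgf y)"
    using step(1) by (cases h) (simp_all add: funpow_swap1)
  ultimately show ?case
    unfolding pruned_pgf_step[OF s step(1)] step.IH by (simp only: mult.assoc)
qed

text \<open>
  The generations from \<open>J\<close> to \<open>J + m\<close> are free and replace $y$ by the $m$-th iterate. At height \<open>J\<close>
  this yields one factor for each vertex of \<open>s\<close>, and the remaining vertices are handled by
  \<open>pruned_pgf_level\<close>.
\<close>

lemma pruned_pgf:
  assumes J: "J \<ge> 1" and s: "s \<in> finite_trees J" "num_children [] s = enat J"
  shows "(\<integral>\<^sup>+\<omega>. of_bool (prune J (\<tau> \<omega>) = s) * y ^ card (level (J + m) (\<tau> \<omega>)) \<partial>M) =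
     (\<Prod>u\<in>{u \<in> nodes s. 0 < length u \<and> length u < J}. ennreal (p (num_kids u s))) *
     (pgf ^^ m) y ^ card (level J s) * tail_pgf J ((pgf ^^ (m + (J - 1))) y)"
proof -
  let ?y = "(pgf ^^ m) y"
  have ag: "prune J t = s \<longleftrightarrow> agrees J s J t" for t
    using prune_eq_iff[OF s] by (simp add: agrees_def)
  have "(\<integral>\<^sup>+\<omega>. of_bool (prune J (\<tau> \<omega>) = s) * y ^ card (level (J + m) (\<tau> \<omega>)) \<partial>M) =
     (\<integral>\<^sup>+\<omega>. of_bool (agrees J s J (truncate J (\<tau> \<omega>))) * y ^ card (level (J + m) (\<tau> \<omega>)) \<partial>M)"
    by (simp add: ag agrees_truncate[OF J])
  also have "\<dots> = (\<integral>\<^sup>+\<omega>. of_bool (agrees J s J (truncate J (\<tau> \<omega>))) * ?y ^ card (level J (\<tau> \<omega>)) \<partial>M)"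
    by (rule pgf_iterate)
  also have "\<dots> = (\<integral>\<^sup>+\<omega>. ?y ^ card (level J s) * (of_bool (agrees J s J (truncate J (\<tau> \<omega>))) *
     ?y ^ (card (level J (truncate J (\<tau> \<omega>))) - card (level J s))) \<partial>M)"
  proof (rule nn_integral_cong)
    fix \<omega> assume w: "\<omega> \<in> space M"
    have "card (level J s) \<le> card (level J (\<tau> \<omega>))" if "agrees J s J (\<tau> \<omega>)"
      using agrees_level[OF that s(2)] locally_finite_level(1)[OF \<tau>_locally_finite[OF w]] by (intro card_mono) auto
    then show "of_bool (agrees J s J (truncate J (\<tau> \<omega>))) * ?y ^ card (level J (\<tau> \<omega>)) =
      ?y ^ card (level J s) * (of_bool (agrees J s J (truncate J (\<tau> \<omega>))) *
     ?y ^ (card (level J (truncate J (\<tau> \<omega>))) - card (level J s)))"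
      by (auto simp: agrees_truncate[OF J] level_truncate simp flip: power_add)
  qed
  also have "\<dots> = ?y ^ card (level J s) * (\<integral>\<^sup>+\<omega>. of_bool (agrees J s J (truncate J (\<tau> \<omega>))) *
     ?y ^ (card (level J (truncate J (\<tau> \<omega>))) - card (level J s)) \<partial>M)"
    by (rule nn_integral_cmult) (rule measurable_truncate_\<tau>)
  also have "(\<integral>\<^sup>+\<omega>. of_bool (agrees J s J (truncate J (\<tau> \<omega>))) *
     ?y ^ (card (level J (truncate J (\<tau> \<omega>))) - card (level J s)) \<partial>M) =
     (\<Prod>u\<in>{u \<in> nodes s. 0 < length u \<and> length u < J}. ennreal (p (num_kids u s))) * tail_pgf J ((pgf ^^ (J - 1)) ?y)"
    using pruned_pgf_level[OF s J, of ?y] by (simp add: agrees_truncate[OF J] level_truncate)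
  finally show ?thesis by (simp add: mult_ac funpow_add add.commute[of m])
qed

end

section \<open>From generating functions to probabilities\<close>

text \<open>
  Uniqueness of power series from values on one side of 0 only, which suffices for generating functions:
  after division by the leading power, continuity at 0 shows that the leading coefficient vanishes.
\<close>

lemma fps_eq_0_if_eval_eq_0:
  fixes F :: "real fps"
  assumes r: "fps_conv_radius F \<ge> 1" and z: "\<And>x. 0 < x \<Longrightarrow> x < 1 \<Longrightarrow> eval_fps F x = 0"
  shows "F = 0"
proof (rule ccontr)
  assume "F \<noteq> 0"
  define D where "D = fps_shift (subdegree F) F"
  have rD: "fps_conv_radius D \<ge> 1" using r by (simp add: D_def)
  have D0: "eval_fps D x = 0" if x: "0 < x" "x < 1" for x
  proof -
    have "ereal (norm x) < fps_conv_radius F" using less_le_trans[of "ereal (norm x)" 1] r x by simp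
    then show ?thesis using eval_fps_shift[of "subdegree F" F x] z[OF x] x by (simp add: D_def)
  qed
  have sub: "{0..<1::real} \<subseteq> eball 0 (fps_conv_radius D)"
  proof
    fix x :: real assume "x \<in> {0..<1}"
    then have "ereal (norm x) < 1" by simp
    also note rD
    finally have "ereal (norm x) < fps_conv_radius D" .
    then show "x \<in> eball 0 (fps_conv_radius D)" by (simp add: in_eball_iff)
  qed
  have "continuous_on {0..<1} (eval_fps D)"
    using continuous_on_subset[OF continuous_on_eval_fps sub] .
  then have "((eval_fps D) \<longlongrightarrow> eval_fps D 0) (at 0 within {0..<1})"
    by (auto simp: continuous_on_def)
  moreover have "at (0::real) within {0..<1} = at_right 0"
    by (rule at_within_nhd[of 0 "{..<1}"]) auto
  ultimately have "((eval_fps D) \<longlongrightarrow> eval_fps D 0) (at_right 0)" by simp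
  moreover have "((eval_fps D) \<longlongrightarrow> 0) (at_right 0)"
    by (rule tendsto_eventually) (auto simp: eventually_at_right[of 0 1] intro!: exI[of _ 1] D0)
  ultimately have "eval_fps D 0 = 0" by (rule tendsto_unique[rotated]) simp
  then show False using \<open>F \<noteq> 0\<close> by (simp add: eval_fps_at_0 D_def)
qed

lemma fps_conv_radius_ge_1:
  fixes F :: "real fps"
  assumes "\<And>x. 0 < x \<Longrightarrow> x < 1 \<Longrightarrow> (\<lambda>k. fps_nth F k * x ^ k) sums v x"
  shows "fps_conv_radius F \<ge> 1" "0 < x \<Longrightarrow> x < 1 \<Longrightarrow> eval_fps F x = v x"
proof -
  show "fps_conv_radius F \<ge> 1" unfolding fps_conv_radius_def
    by (rule conv_radius_geI_ex') (use assms in \<open>auto simp: sums_iff\<close>)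
  show "0 < x \<Longrightarrow> x < 1 \<Longrightarrow> eval_fps F x = v x" using assms by (simp add: eval_fps_def sums_iff)
qed

lemma sets_prune: "{t. prune J t = s} \<in> sets borel"
proof -
  have "prune J t = s \<longleftrightarrow> (\<forall>u. (u \<in> nodes t \<and> length u \<le> J \<and> (u \<noteq> [] \<longrightarrow> hd u \<le> J)) \<longleftrightarrow> u \<in> nodes s)" for t
    by (simp add: nodes_inject[symmetric] nodes_prune set_eq_iff)
  moreover have "Measurable.pred borel (\<lambda>t. \<forall>u. (u \<in> nodes t \<and> length u \<le> J \<and> (u \<noteq> [] \<longrightarrow> hd u \<le> J)) \<longleftrightarrow> u \<in> nodes s)"
    by measurable
  ultimately show ?thesis by (simp add: pred_def)
qed

context galton_watson
begin

lemma sets_card_level: "{\<omega> \<in> space M. card (level n (\<tau> \<omega>)) = a} \<in> sets M"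
proof -
  have "\<tau> -` {t. gen_size n t = enat a} \<inter> space M \<in> sets M"
    by (rule measurable_sets[OF measurable_\<tau> sets_gen_size])
  also have "\<tau> -` {t. gen_size n t = enat a} \<inter> space M = {\<omega> \<in> space M. card (level n (\<tau> \<omega>)) = a}"
    using \<tau>_locally_finite by (auto simp: gen_size_locally_finite)
  finally show ?thesis .
qed

lemma prob_card_level_eq_fps_nth:
  assumes C: "{\<omega> \<in> space M. C \<omega>} \<in> sets M"
    and F: "fps_conv_radius F \<ge> 1" and pos: "\<And>x. 0 < x \<Longrightarrow> x < 1 \<Longrightarrow> eval_fps F x \<ge> 0"
    and I: "\<And>x. 0 < x \<Longrightarrow> x < 1 \<Longrightarrow>
      (\<integral>\<^sup>+\<omega>. of_bool (C \<omega>) * ennreal x ^ card (level n (\<tau> \<omega>)) \<partial>M) = ennreal (eval_fps F x)"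
  shows "prob {\<omega> \<in> space M. C \<omega> \<and> card (level n (\<tau> \<omega>)) = a} = fps_nth F a"
proof -
  define A where "A a = {\<omega> \<in> space M. C \<omega> \<and> card (level n (\<tau> \<omega>)) = a}" for a
  have A: "A a \<in> sets M" for a
  proof -
    have "A a = {\<omega> \<in> space M. C \<omega>} \<inter> {\<omega> \<in> space M. card (level n (\<tau> \<omega>)) = a}" by (auto simp: A_def)
    then show ?thesis using C sets_card_level by simp
  qed
  define H where "H = Abs_fps (\<lambda>a. prob (A a))"
  have H: "(\<lambda>a. fps_nth H a * x ^ a) sums eval_fps F x" if x: "0 < x" "x < 1" for x
  proof -
    have "ennreal (eval_fps F x) = (\<integral>\<^sup>+\<omega>. (\<Sum>a. ennreal (x ^ a) * indicator (A a) \<omega>) \<partial>M)"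
      unfolding I[OF x, symmetric]
    proof (rule nn_integral_cong)
      fix \<omega> assume w: "\<omega> \<in> space M"
      have "(\<Sum>a. ennreal (x ^ a) * indicator (A a) \<omega>) =
          (\<Sum>a\<in>{card (level n (\<tau> \<omega>))}. ennreal (x ^ a) * indicator (A a) \<omega>)"
        by (intro suminf_finite) (auto simp: A_def)
      then show "of_bool (C \<omega>) * ennreal x ^ card (level n (\<tau> \<omega>)) = (\<Sum>a. ennreal (x ^ a) * indicator (A a) \<omega>)"
        using w x by (simp add: A_def ennreal_power indicator_def)
    qed
    also have "\<dots> = (\<Sum>a. \<integral>\<^sup>+\<omega>. ennreal (x ^ a) * indicator (A a) \<omega> \<partial>M)"
      using A by (intro nn_integral_suminf) simp
    also have "\<dots> = (\<Sum>a. ennreal (fps_nth H a * x ^ a))"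
      using A x by (simp add: nn_integral_cmult_indicator emeasure_eq_measure H_def ennreal_mult mult.commute)
    finally have "(\<lambda>a. ennreal (fps_nth H a * x ^ a)) sums ennreal (eval_fps F x)"
      by (simp add: sums_iff)
    then show ?thesis using pos[OF x] x by (subst (asm) sums_ennreal) (auto simp: H_def)
  qed
  have H': "fps_conv_radius H \<ge> 1" "\<And>x. 0 < x \<Longrightarrow> x < 1 \<Longrightarrow> eval_fps H x = eval_fps F x"
    using fps_conv_radius_ge_1[of H "eval_fps F"] H by blast+
  have "H - F = 0"
  proof (rule fps_eq_0_if_eval_eq_0)
    show "fps_conv_radius (H - F) \<ge> 1"
      using fps_conv_radius_diff[of H F] H'(1) F by (meson dual_order.trans min.boundedI)
    fix x :: real assume x: "0 < x" "x < 1"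
    then have "ereal (norm x) < 1" by simp
    then have "ereal (norm x) < fps_conv_radius H" "ereal (norm x) < fps_conv_radius F"
      using less_le_trans H'(1) F by blast+
    then show "eval_fps (H - F) x = 0" using H'(2)[OF x] by (simp add: eval_fps_diff)
  qed
  then have "fps_nth H a = fps_nth F a" by simp
  then show ?thesis by (simp add: H_def A_def)
qed

end

context geometric_offspring
begin

lemma gen_fps_eval:
  assumes "n \<ge> 1"
  shows "fps_conv_radius (gen_fps n) \<ge> 1" "0 < x \<Longrightarrow> x < 1 \<Longrightarrow> eval_fps (gen_fps n) x = gen_pgf n x"
proof -
  have "(\<lambda>k. fps_nth (gen_fps n) k * x ^ k) sums gen_pgf n x" if "0 < x" "x < 1" for x
    using gen_fps_sums[OF assms, of x] g_gt[OF assms] that by simp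
  then show "fps_conv_radius (gen_fps n) \<ge> 1" "0 < x \<Longrightarrow> x < 1 \<Longrightarrow> eval_fps (gen_fps n) x = gen_pgf n x"
    using fps_conv_radius_ge_1[of "gen_fps n"] by blast+
qed

text \<open>
  The constant by which $1/(1 - (1-q) f_{n-1})$ and $f_n$ differ up to a factor; see \<open>tail_pgf_shift\<close>.
\<close>

definition shift_const :: real where "shift_const = (\<eta> + q - 1) / (1 - q)"

text \<open>
  The generating function of the descendants of the root's children beyond the $J$-th is
  affine in $f_{n+1}$, because $x/(1 - (1-q)x)$ and $1/(1 - (1-q)x)$ are affine functions of each other.
\<close>

lemma tail_pgf_shift:
  assumes "J \<ge> 1" "n \<ge> 1" "0 \<le> x" "x \<le> 1"
  shows "\<eta> * q * (1 - q) ^ (J - 1) / (1 - (1 - q) * gen_pgf n x) = (1 - q) ^ J * (gen_pgf (Suc n) x + shift_const)"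
proof -
  define y where "y = gen_pgf n x"
  have y: "0 \<le> y" "y \<le> 1" using gen_pgf_range[OF assms(2-4)] by (simp_all add: y_def)
  have d: "1 - (1 - q) * y > 0" "1 - q > 0" using scaled_less_1[OF y(2)] q_less by auto
  have "gen_pgf (Suc n) x = offspring_pgf y"
    using gen_pgf_Suc[OF assms(2-4)] offspring_pgf_eq[OF y] by (simp add: y_def)
  moreover have "(1 - q) * (offspring_pgf y + shift_const) = \<eta> * q / (1 - (1 - q) * y)"
  proof -
    have "(1 - q) * (offspring_pgf y + shift_const) = (1 - q) * offspring_pgf y + (\<eta> + q - 1)"
      using d by (simp add: shift_const_def distrib_left)
    also have "\<dots> = \<eta> * q * (1 + (1 - q) * y / (1 - (1 - q) * y))"
      unfolding offspring_pgf_def by (simp add: distrib_left) (simp add: algebra_simps)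
    also have "1 + (1 - q) * y / (1 - (1 - q) * y) = 1 / (1 - (1 - q) * y)"
      using d by (simp add: field_simps)
    finally show ?thesis by simp
  qed
  moreover have "(1 - q) ^ J = (1 - q) ^ (J - 1) * (1 - q)" using assms(1) by (cases J) auto
  ultimately show ?thesis by (simp add: y_def mult.assoc mult.left_commute)
qed

context
  fixes M :: "'a measure" and \<tau> :: "'a \<Rightarrow> tree"
  assumes gw: "galton_watson_tree (geo_offspring \<eta> q) M \<tau>"
begin

interpretation gw: galton_watson "geo_offspring \<eta> q" M \<tau>
  using gw geo_offspring_nonneg by unfold_locales

lemma pgf_geo: "0 \<le> x \<Longrightarrow> x \<le> 1 \<Longrightarrow> gw.pgf (ennreal x) = ennreal (offspring_pgf x)"
  unfolding gw.pgf_def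
  using suminf_ennreal_eq[OF _ offspring_pgf_sums[of x]] geo_offspring_nonneg
  by (simp add: ennreal_power ennreal_mult)

lemma pgf_geo_funpow:
  assumes "n \<ge> 1" "0 \<le> x" "x \<le> 1"
  shows "(gw.pgf ^^ n) (ennreal x) = ennreal (gen_pgf n x)"
  using assms(1)
proof (induction n rule: dec_induct)
  case base
  then show ?case using assms by (simp add: pgf_geo offspring_pgf_eq)
next
  case (step n)
  then show ?case
    using gen_pgf_range[of n x] gen_pgf_Suc[of n x] assms by (simp add: pgf_geo offspring_pgf_eq)
qed

lemma tail_pgf_geo:
  assumes "J \<ge> 1" "0 \<le> x" "x \<le> 1"
  shows "gw.tail_pgf J (ennreal x) = ennreal (\<eta> * q * (1 - q) ^ (J - 1) / (1 - (1 - q) * x))"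
proof -
  have "ennreal (geo_offspring \<eta> q k) * (if J \<le> k then ennreal x ^ (k - J) else 0) =
    ennreal (if J \<le> k then geo_offspring \<eta> q k * x ^ (k - J) else 0)" for k
    using assms geo_offspring_nonneg by (simp add: ennreal_power ennreal_mult)
  moreover have "0 \<le> (if J \<le> k then geo_offspring \<eta> q k * x ^ (k - J) else 0)" for k
    using assms geo_offspring_nonneg by simp
  ultimately show ?thesis unfolding gw.tail_pgf_def
    using suminf_ennreal_eq[OF _ tail_pgf_sums[OF assms]] by presburger
qed

lemma prob_generation_size:
  assumes "n \<ge> 1"
  shows "measure M {\<omega> \<in> space M. card (level n (\<tau> \<omega>)) = a} = fps_nth (gen_fps n) a"
proof -
  have "measure M {\<omega> \<in> space M. True \<and> card (level n (\<tau> \<omega>)) = a} = fps_nth (gen_fps n) a"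
  proof (rule gw.prob_card_level_eq_fps_nth)
    fix x :: real assume x: "0 < x" "x < 1"
    show "eval_fps (gen_fps n) x \<ge> 0" using gen_fps_eval(2)[OF assms x] gen_pgf_range[OF assms] x by simp
    show "(\<integral>\<^sup>+\<omega>. of_bool True * ennreal x ^ card (level n (\<tau> \<omega>)) \<partial>M) = ennreal (eval_fps (gen_fps n) x)"
      using gw.pgf_iterate[of "\<lambda>_. 1" 0 "ennreal x" n] pgf_geo_funpow[OF assms] x gen_fps_eval(2)[OF assms x]
      by (simp add: gw.emeasure_space_1)
  qed (use gen_fps_eval[OF assms] in auto)
  then show ?thesis by simp
qed

text \<open>
  The joint law of the pruned tree and of $Z_{m+J}$, in terms of coefficients: one factor
  \<open>gen_fps m\<close> for each vertex of \<open>s\<close> at height \<open>J\<close>, and a single factor for all children of the root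
  beyond the \<open>J\<close>-th.
\<close>

lemma prob_prune_generation_size:
  assumes J: "J \<ge> 1" and s: "s \<in> finite_trees J" "num_children [] s = enat J" and m: "m \<ge> 1"
  shows "measure M {\<omega> \<in> space M. prune J (\<tau> \<omega>) = s \<and> card (level (m + J) (\<tau> \<omega>)) = a} =
     (\<Prod>u\<in>{u \<in> nodes s. 0 < length u \<and> length u < J}. geo_offspring \<eta> q (num_kids u s)) * (1 - q) ^ J *
     fps_nth ((gen_fps (m + J) + fps_const shift_const) * gen_fps m ^ card (level J s)) a"
proof -
  define P where "P = (\<Prod>u\<in>{u \<in> nodes s. 0 < length u \<and> length u < J}. geo_offspring \<eta> q (num_kids u s))"
  define z where "z = card (level J s)"
  define F where "F = fps_const (P * (1 - q) ^ J) * ((gen_fps (m + J) + fps_const shift_const) * gen_fps m ^ z)"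
  have P: "P \<ge> 0" by (simp add: P_def prod_nonneg geo_offspring_nonneg)
  have mJ: "m + J \<ge> 1" using m by simp
  note r = gen_fps_eval(1)[OF m] gen_fps_eval(1)[OF mJ]
  have r1: "fps_conv_radius (gen_fps (m + J) + fps_const shift_const) \<ge> 1"
    using fps_conv_radius_add[of "gen_fps (m + J)" "fps_const shift_const"] r by (simp add: min_def split: if_splits)
  have r2: "fps_conv_radius (gen_fps m ^ z) \<ge> 1"
    using fps_conv_radius_power[of "gen_fps m" z] r by (meson dual_order.trans)
  have r3: "fps_conv_radius ((gen_fps (m + J) + fps_const shift_const) * gen_fps m ^ z) \<ge> 1"
    using fps_conv_radius_mult[of "gen_fps (m + J) + fps_const shift_const" "gen_fps m ^ z"] r1 r2
    by (simp add: min_def split: if_splits)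
  have r4: "fps_conv_radius F \<ge> 1"
    using fps_conv_radius_mult[of "fps_const (P * (1 - q) ^ J)" "(gen_fps (m + J) + fps_const shift_const) * gen_fps m ^ z"] r3
    unfolding F_def by (simp add: min_def split: if_splits)
  have ev: "eval_fps F x = P * (gen_pgf m x ^ z * (\<eta> * q * (1 - q) ^ (J - 1) / (1 - (1 - q) * gen_pgf (m + (J - 1)) x)))"
    if x: "0 < x" "x < 1" for x
  proof -
    have x1: "ereal (norm x) < 1" using x by simp
    have "eval_fps F x = P * (1 - q) ^ J * ((gen_pgf (m + J) x + shift_const) * gen_pgf m x ^ z)"
      unfolding F_def
      using less_le_trans[OF x1 r1] less_le_trans[OF x1 r2] less_le_trans[OF x1 r3]
        less_le_trans[OF x1 r(1)] less_le_trans[OF x1 r(2)] gen_fps_eval(2)[OF m x] gen_fps_eval(2)[OF mJ x]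
      by (simp add: eval_fps_mult eval_fps_add eval_fps_power)
    also have "\<dots> = P * (gen_pgf m x ^ z * ((1 - q) ^ J * (gen_pgf (Suc (m + (J - 1))) x + shift_const)))"
      using J by (simp add: mult_ac)
    finally show ?thesis using tail_pgf_shift[OF J, of "m + (J - 1)" x] m x by simp
  qed
  have "measure M {\<omega> \<in> space M. prune J (\<tau> \<omega>) = s \<and> card (level (m + J) (\<tau> \<omega>)) = a} = fps_nth F a"
  proof (rule gw.prob_card_level_eq_fps_nth[OF _ r4])
    show "{\<omega> \<in> space M. prune J (\<tau> \<omega>) = s} \<in> sets M"
      using measurable_sets[OF gw.measurable_\<tau> sets_prune[of J s]] by (simp add: vimage_def Int_def conj_commute)
    fix x :: real assume x: "0 < x" "x < 1"
    have y: "0 \<le> gen_pgf i x" "gen_pgf i x \<le> 1" if "i \<ge> 1" for i using gen_pgf_range[OF that] x by auto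
    define T where "T = \<eta> * q * (1 - q) ^ (J - 1) / (1 - (1 - q) * gen_pgf (m + (J - 1)) x)"
    have T: "T \<ge> 0" unfolding T_def using eta_pos q_pos q_less scaled_less_1[OF y(2)[of "m + (J - 1)"]] m by simp
    show "eval_fps F x \<ge> 0" unfolding ev[OF x] T_def[symmetric] using P T y[OF m] by simp
    have "(\<integral>\<^sup>+\<omega>. of_bool (prune J (\<tau> \<omega>) = s) * ennreal x ^ card (level (m + J) (\<tau> \<omega>)) \<partial>M) =
      (\<Prod>u\<in>{u \<in> nodes s. 0 < length u \<and> length u < J}. ennreal (geo_offspring \<eta> q (num_kids u s))) *
      ennreal (gen_pgf m x) ^ z * gw.tail_pgf J (ennreal (gen_pgf (m + (J - 1)) x))"
      using gw.pruned_pgf[OF J s, of "ennreal x" m] pgf_geo_funpow[OF m, of x] pgf_geo_funpow[of "m + (J - 1)" x] m x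
      by (simp add: z_def add.commute)
    also have "\<dots> = ennreal P * ennreal (gen_pgf m x) ^ z * ennreal T"
      using tail_pgf_geo[OF J y[of "m + (J - 1)"]] m
      by (simp add: P_def T_def prod_ennreal geo_offspring_nonneg)
    also have "\<dots> = ennreal (eval_fps F x)"
      unfolding ev[OF x] T_def[symmetric] using P T y[OF m] by (simp add: ennreal_mult ennreal_power mult.assoc)
    finally show "(\<integral>\<^sup>+\<omega>. of_bool (prune J (\<tau> \<omega>) = s) * ennreal x ^ card (level (m + J) (\<tau> \<omega>)) \<partial>M) = ennreal (eval_fps F x)" .
  qed
  then show ?thesis by (simp add: F_def P_def z_def mult.assoc)
qed

end

section \<open>The law of the limit tree\<close>

text \<open>
  A vertex at height \<open>l\<close> contributes $\gamma_{l+1}^k/\gamma_l$, and the sum of the numbers of children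
  on one level is the size of the next. So the product telescopes from level 1, which has \<open>J\<close>
  vertices, with $\gamma_1 = 1/(1-q)$, to level \<open>h\<close>.
\<close>

lemma prod_tilted_offspring:
  assumes s: "s \<in> finite_trees J" "num_children [] s = enat J" and h: "h \<ge> 1"
  shows "(\<Prod>u\<in>{u \<in> nodes s. 0 < length u \<and> length u < h}. tilted_offspring \<eta> q (length u) (num_kids u s)) =
    (\<Prod>u\<in>{u \<in> nodes s. 0 < length u \<and> length u < h}. geo_offspring \<eta> q (num_kids u s)) * (1 - q) ^ J *
    g h ^ card (level h s)"
  using h
proof (induction h rule: dec_induct)
  case base
  have "{u \<in> nodes s. 0 < length u \<and> length u < 1} = {}" by auto
  moreover have "card (level 1 s) = J" using locally_finite_level(2)[OF finite_trees_height(1)[OF s(1)], of 0] s(2) by simp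
  ultimately show ?case using q_less g_1 by (simp add: power_divide)
next
  case (step h)
  have fin: "finite (level h s)" "card (level (Suc h) s) = (\<Sum>u\<in>level h s. num_kids u s)"
    using locally_finite_level[OF finite_trees_height(1)[OF s(1)]] by auto
  have "{u \<in> nodes s. 0 < length u \<and> length u < Suc h} = level h s \<union> {u \<in> nodes s. 0 < length u \<and> length u < h}"
    using step(1) by (auto simp: level_def)
  then have split: "(\<Prod>u\<in>{u \<in> nodes s. 0 < length u \<and> length u < Suc h}. f u) =
     (\<Prod>u\<in>level h s. f u) * (\<Prod>u\<in>{u \<in> nodes s. 0 < length u \<and> length u < h}. f u)" for f :: "word \<Rightarrow> real"
    using finite_nodes[OF s(1)] by (simp only:) (rule prod.union_disjoint; auto simp: level_def)
  have "(\<Prod>u\<in>level h s. tilted_offspring \<eta> q (length u) (num_kids u s)) =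
    (\<Prod>u\<in>level h s. g (h + 1) ^ num_kids u s / g h * geo_offspring \<eta> q (num_kids u s))"
    by (intro prod.cong) (auto simp: level_def tilted_offspring_def)
  also have "\<dots> = g (Suc h) ^ card (level (Suc h) s) / g h ^ card (level h s) * (\<Prod>u\<in>level h s. geo_offspring \<eta> q (num_kids u s))"
    by (simp add: prod.distrib prod_dividef power_sum fin)
  finally have e: "(\<Prod>u\<in>level h s. tilted_offspring \<eta> q (length u) (num_kids u s)) =
    g (Suc h) ^ card (level (Suc h) s) / g h ^ card (level h s) * (\<Prod>u\<in>level h s. geo_offspring \<eta> q (num_kids u s))" .
  have "g h > 0" using g_gt[OF step(1)] by simp
  then show ?case unfolding split e step.IH by simp
qed

lemma measure_tilted_law:
  assumes "h \<ge> 1" shows "measure (tilted_law \<eta> q h) {enat k} = tilted_offspring \<eta> q h k"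
proof -
  have "enat -` {enat k} = {k}" by auto
  then have "emeasure (tilted_law \<eta> q h) {enat k} = ennreal (tilted_offspring \<eta> q h k)"
    using assms by (simp add: tilted_law_def emeasure_distr emeasure_density)
  then show ?thesis
    using tilted_offspring_nonneg[OF eta_pos eta_le q_pos q_less assms] by (simp add: measure_def)
qed

lemma prob_prune_limit:
  assumes J: "J \<ge> 1" and s: "s \<in> finite_trees J" "num_children [] s = enat J"
  shows "measure (inhom_gw_law (tilted_law \<eta> q)) {t. prune J t = s} =
    (\<Prod>u\<in>{u \<in> nodes s. 0 < length u \<and> length u < J}. geo_offspring \<eta> q (num_kids u s)) * (1 - q) ^ J *
    g J ^ card (level J s)"
proof -
  let ?\<nu> = "\<lambda>u::word. tilted_law \<eta> q (length u)" and ?B = "{u \<in> nodes s. 0 < length u \<and> length u < J}"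
  let ?P = "PiM words ?\<nu>"
  interpret product_prob_space ?\<nu> words
    by (intro product_prob_spaceI prob_space_tilted_law eta_pos eta_le q_pos q_less)
  (* The event is a cylinder; the root enters through an inequality of probability one. *)
  define X where "X u = (if u = [] then {enat J..} else {num_children u s})" for u :: word
  have words: "insert [] ?B \<subseteq> words" using nodes[of s] by (auto simp: is_tree_def)
  have "tree_of \<in> ?P \<rightarrow>\<^sub>M borel" by (rule measurable_tree_of) (simp add: sets_tilted_law)
  then have "measure (inhom_gw_law (tilted_law \<eta> q)) {t. prune J t = s} = measure ?P (tree_of -` {t. prune J t = s} \<inter> space ?P)"
    unfolding inhom_gw_law_def by (rule measure_distr) (rule sets_prune)
  also have "tree_of -` {t. prune J t = s} \<inter> space ?P = {\<xi> \<in> space ?P. \<forall>u\<in>insert [] ?B. \<xi> u \<in> X u}"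
  proof -
    have "prune J (tree_of \<xi>) = s \<longleftrightarrow> (\<forall>u\<in>insert [] ?B. \<xi> u \<in> X u)" for \<xi>
    proof
      assume eq: "prune J (tree_of \<xi>) = s"
      have "u \<in> nodes (tree_of \<xi>)" if "u \<in> nodes s" for u
        using that nodes_prune[of u J "tree_of \<xi>"] eq by simp
      then show "\<forall>u\<in>insert [] ?B. \<xi> u \<in> X u"
        using eq prune_eq_iff[OF s] by (auto simp: X_def num_children_tree_of)
    next
      assume R: "\<forall>u\<in>insert [] ?B. \<xi> u \<in> X u"
      have "u \<in> nodes s \<longrightarrow> u \<in> nodes (tree_of \<xi>)" for u
      proof (induction u rule: rev_induct)
        case (snoc i u)
        show ?case
        proof
          assume "u @ [i] \<in> nodes s"
          then have u: "u \<in> nodes s" "1 \<le> i" "enat i \<le> num_children u s" "length u < J"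
            using num_children_finite_trees[OF s(1), of u]
            by (auto simp: snoc_in_nodes zero_enat_def intro: ccontr)
          have "enat i \<le> \<xi> u"
          proof (cases "u = []")
            case True
            then show ?thesis using R u(3) s(2) by (auto simp: X_def intro: order_trans[of _ "enat J"])
          next
            case False
            then show ?thesis using R u by (auto simp: X_def)
          qed
          then show "u @ [i] \<in> nodes (tree_of \<xi>)" using u snoc by (simp add: snoc_in_nodes_tree_of)
        qed
      qed simp
      then show "prune J (tree_of \<xi>) = s"
        using R prune_eq_iff[OF s] by (auto simp: X_def num_children_tree_of)
    qed
    then show ?thesis by auto
  qed
  also have "measure ?P \<dots> = (\<Prod>u\<in>insert [] ?B. measure (?\<nu> u) (X u))"
  proof -
    have "emeasure ?P {\<xi> \<in> space ?P. \<forall>u\<in>insert [] ?B. \<xi> u \<in> X u} = (\<Prod>u\<in>insert [] ?B. emeasure (?\<nu> u) (X u))"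
      by (rule emeasure_PiM_Collect[OF words]) (use finite_nodes[OF s(1)] in \<open>auto simp: sets_tilted_law\<close>)
    then show ?thesis
      unfolding P.emeasure_eq_measure M.emeasure_eq_measure
      by (simp add: prod_ennreal measure_nonneg prod_nonneg del: prod.insert_if prod.insert)
  qed
  also have "\<dots> = measure (?\<nu> []) (X []) * (\<Prod>u\<in>?B. measure (?\<nu> u) (X u))"
    using finite_nodes[OF s(1)] by (subst prod.insert) auto
  also have "measure (?\<nu> []) (X []) = 1"
    by (simp add: X_def tilted_law_def measure_return)
  also have "(\<Prod>u\<in>?B. measure (?\<nu> u) (X u)) = (\<Prod>u\<in>?B. tilted_offspring \<eta> q (length u) (num_kids u s))"
  proof (rule prod.cong[OF refl])
    fix u assume u: "u \<in> ?B"
    then have "X u = {enat (num_kids u s)}"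
      using num_kids_enat[OF finite_trees_height(1)[OF s(1)], of u] by (auto simp: X_def)
    then show "measure (?\<nu> u) (X u) = tilted_offspring \<eta> q (length u) (num_kids u s)"
      using u measure_tilted_law[of "length u"] by (simp add: Suc_le_eq)
  qed
  finally show ?thesis using prod_tilted_offspring[OF s J] by simp
qed

lemma num_children_infinite_iff:
  assumes "u \<in> nodes t"
  shows "num_children u t = \<infinity> \<longleftrightarrow> (\<forall>i\<ge>1. u @ [i] \<in> nodes t)"
proof
  assume R: "\<forall>i\<ge>1. u @ [i] \<in> nodes t"
  show "num_children u t = \<infinity>"
  proof (cases "num_children u t")
    case (enat k)
    then show ?thesis using R[rule_format, of "Suc k"] by (simp add: snoc_in_nodes)
  qed simp
qed (use assms in \<open>simp add: snoc_in_nodes\<close>)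

text \<open>
  A vertex has infinitely many children iff all its possible children belong to the tree; this leaves only countable quantifiers.
\<close>

lemma sets_root_infinite_trees: "root_infinite_trees \<in> sets borel"
proof -
  have "t \<in> root_infinite_trees \<longleftrightarrow> (\<forall>i. 1 \<le> i \<longrightarrow> [] @ [i] \<in> nodes t) \<and>
      (\<forall>u. u \<in> nodes t \<and> u \<noteq> [] \<longrightarrow> \<not> (\<forall>i. 1 \<le> i \<longrightarrow> u @ [i] \<in> nodes t))" for t
  proof -
    have "num_children u t < \<infinity> \<longleftrightarrow> \<not> (\<forall>i. 1 \<le> i \<longrightarrow> u @ [i] \<in> nodes t)" if "u \<in> nodes t" for u
      unfolding num_children_infinite_iff[OF that, symmetric] by simp
    moreover have "num_children [] t = \<infinity> \<longleftrightarrow> (\<forall>i. 1 \<le> i \<longrightarrow> [] @ [i] \<in> nodes t)"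
      by (rule num_children_infinite_iff) simp
    ultimately show ?thesis unfolding root_infinite_trees_def mem_Collect_eq by blast
  qed
  moreover have "Measurable.pred borel (\<lambda>t. (\<forall>i. 1 \<le> i \<longrightarrow> [] @ [i] \<in> nodes t) \<and>
      (\<forall>u. u \<in> nodes t \<and> u \<noteq> [] \<longrightarrow> \<not> (\<forall>i. 1 \<le> i \<longrightarrow> u @ [i] \<in> nodes t)))"
    by measurable
  ultimately have "Measurable.pred borel (\<lambda>t. t \<in> root_infinite_trees)" by presburger
  then show ?thesis by (simp add: pred_def)
qed

lemma AE_limit_root_infinite: "AE t in inhom_gw_law (tilted_law \<eta> q). t \<in> root_infinite_trees"
proof -
  let ?\<nu> = "\<lambda>u::word. tilted_law \<eta> q (length u)"
  let ?P = "PiM words ?\<nu>"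
  have comp: "AE k in ?\<nu> u. (u = [] \<longleftrightarrow> k = \<infinity>)" for u
  proof (cases "u = []")
    case True
    have "tilted_law \<eta> q (length u) = return (count_space UNIV) \<infinity>" by (simp add: True tilted_law_def)
    then show ?thesis using True by (simp only: AE_return)(simp add: AE_return)
  next
    case False
    have "tilted_law \<eta> q (length u) =
      distr (density (count_space UNIV) (\<lambda>k. ennreal (tilted_offspring \<eta> q (length u) k))) (count_space UNIV) enat"
      using False by (simp add: tilted_law_def)
    then show ?thesis using False by (simp only:) (simp add: AE_distr_iff)
  qed
  have "AE \<xi> in ?P. \<forall>u\<in>words. (u = [] \<longleftrightarrow> \<xi> u = \<infinity>)"
  proof (rule AE_ball_countable')
    fix u assume "u \<in> words"
    then show "AE \<xi> in ?P. (u = [] \<longleftrightarrow> \<xi> u = \<infinity>)"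
      by (intro AE_PiM_component comp prob_space_tilted_law eta_pos eta_le q_pos q_less)
  qed simp
  then have "AE \<xi> in ?P. tree_of \<xi> \<in> root_infinite_trees"
  proof (rule AE_mp, intro AE_I2 impI)
    fix \<xi> :: "word \<Rightarrow> enat" assume R: "\<forall>u\<in>words. (u = [] \<longleftrightarrow> \<xi> u = \<infinity>)"
    have w: "u \<in> words" if "u \<in> nodes (tree_of \<xi>)" for u
      using that nodes[of "tree_of \<xi>"] by (auto simp: is_tree_def)
    have "[] \<in> words" by (simp add: words_def)
    then show "tree_of \<xi> \<in> root_infinite_trees"
      using R w by (auto simp: root_infinite_trees_def num_children_tree_of simp del: not_infinity_eq)
  qed
  then show ?thesis
    unfolding inhom_gw_law_def using sets_root_infinite_trees
    by (subst AE_distr_iff) (auto intro!: measurable_tree_of simp: sets_tilted_law)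
qed

end

section \<open>Weak convergence from the probabilities of cells\<close>

text \<open>
  For each \<open>J\<close> the map \<open>c J\<close> partitions the space into cells, and every neighbourhood of
  \<open>L\<close>-almost every point contains the cell of the point for all large \<open>J\<close>. Replacing \<open>f\<close> by its infimum on each cell gives a
  function below \<open>f\<close> with countably many values, to whose expectation Fatou's lemma for sums applies
  as \<open>n\<close> tends to infinity; a second application of Fatou's lemma, as \<open>J\<close> tends to infinity, recovers \<open>f\<close>.
\<close>

lemma lower_semicontinuity_cells:
  fixes N :: "nat \<Rightarrow> 'x::topological_space measure" and L :: "'x measure"
    and c :: "nat \<Rightarrow> 'x \<Rightarrow> 'l" and S :: "nat \<Rightarrow> 'l set" and f :: "'x \<Rightarrow> real"
  assumes N: "\<And>n. prob_space (N n)" "\<And>n. sets (N n) = sets borel"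
    and L: "prob_space L" "sets L = sets borel"
    and S: "\<And>J. countable (S J)" and cells: "\<And>J s. s \<in> S J \<Longrightarrow> {x. c J x = s} \<in> sets borel"
    and lim: "\<And>J s. s \<in> S J \<Longrightarrow> (\<lambda>n. measure (N n) {x. c J x = s}) \<longlonglongrightarrow> measure L {x. c J x = s}"
    and AE: "AE x in L. (\<forall>J. c J x \<in> S J) \<and>
      (\<forall>V. open V \<longrightarrow> x \<in> V \<longrightarrow> eventually (\<lambda>J. \<forall>x'. c J x' = c J x \<longrightarrow> x' \<in> V) sequentially)"
    and f: "continuous_on UNIV f" "\<And>x. 0 \<le> f x" "\<And>x. f x \<le> B"
  shows "(\<integral>\<^sup>+x. f x \<partial>L) \<le> liminf (\<lambda>n. \<integral>\<^sup>+x. f x \<partial>N n)"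
proof -
  (* The bound B keeps the value finite on an empty cell. *)
  define m where "m J s = min (ennreal B) (INF x\<in>{x. c J x = s}. ennreal (f x))" for J s
  define h where "h J x = (\<integral>\<^sup>+s. m J s * indicator {x. c J x = s} x \<partial>count_space (S J))" for J x
  have h: "h J x = (if c J x \<in> S J then m J (c J x) else 0)" for J x
  proof (cases "c J x \<in> S J")
    case True
    then show ?thesis unfolding h_def
      by (subst nn_integral_count_space'[where A="{c J x}"]) (auto simp: indicator_def)
  next
    case False
    then have "h J x = (\<integral>\<^sup>+s. 0 \<partial>count_space (S J))"
      unfolding h_def by (intro nn_integral_cong) (auto simp: indicator_def)
    then show ?thesis using False by simp
  qed
  have h_le: "h J x \<le> ennreal (f x)" for J x
    unfolding h m_def by (auto intro!: min.coboundedI2 INF_lower)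
  have h_int: "(\<integral>\<^sup>+x. h J x \<partial>K) = (\<integral>\<^sup>+s. m J s * emeasure K {x. c J x = s} \<partial>count_space (S J))"
    and h_meas: "h J \<in> borel_measurable K"
    if K: "sets K = sets borel" for K :: "'x measure" and J
  proof -
    have sets: "{x. c J x = s} \<in> sets K" if "s \<in> S J" for s using cells[OF that] K by simp
    then show "(\<integral>\<^sup>+x. h J x \<partial>K) = (\<integral>\<^sup>+s. m J s * emeasure K {x. c J x = s} \<partial>count_space (S J))"
      unfolding h_def
      by (subst nn_integral_count_space_nn_integral[OF S])
         (auto intro!: nn_integral_cong nn_integral_cmult_indicator)
    show "h J \<in> borel_measurable K"
    proof (rule measurableI)
      fix A :: "ennreal set" assume "A \<in> sets borel"
      define U where "U = (\<Union>s\<in>S J. {x. c J x = s})"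
      have U: "U \<in> sets K" unfolding U_def using sets S by (intro sets.countable_UN') auto
      have "(\<Union>s\<in>{s \<in> S J. m J s \<in> A}. {x. c J x = s}) \<in> sets K"
        using sets by (intro sets.countable_UN' countable_subset[OF _ S[of J]]) auto
      moreover have "h J -` A \<inter> space K = (\<Union>s\<in>{s \<in> S J. m J s \<in> A}. {x. c J x = s}) \<union>
          (if 0 \<in> A then space K - U else {})"
        using sets_eq_imp_space_eq[OF K] by (auto simp: h U_def split: if_splits)
      ultimately show "h J -` A \<inter> space K \<in> sets K" using U by auto
    qed simp
  qed
  have lower: "(\<integral>\<^sup>+x. h J x \<partial>L) \<le> liminf (\<lambda>n. \<integral>\<^sup>+x. f x \<partial>N n)" for J
  proof -
    have "(\<integral>\<^sup>+x. h J x \<partial>L) = (\<integral>\<^sup>+s. liminf (\<lambda>n. m J s * emeasure (N n) {x. c J x = s}) \<partial>count_space (S J))"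
      unfolding h_int[OF L(2)]
    proof (rule nn_integral_cong)
      fix s assume "s \<in> space (count_space (S J))"
      then have "(\<lambda>n. ennreal (measure (N n) {x. c J x = s})) \<longlonglongrightarrow> ennreal (measure L {x. c J x = s})"
        using lim by (intro tendsto_ennrealI) simp
      then have "(\<lambda>n. emeasure (N n) {x. c J x = s}) \<longlonglongrightarrow> emeasure L {x. c J x = s}"
        using finite_measure.emeasure_eq_measure[OF prob_space.finite_measure[OF N(1)]]
          finite_measure.emeasure_eq_measure[OF prob_space.finite_measure[OF L(1)]] by simp
      then have "(\<lambda>n. m J s * emeasure (N n) {x. c J x = s}) \<longlonglongrightarrow> m J s * emeasure L {x. c J x = s}"
        by (intro ennreal_tendsto_cmult) (auto simp: m_def min_less_iff_disj)
      then show "m J s * emeasure L {x. c J x = s} = liminf (\<lambda>n. m J s * emeasure (N n) {x. c J x = s})"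
        using lim_imp_Liminf[OF sequentially_bot] by metis
    qed
    also have "\<dots> \<le> liminf (\<lambda>n. \<integral>\<^sup>+s. m J s * emeasure (N n) {x. c J x = s} \<partial>count_space (S J))"
      by (rule nn_integral_liminf) simp
    also have "\<dots> = liminf (\<lambda>n. \<integral>\<^sup>+x. h J x \<partial>N n)" using h_int[OF N(2)] by simp
    also have "\<dots> \<le> liminf (\<lambda>n. \<integral>\<^sup>+x. f x \<partial>N n)"
      by (intro Liminf_mono always_eventually allI nn_integral_mono h_le)
    finally show ?thesis .
  qed
  have "(\<integral>\<^sup>+x. f x \<partial>L) \<le> (\<integral>\<^sup>+x. liminf (\<lambda>J. h J x) \<partial>L)"
  proof (rule nn_integral_mono_AE, use AE in eventually_elim)
    fix x
    assume good: "(\<forall>J. c J x \<in> S J) \<and>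
      (\<forall>V. open V \<longrightarrow> x \<in> V \<longrightarrow> eventually (\<lambda>J. \<forall>x'. c J x' = c J x \<longrightarrow> x' \<in> V) sequentially)"
    show "ennreal (f x) \<le> liminf (\<lambda>J. h J x)"
      unfolding le_Liminf_iff
    proof (intro allI impI)
      fix y assume "y < ennreal (f x)"
      then obtain y' where y': "y < y'" "y' < ennreal (f x)" using dense by blast
      have "continuous_on UNIV (\<lambda>x. ennreal (f x))" using f(1) by (intro continuous_on_ennreal)
      then have "open {z. y' < ennreal (f z)}" by (intro open_Collect_less continuous_on_const)
      then have "eventually (\<lambda>J. \<forall>x'. c J x' = c J x \<longrightarrow> x' \<in> {z. y' < ennreal (f z)}) sequentially"
        using good y'(2) by blast
      then show "eventually (\<lambda>J. y < h J x) sequentially"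
      proof eventually_elim
        case (elim J)
        have "ennreal (f x) \<le> ennreal B" using f(3) by (intro ennreal_leI)
        moreover have "y' \<le> (INF x'\<in>{x'. c J x' = c J x}. ennreal (f x'))"
          using elim by (intro INF_greatest) (auto intro: less_imp_le)
        ultimately have "y' \<le> h J x" unfolding h m_def using good y'(2) by auto
        with y'(1) show ?case by (rule less_le_trans)
      qed
    qed
  qed
  also have "\<dots> \<le> liminf (\<lambda>J. \<integral>\<^sup>+x. h J x \<partial>L)"
    by (rule nn_integral_liminf) (rule h_meas[OF L(2)])
  also have "\<dots> \<le> liminf (\<lambda>n. \<integral>\<^sup>+x. f x \<partial>N n)"
    using Liminf_mono[of "\<lambda>J. \<integral>\<^sup>+x. h J x \<partial>L" "\<lambda>_. liminf (\<lambda>n. \<integral>\<^sup>+x. f x \<partial>N n)" sequentially] lower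
    by (simp add: Liminf_const)
  finally show ?thesis .
qed

text \<open>
  Lower semicontinuity bounds the integrals of both \<open>f\<close> and \<open>- f\<close> from below, once they are made nonnegative.
\<close>

lemma integral_tendsto_cells:
  fixes N :: "nat \<Rightarrow> 'x::topological_space measure" and L :: "'x measure"
    and c :: "nat \<Rightarrow> 'x \<Rightarrow> 'l" and S :: "nat \<Rightarrow> 'l set" and f :: "'x \<Rightarrow> real"
  assumes N: "\<And>n. prob_space (N n)" "\<And>n. sets (N n) = sets borel"
    and L: "prob_space L" "sets L = sets borel"
    and S: "\<And>J. countable (S J)" and cells: "\<And>J s. s \<in> S J \<Longrightarrow> {x. c J x = s} \<in> sets borel"
    and lim: "\<And>J s. s \<in> S J \<Longrightarrow> (\<lambda>n. measure (N n) {x. c J x = s}) \<longlonglongrightarrow> measure L {x. c J x = s}"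
    and AE: "AE x in L. (\<forall>J. c J x \<in> S J) \<and>
      (\<forall>V. open V \<longrightarrow> x \<in> V \<longrightarrow> eventually (\<lambda>J. \<forall>x'. c J x' = c J x \<longrightarrow> x' \<in> V) sequentially)"
    and f: "continuous_on UNIV f" "bounded (range f)"
  shows "(\<lambda>n. \<integral>x. f x \<partial>N n) \<longlonglongrightarrow> (\<integral>x. f x \<partial>L)"
proof -
  obtain B where B: "\<And>x. \<bar>f x\<bar> \<le> B" using f(2) by (auto simp: bounded_iff)
  have int: "integrable K g" if "prob_space K" "sets K = sets borel" "continuous_on UNIV g" "\<And>x. \<bar>g x\<bar> \<le> C"
    for K :: "'x measure" and g :: "'x \<Rightarrow> real" and C
  proof -
    interpret K: prob_space K by fact
    have "g \<in> borel_measurable K"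
      using borel_measurable_continuous_onI[OF that(3)] measurable_cong_sets[OF that(2) refl] by blast
    then show ?thesis using that(4) by (intro K.integrable_const_bound[of _ C]) auto
  qed
  have lower: "eventually (\<lambda>n. (\<integral>x. g x \<partial>L) - e < (\<integral>x. g x \<partial>N n)) sequentially"
    if g: "continuous_on UNIV g" "\<And>x. \<bar>g x\<bar> \<le> B" and e: "e > 0" for g :: "'x \<Rightarrow> real" and e
  proof -
    have "\<bar>g undefined\<bar> \<le> B" by (rule g(2))
    then have B0: "B \<ge> 0" by linarith
    let ?g = "\<lambda>x. g x + B"
    have g': "continuous_on UNIV ?g" "\<And>x. 0 \<le> ?g x" "\<And>x. ?g x \<le> 2 * B"
      using g(2) by (auto intro!: continuous_intros g(1) simp: abs_le_iff) (smt (verit) g(2))+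
    have eq: "(\<integral>\<^sup>+x. ?g x \<partial>K) = ennreal ((\<integral>x. g x \<partial>K) + B)" and nonneg: "(\<integral>x. g x \<partial>K) + B \<ge> 0"
      if K: "prob_space K" "sets K = sets borel" for K :: "'x measure"
    proof -
      interpret K: prob_space K by fact
      have ig: "integrable K g" by (rule int[OF K g])
      have "(\<integral>x. ?g x \<partial>K) = (\<integral>x. g x \<partial>K) + B" using ig by (simp add: K.prob_space)
      moreover have "(\<integral>\<^sup>+x. ?g x \<partial>K) = ennreal (\<integral>x. ?g x \<partial>K)"
        using ig g'(2) by (intro nn_integral_eq_integral) auto
      moreover have "(\<integral>x. ?g x \<partial>K) \<ge> 0" using g'(2) by (simp add: integral_nonneg_AE)
      ultimately show "(\<integral>\<^sup>+x. ?g x \<partial>K) = ennreal ((\<integral>x. g x \<partial>K) + B)" "(\<integral>x. g x \<partial>K) + B \<ge> 0" by auto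
    qed
    (* Adding B makes the function nonnegative; the constant cancels since all measures have mass one. *)
    have "ennreal ((\<integral>x. g x \<partial>L) + B) \<le> liminf (\<lambda>n. ennreal ((\<integral>x. g x \<partial>N n) + B))"
      using lower_semicontinuity_cells[OF N L S cells lim AE g'] eq[OF L] eq[OF N] by simp
    then have *: "\<forall>y<ennreal ((\<integral>x. g x \<partial>L) + B). eventually (\<lambda>n. y < ennreal ((\<integral>x. g x \<partial>N n) + B)) sequentially"
      by (simp only: le_Liminf_iff)
    show ?thesis
    proof (cases "(\<integral>x. g x \<partial>L) + B - e \<ge> 0")
      case True
      have "ennreal ((\<integral>x. g x \<partial>L) + B - e) < ennreal ((\<integral>x. g x \<partial>L) + B)"
        using True e by (intro ennreal_lessI) auto
      then have "eventually (\<lambda>n. ennreal ((\<integral>x. g x \<partial>L) + B - e) < ennreal ((\<integral>x. g x \<partial>N n) + B)) sequentially"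
        using * by blast
      then show ?thesis by eventually_elim (use True in \<open>simp add: ennreal_less_iff\<close>)
    next
      case False
      have "(\<integral>x. g x \<partial>L) - e < (\<integral>x. g x \<partial>N n)" for n using False nonneg[OF N, of n] by linarith
      then show ?thesis by simp
    qed
  qed
  show ?thesis
  proof (rule tendstoI)
    fix e :: real assume e: "e > 0"
    have "eventually (\<lambda>n. (\<integral>x. - f x \<partial>L) - e < (\<integral>x. - f x \<partial>N n)) sequentially"
      by (rule lower[OF _ _ e]) (use B f(1) in \<open>auto intro: continuous_intros\<close>)
    moreover have "eventually (\<lambda>n. (\<integral>x. f x \<partial>L) - e < (\<integral>x. f x \<partial>N n)) sequentially"
      by (rule lower[OF f(1) B e])
    ultimately show "eventually (\<lambda>n. dist (\<integral>x. f x \<partial>N n) (\<integral>x. f x \<partial>L) < e) sequentially"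
      by eventually_elim (auto simp: dist_real_def abs_less_iff)
  qed
qed

section \<open>Conditioning on a large generation\<close>

context geometric_offspring
begin

lemma gap_eq:
  assumes "\<eta> \<noteq> q" "n \<ge> 1"
  shows "gap n = (kappa - 1)\<^sup>2 * ((\<eta> / q) ^ n / (1 - (\<eta> / q) ^ n)\<^sup>2)"
  unfolding gap_def g_minus_fixed_point(1)[OF assms(2,1)] g_minus_fixed_point(2)[OF assms(2,1)]
  by (simp add: power2_eq_square mult_ac)

text \<open>
  In the three regimes \<open>gap n\<close> is bounded below by a multiple of $\mu^n$, $n^{-2}$ and $\mu^{-n}$
  respectively.
\<close>

lemma filterlim_size_times_gap:
  fixes a :: "nat \<Rightarrow> nat"
  assumes sub: "\<eta> / q < 1 \<Longrightarrow> filterlim (\<lambda>n. real (a n) * (\<eta> / q) ^ n) at_top sequentially"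
    and crit: "\<eta> / q = 1 \<Longrightarrow> filterlim (\<lambda>n. real (a n) / real n ^ 2) at_top sequentially"
    and super: "\<eta> / q > 1 \<Longrightarrow> filterlim (\<lambda>n. real (a n) / (\<eta> / q) ^ n) at_top sequentially"
  shows "filterlim (\<lambda>n. real (a n) * gap n) at_top sequentially"
proof -
  have main: "filterlim (\<lambda>n. real (a n) * gap n) at_top sequentially"
    if C: "C > 0" and v: "filterlim (\<lambda>n. real (a n) * v n) at_top sequentially"
      and le: "\<And>n. n \<ge> 1 \<Longrightarrow> C * v n \<le> gap n" for C and v :: "nat \<Rightarrow> real"
  proof (rule filterlim_at_top_mono)
    show "filterlim (\<lambda>n. C * (real (a n) * v n)) at_top sequentially"
      by (rule filterlim_tendsto_pos_mult_at_top[OF tendsto_const C v])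
    have "C * (real (a n) * v n) \<le> real (a n) * gap n" if "n \<ge> 1" for n
      using mult_left_mono[OF le[OF that], of "real (a n)"] by (simp add: mult_ac)
    then show "eventually (\<lambda>n. C * (real (a n) * v n) \<le> real (a n) * gap n) sequentially"
      by (auto simp: eventually_sequentially)
  qed
  have k: "kappa \<noteq> 1" if "\<eta> \<noteq> q" using that q_less by (auto simp: kappa_def)
  consider "\<eta> / q < 1" "\<eta> \<noteq> q" | "\<eta> = q" | "\<eta> / q > 1" "\<eta> \<noteq> q" using q_pos by (cases "\<eta> < q"; cases "\<eta> = q") auto
  then show ?thesis
  proof cases
    case 1
    show ?thesis
    proof (rule main[OF _ sub[OF 1(1)]])
      show "(kappa - 1)\<^sup>2 > 0" using k[OF 1(2)] by simp
      fix n :: nat assume n: "n \<ge> 1"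
      define x where "x = (\<eta> / q) ^ n"
      have x: "0 < x" "x < 1" using 1(1) eta_pos q_pos n by (auto simp: x_def power_less_one_iff)
      then have "(1 - x)\<^sup>2 \<le> 1" "(1 - x)\<^sup>2 > 0" by (auto intro: power_le_one)
      then have "x \<le> x / (1 - x)\<^sup>2" using x by (simp add: field_simps)
      then show "(kappa - 1)\<^sup>2 * (\<eta> / q) ^ n \<le> gap n"
        unfolding gap_eq[OF 1(2) n] x_def[symmetric] by (intro mult_left_mono) auto
    qed
  next
    case 2
    have "filterlim (\<lambda>n. real (a n) * (1 / real n ^ 2)) at_top sequentially" using crit 2 q_pos by simp
    then show ?thesis
    proof (rule main[rotated])
      show "(q / (1 - q))\<^sup>2 > 0" using q_pos q_less by simp
      show "(q / (1 - q))\<^sup>2 * (1 / real n ^ 2) \<le> gap n" if "n \<ge> 1" for n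
        using g_minus_fixed_point(3,4)[OF that 2] by (simp add: gap_def power2_eq_square mult_ac)
    qed
  next
    case 3
    have "filterlim (\<lambda>n. real (a n) * (1 / (\<eta> / q) ^ n)) at_top sequentially" using super[OF 3(1)] by simp
    then show ?thesis
    proof (rule main[rotated])
      show "(kappa - 1)\<^sup>2 > 0" using k[OF 3(2)] by simp
      fix n :: nat assume n: "n \<ge> 1"
      define x where "x = (\<eta> / q) ^ n"
      have x: "1 < x" using 3(1) n by (auto simp: x_def intro: one_less_power)
      then have "(x - 1)\<^sup>2 \<le> x\<^sup>2" "(1 - x)\<^sup>2 > 0" by (auto intro: power_mono)
      then have "1 / x \<le> x / (1 - x)\<^sup>2" using x by (simp add: field_simps power2_eq_square)
      then show "(kappa - 1)\<^sup>2 * (1 / (\<eta> / q) ^ n) \<le> gap n"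
        unfolding gap_eq[OF 3(2) n] x_def[symmetric] by (intro mult_left_mono) auto
    qed
  qed
qed

end

theorem proposition6p4:
  fixes \<eta> q \<mu> :: real and a :: "nat \<Rightarrow> nat"
    and M :: "'a measure" and \<tau> :: "'a \<Rightarrow> tree"
    and N :: "nat \<Rightarrow> 'b measure" and \<tau>\<^sub>n :: "nat \<Rightarrow> 'b \<Rightarrow> tree"
    and L :: "'c measure" and \<tau>_inf :: "'c \<Rightarrow> tree"
  assumes "0 < \<eta>" "\<eta> \<le> 1" "0 < q" "q < 1"
    and "\<mu> = \<eta> / q"
    and "\<And>n. n \<ge> 1 \<Longrightarrow> a n \<ge> 1"
    and "galton_watson_tree (geo_offspring \<eta> q) M \<tau>"
    and "\<And>n. n \<ge> 1 \<Longrightarrow> random_tree (N n) (\<tau>\<^sub>n n)"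
    and "\<And>n. n \<ge> 1 \<Longrightarrow>
           distr (N n) borel (\<tau>\<^sub>n n) =
           distr (uniform_measure M {\<omega> \<in> space M. gen_size n (\<tau> \<omega>) = enat (a n)}) borel \<tau>"
    and "inhom_galton_watson_tree (tilted_law \<eta> q) L \<tau>_inf"
    and "\<mu> < 1 \<Longrightarrow> filterlim (\<lambda>n. real (a n) * \<mu> ^ n) at_top sequentially"
    and "\<mu> = 1 \<Longrightarrow> filterlim (\<lambda>n. real (a n) / real n ^ 2) at_top sequentially"
    and "\<mu> > 1 \<Longrightarrow> filterlim (\<lambda>n. real (a n) / \<mu> ^ n) at_top sequentially"
  shows "converges_in_distribution N \<tau>\<^sub>n L \<tau>_inf"
proof -
  interpret geometric_offspring \<eta> q using assms(1-4) by unfold_locales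
  interpret gw: galton_watson "geo_offspring \<eta> q" M \<tau>
    using assms(7) geo_offspring_nonneg by unfold_locales
  have gap_lim: "filterlim (\<lambda>n. real (a n) * gap n) at_top sequentially"
    using assms(11-13) unfolding assms(5) by (rule filterlim_size_times_gap)
  define E where "E n = {\<omega> \<in> space M. gen_size n (\<tau> \<omega>) = enat (a n)}" for n
  have E: "E n = {\<omega> \<in> space M. card (level n (\<tau> \<omega>)) = a n}" for n
    using gw.\<tau>_locally_finite by (auto simp: E_def gen_size_locally_finite)
  define Q where "Q n = distr (N n) borel (\<tau>\<^sub>n n)" for n
  define Q_inf where "Q_inf = distr L borel \<tau>_inf"
  have Q_prob: "prob_space (Q n)" if "n \<ge> 1" for n
    using assms(8)[OF that] unfolding Q_def random_tree_def by (intro prob_space.prob_space_distr) auto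
  have lim_law: "random_tree L \<tau>_inf" "Q_inf = inhom_gw_law (tilted_law \<eta> q)"
    using assms(10) by (auto simp: inhom_galton_watson_tree_def Q_inf_def)
  have Q_inf_prob: "prob_space Q_inf"
    using lim_law(1) unfolding Q_inf_def random_tree_def by (intro prob_space.prob_space_distr) auto
  have cell_lim: "(\<lambda>n. measure (Q n) {t. prune J t = s}) \<longlonglongrightarrow> measure Q_inf {t. prune J t = s}"
    if J: "J \<ge> 1" and s: "s \<in> finite_trees J" "num_children [] s = enat J" for J s
  proof -
    define P where "P = (\<Prod>u\<in>{u \<in> nodes s. 0 < length u \<and> length u < J}. geo_offspring \<eta> q (num_kids u s)) * (1 - q) ^ J"
    define R where "R n = fps_nth ((gen_fps n + fps_const shift_const) * gen_fps (n - J) ^ card (level J s)) (a n) /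
        fps_nth (gen_fps n) (a n)" for n
    have "measure (Q n) {t. prune J t = s} = P * R n" if n: "n > J" for n
    proof -
      have n1: "n \<ge> 1" "n - J \<ge> 1" "n - J + J = n" using n by auto
      have PE: "measure M (E n) = fps_nth (gen_fps n) (a n)"
        unfolding E by (rule prob_generation_size[OF assms(7) n1(1)])
      have pos: "measure M (E n) > 0"
        unfolding PE using g_gt[OF n1(1)] gap_pos[OF n1(1)] assms(6)[OF n1(1)] by (simp add: gen_fps_nth)
      have sets: "E n \<in> sets M" unfolding E by (rule gw.sets_card_level)
      have T: "\<tau> -` {t. prune J t = s} \<inter> space M \<in> sets M"
        by (rule measurable_sets[OF gw.measurable_\<tau> sets_prune])
      have "measure (Q n) {t. prune J t = s} = measure (uniform_measure M (E n)) (\<tau> -` {t. prune J t = s} \<inter> space M)"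
        unfolding Q_def assms(9)[OF n1(1)] E_def[symmetric]
        by (subst measure_distr) (auto simp: sets_prune)
      also have "\<dots> = measure M (E n \<inter> (\<tau> -` {t. prune J t = s} \<inter> space M)) / measure M (E n)"
        using pos T by (intro measure_uniform_measure) (simp_all add: gw.emeasure_eq_measure)
      also have "E n \<inter> (\<tau> -` {t. prune J t = s} \<inter> space M) =
          {\<omega> \<in> space M. prune J (\<tau> \<omega>) = s \<and> card (level (n - J + J) (\<tau> \<omega>)) = a n}"
        using n1(3) by (auto simp: E)
      finally show ?thesis
        using prob_prune_generation_size[OF assms(7) J s n1(2), of "a n"] n1(3)
        by (simp add: PE P_def R_def)
    qed
    then have ev: "eventually (\<lambda>n. P * R n = measure (Q n) {t. prune J t = s}) sequentially"
      by (auto simp: eventually_sequentially intro!: exI[of _ "Suc J"])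
    have "R \<longlonglongrightarrow> g J ^ card (level J s)"
      unfolding R_def[abs_def] by (rule coefficient_ratio_tendsto[OF J assms(6) gap_lim])
    then have "(\<lambda>n. P * R n) \<longlonglongrightarrow> P * g J ^ card (level J s)" by (intro tendsto_intros)
    moreover have "measure Q_inf {t. prune J t = s} = P * g J ^ card (level J s)"
      unfolding lim_law(2) P_def by (rule prob_prune_limit[OF J s])
    ultimately show ?thesis using Lim_transform_eventually[OF _ ev] by simp
  qed
  show ?thesis unfolding converges_in_distribution_def
  proof (intro allI impI)
    fix f :: "tree \<Rightarrow> real" assume f: "continuous_on UNIV f \<and> bounded (range f)"
    have fm: "f \<in> borel_measurable borel" using f by (intro borel_measurable_continuous_onI) auto
    (* The laws are probability measures from n = 1 on, and the root of a pruned tree has a child from J = 1 on; hence the shifts by one. *)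
    have "(\<lambda>n. \<integral>t. f t \<partial>Q (Suc n)) \<longlonglongrightarrow> (\<integral>t. f t \<partial>Q_inf)"
    proof (rule integral_tendsto_cells)
      let ?S = "\<lambda>J. {s \<in> finite_trees (Suc J). num_children [] s = enat (Suc J)}"
      show "countable (?S J)" for J
        by (rule countable_subset[OF _ countable_finite_trees[of "Suc J"]]) auto
      show "(\<lambda>n. measure (Q (Suc n)) {t. prune (Suc J) t = s}) \<longlonglongrightarrow> measure Q_inf {t. prune (Suc J) t = s}"
        if "s \<in> ?S J" for J s
        using LIMSEQ_Suc[OF cell_lim[of "Suc J" s]] that by simp
      show "AE t in Q_inf. (\<forall>J. prune (Suc J) t \<in> ?S J) \<and> (\<forall>V. open V \<longrightarrow> t \<in> V \<longrightarrow>
          eventually (\<lambda>J. \<forall>t'. prune (Suc J) t' = prune (Suc J) t \<longrightarrow> t' \<in> V) sequentially)"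
        unfolding lim_law(2) using AE_limit_root_infinite
      proof eventually_elim
        case (elim t)
        have "eventually (\<lambda>J. \<forall>t'. prune (Suc J) t' = prune (Suc J) t \<longrightarrow> t' \<in> V) sequentially"
          if "open V" "t \<in> V" for V
          using prune_neighbourhoods[OF elim that]
          by (rule eventually_sequentially_Suc[THEN iffD2])
        then show ?case using prune_root_infinite[OF elim] by simp
      qed
    qed (use f Q_prob Q_inf_prob sets_prune in \<open>auto simp: Q_def Q_inf_def\<close>)
    moreover have "(\<integral>t. f t \<partial>Q (Suc n)) = (\<integral>\<omega>. f (\<tau>\<^sub>n (Suc n) \<omega>) \<partial>N (Suc n))" for n
      unfolding Q_def using assms(8)[of "Suc n"] fm by (intro integral_distr) (auto simp: random_tree_def)
    moreover have "(\<integral>t. f t \<partial>Q_inf) = (\<integral>\<omega>. f (\<tau>_inf \<omega>) \<partial>L)"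
      unfolding Q_inf_def using lim_law(1) fm by (intro integral_distr) (auto simp: random_tree_def)
    ultimately have "(\<lambda>n. \<integral>\<omega>. f (\<tau>\<^sub>n (Suc n) \<omega>) \<partial>N (Suc n)) \<longlonglongrightarrow> (\<integral>\<omega>. f (\<tau>_inf \<omega>) \<partial>L)" by simp
    then show "(\<lambda>n. \<integral>\<omega>. f (\<tau>\<^sub>n n \<omega>) \<partial>N n) \<longlonglongrightarrow> (\<integral>\<omega>. f (\<tau>_inf \<omega>) \<partial>L)"
      by (rule LIMSEQ_imp_Suc)
  qed
qed

end
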